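(* Let $d\geqslant1$, let $W\subset\mathbb{R}^d$ be a polyrectangle, and let $f:W\to\mathbb{R}$ be a $\mathcal{C}^{1,1}$ function. Let $\lambda\in\mathbb{R}$ and let $F=\{x\in W:f(x)\geqslant\lambda\}$ or $F=\{x\in W: f(x)>\lambda\}$. Assume that $f$ is regular within $W$ at level $\lambda$. (i) For every $d\geqslant1$, $$\#\Gamma(F\cap W)\leqslant\sum_{k=0}^{d}2^{k}\kappa_k^{-1}I_k(f-\lambda;W),$$ where $\kappa_k$ is the volume of the $k$-dimensional unit ball. (ii) If $d=2$, then for $\varepsilon>0$, $$\#\Gamma\big((F\cap W)^{\varepsilon}\big)\leqslant C\sum_{k=0}^{2}I_k(f-\lambda;W)$$ for some $C>0$ not depending on $f$, $\lambda$ or $\varepsilon$.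
   Context: $(\mathbf{u}_i)$ is the canonical basis of $\mathbb{R}^d$. A rectangle of $\mathbb{R}^d$ is a set $I_1\times\dots\times I_d$ where the $I_k$ are possibly infinite closed intervals with non-empty interior; its corners are the points whose coordinates are (finite) extremities of the $I_k$. A polyrectangle is a finite union $\bigcup_iW_i$ of rectangles with $\mathrm{corners}(W_i)\cap\mathrm{corners}(W_j)=\emptyset$ for $i\neq j$. For a polyrectangle $W$ and $x\in W$, let $I_x(W)=\{1,\dots,d\}$ if $x\in\mathrm{int}(W)$, and otherwise let $I_x(W)$ be the set of indices $i$ such that $x+\varepsilon\mathbf{u}_i\in\partial W$ and $x-\varepsilon\mathbf{u}_i\in\partial W$ for arbitrarily small $\varepsilon>0$. Let $\partial_kW=\{x\in W:|I_x(W)|=k\}$, and $\mathrm{corners}(W)=\partial_0W$. A function is $\mathcal{C}^{1,1}$ if it is differentiable with locally Lipschitz gradient. $f$ is regular within $W$ at level $\lambda$ if for every $0\leqslant k\leqslant d$, $\{x\in\partial_kW: f(x)=\lambda,\ \partial_if(x)=0 \text{ for all } i\in I_x(W)\}=\emptyset$. $\Gamma(A)$ is the class of bounded arc-wise connected components of $A$; $\#$ is cardinality. For $A\subset\mathbb{R}^2$ and $\varepsilon>0$, $A^{\varepsilon}=\bigcup_{x\in\varepsilon\mathbb{Z}^2\cap A}(x+\varepsilon[-1/2,1/2)^2)$. $\mathrm{Lip}(g)\in[0,\infty]$ is the Lipschitz constant of $g$ on $W$, and $\mathcal{H}^k_d$ is $k$-dimensional Hausdorff measure in $\mathbb{R}^d$.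 For $1\leqslant k\leqslant d$, define the possibly infinite quantity $$I_k(g;W)=\max\big(\mathrm{Lip}(g),\mathrm{Lip}(\partial_ig),1\leqslant i\leqslant d\big)^k\int_{\partial_kW}\frac{\mathcal{H}^k_d(dx)}{\max\big(|g(x)|,|\partial_ig(x)|,\,i\in I_x(W)\big)^k},$$ with $I_k(g;W)=0$ if $\mathrm{Lip}(g)=0$ and $g$ vanishes, and $I_0(g;W)=\#\mathrm{corners}(W)$. *)

theory Defs
  imports "HOL-Analysis.Analysis"
begin

text \<open>A rectangle is given by the family of its sides; the finite extremities of a closed
  interval with non-empty interior are exactly its frontier points.\<close>

definition rect_sides :: "('n \<Rightarrow> real set) \<Rightarrow> bool" where
  "rect_sides I \<longleftrightarrow> (\<forall>k. is_interval (I k) \<and> closed (I k) \<and> interior (I k) \<noteq> {})"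

definition rectangle :: "('n \<Rightarrow> real set) \<Rightarrow> (real ^ 'n) set" where
  "rectangle I = {x. \<forall>k. x $ k \<in> I k}"

definition rect_corners :: "('n \<Rightarrow> real set) \<Rightarrow> (real ^ 'n) set" where
  "rect_corners I = {x. \<forall>k. x $ k \<in> frontier (I k)}"

definition polyrectangle :: "(real ^ 'n) set \<Rightarrow> bool" where
  "polyrectangle W \<longleftrightarrow>
    (\<exists>(m::nat) I. (\<forall>i<m. rect_sides (I i)) \<and> W = (\<Union>i<m. rectangle (I i)) \<and>
       (\<forall>i<m. \<forall>j<m. i \<noteq> j \<longrightarrow> rect_corners (I i) \<inter> rect_corners (I j) = {}))"

definition free_dirs :: "(real ^ 'n) set \<Rightarrow> real ^ 'n \<Rightarrow> 'n set" where
  "free_dirs W x =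
    (if x \<in> interior W then UNIV
     else {i. \<forall>\<delta>>0. \<exists>\<epsilon>. 0 < \<epsilon> \<and> \<epsilon> < \<delta> \<and>
              x + \<epsilon> *\<^sub>R axis i 1 \<in> frontier W \<and> x - \<epsilon> *\<^sub>R axis i 1 \<in> frontier W})"

definition bdry :: "nat \<Rightarrow> (real ^ 'n) set \<Rightarrow> (real ^ 'n) set" where
  "bdry k W = {x \<in> W. card (free_dirs W x) = k}"

definition corners :: "(real ^ 'n) set \<Rightarrow> (real ^ 'n) set" where
  "corners W = bdry 0 W"

text \<open>Derivatives are taken within \<open>W\<close>. They are unique there, because every point of a
  polyrectangle is a vertex of a small non-degenerate cube contained in it.\<close>

definition pd :: "(real ^ 'n) set \<Rightarrow> 'n \<Rightarrow> (real ^ 'n \<Rightarrow> real) \<Rightarrow> real ^ 'n \<Rightarrow> real" where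
  "pd W i f x = frechet_derivative f (at x within W) (axis i 1)"

definition C11_on :: "(real ^ 'n) set \<Rightarrow> (real ^ 'n \<Rightarrow> real) \<Rightarrow> bool" where
  "C11_on W f \<longleftrightarrow> f differentiable_on W \<and>
    (\<forall>x\<in>W. \<exists>r>0. \<exists>K. K-lipschitz_on (ball x r \<inter> W) (\<lambda>y. \<chi> i. pd W i f y))"

definition regular_within :: "(real ^ 'n) set \<Rightarrow> (real ^ 'n \<Rightarrow> real) \<Rightarrow> real \<Rightarrow> bool" where
  "regular_within W f l \<longleftrightarrow>
    (\<forall>k\<le>CARD('n). {x \<in> bdry k W. f x = l \<and> (\<forall>i\<in>free_dirs W x. pd W i f x = 0)} = {})"

definition Lip :: "(real ^ 'n) set \<Rightarrow> (real ^ 'n \<Rightarrow> real) \<Rightarrow> ennreal" where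
  "Lip W g = (INF K\<in>{K. K-lipschitz_on W g}. ennreal K)"

text \<open>Normalised so that \<open>k\<close>-dimensional Hausdorff measure agrees with Lebesgue measure on
  \<open>k\<close>-dimensional flats.\<close>

definition hausdorff_gauge :: "nat \<Rightarrow> 'a::metric_space set \<Rightarrow> ennreal" where
  "hausdorff_gauge k U =
    (if U = {} then 0 else ennreal (unit_ball_vol (real k) * (diameter U / 2) ^ k))"

definition hausdorff_pre :: "nat \<Rightarrow> real \<Rightarrow> 'a::metric_space set \<Rightarrow> ennreal" where
  "hausdorff_pre k \<delta> A =
    (INF U\<in>{U :: nat \<Rightarrow> 'a set. A \<subseteq> (\<Union>j. U j) \<and> (\<forall>j. bounded (U j) \<and> diameter (U j) \<le> \<delta>)}.
       \<Sum>j. hausdorff_gauge k (U j))"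

definition hausdorff_outer :: "nat \<Rightarrow> 'a::metric_space set \<Rightarrow> ennreal" where
  "hausdorff_outer k A = (SUP \<delta>\<in>{0<..}. hausdorff_pre k \<delta> A)"

definition hausdorff :: "nat \<Rightarrow> 'a::metric_space measure" where
  "hausdorff k = measure_of UNIV (sets borel) (hausdorff_outer k)"

text \<open>The outer measure is a genuine measure on the Borel sets (Caratheodory's criterion), so
  \<open>hausdorff k\<close> is not degenerate: see \<open>emeasure_hausdorff\<close> below.\<close>

lemma hausdorff_gauge_empty [simp]: "hausdorff_gauge k {} = 0"
  by (simp add: hausdorff_gauge_def)

lemma hausdorff_pre_mono: "A \<subseteq> B \<Longrightarrow> hausdorff_pre k d A \<le> hausdorff_pre k d B"
  unfolding hausdorff_pre_def by (rule INF_superset_mono) auto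

lemma hausdorff_pre_antimono: "d \<le> e \<Longrightarrow> hausdorff_pre k e A \<le> hausdorff_pre k d A"
  unfolding hausdorff_pre_def by (rule INF_superset_mono) (auto intro: order_trans)

lemma hausdorff_outer_mono: "A \<subseteq> B \<Longrightarrow> hausdorff_outer k A \<le> hausdorff_outer k B"
  unfolding hausdorff_outer_def by (rule SUP_mono') (rule hausdorff_pre_mono)

lemma hausdorff_outer_empty [simp]: "hausdorff_outer k {} = 0"
proof -
  have "hausdorff_pre k d ({}::'a set) \<le> (\<Sum>j. hausdorff_gauge k ({}::'a set))" if "d > 0" for d
    unfolding hausdorff_pre_def using that by (intro INF_lower2[of "\<lambda>_. {}"]) auto
  then show ?thesis
    by (simp add: hausdorff_outer_def SUP_eq_iff)
qed

lemma hausdorff_pre_UN_le: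
  fixes A :: "nat \<Rightarrow> 'a::metric_space set"
  shows "hausdorff_pre k d (\<Union>n. A n) \<le> (\<Sum>n. hausdorff_pre k d (A n))"
proof (rule ennreal_le_epsilon)
  fix e :: real
  assume e: "0 < e" and fin: "(\<Sum>n. hausdorff_pre k d (A n)) < top"
  have "\<exists>U. A n \<subseteq> (\<Union>j. U j) \<and> (\<forall>j. bounded (U j) \<and> diameter (U j) \<le> d) \<and>
      (\<Sum>j. hausdorff_gauge k (U j)) \<le> hausdorff_pre k d (A n) + ennreal (e * (1/2) ^ Suc n)" for n
  proof -
    have "hausdorff_pre k d (A n) \<noteq> top"
      using fin by (metis ennreal_suminf_lessD less_irrefl)
    then have "hausdorff_pre k d (A n) < hausdorff_pre k d (A n) + ennreal (e * (1/2) ^ Suc n)"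
      using e by (simp add: ennreal_add_left_cancel_less less_top[symmetric] flip: ennreal_zero_less_mult_iff)
    then show ?thesis
      by (subst (asm) (1) hausdorff_pre_def) (auto simp: INF_less_iff intro: less_imp_le)
  qed
  then obtain U where U: "\<And>n. A n \<subseteq> (\<Union>j. U n j)" "\<And>n j. bounded (U n j)"
      "\<And>n j. diameter (U n j) \<le> d"
      "\<And>n. (\<Sum>j. hausdorff_gauge k (U n j)) \<le> hausdorff_pre k d (A n) + ennreal (e * (1/2) ^ Suc n)"
    by metis
  define V where "V = (\<lambda>m. case prod_decode m of (n, j) \<Rightarrow> U n j)"
  have cover: "(\<Union>n. A n) \<subseteq> (\<Union>m. V m)"
  proof
    fix x assume "x \<in> (\<Union>n. A n)"
    then obtain n j where "x \<in> U n j" using U(1) by blast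
    then have "x \<in> V (prod_encode (n, j))" by (simp add: V_def)
    then show "x \<in> (\<Union>m. V m)" by blast
  qed
  have "hausdorff_pre k d (\<Union>n. A n) \<le> (\<Sum>m. hausdorff_gauge k (V m))"
    unfolding hausdorff_pre_def
    using cover U(2,3) by (intro INF_lower) (auto simp: V_def split: prod.splits)
  also have "\<dots> = (\<Sum>m. (\<lambda>(n, j). hausdorff_gauge k (U n j)) (prod_decode m))"
    by (simp add: V_def prod.case_distrib case_prod_beta)
  also have "\<dots> = (\<Sum>n. \<Sum>j. hausdorff_gauge k (U n j))"
    using suminf_ennreal_2dimen[of "\<lambda>n. \<Sum>j. hausdorff_gauge k (U n j)" "\<lambda>(n, j). hausdorff_gauge k (U n j)"]
    by (simp add: o_def)
  also have "\<dots> \<le> (\<Sum>n. hausdorff_pre k d (A n) + ennreal (e * (1/2) ^ Suc n))"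
    by (intro suminf_le U(4)) auto
  also have "\<dots> = (\<Sum>n. hausdorff_pre k d (A n)) + (\<Sum>n. ennreal (e * (1/2) ^ Suc n))"
    by (rule suminf_add[symmetric]) auto
  also have "(\<Sum>n. ennreal (e * (1/2) ^ Suc n)) = ennreal e"
    using e sums_mult[OF power_half_series, of e] by (intro suminf_ennreal_eq) auto
  finally show "hausdorff_pre k d (\<Union>n. A n) \<le> (\<Sum>n. hausdorff_pre k d (A n)) + ennreal e" .
qed

lemma hausdorff_outer_UN_le:
  fixes A :: "nat \<Rightarrow> 'a::metric_space set"
  shows "hausdorff_outer k (\<Union>n. A n) \<le> (\<Sum>n. hausdorff_outer k (A n))"
  unfolding hausdorff_outer_def
  by (rule SUP_least, rule order_trans[OF hausdorff_pre_UN_le]) (intro suminf_le SUP_upper; auto)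

lemma outer_measure_space_hausdorff:
  "outer_measure_space (UNIV :: 'a::metric_space set set) (hausdorff_outer k)"
  unfolding outer_measure_space_def positive_def increasing_def countably_subadditive_def
  using hausdorff_outer_mono hausdorff_outer_UN_le by auto

lemma hausdorff_outer_Un_le:
  fixes A B :: "'a::metric_space set"
  shows "hausdorff_outer k (A \<union> B) \<le> hausdorff_outer k A + hausdorff_outer k B"
proof -
  have "subadditive (Pow (UNIV :: 'a set)) (hausdorff_outer k)"
    using outer_measure_space_hausdorff[of k, where 'a = 'a]
    unfolding outer_measure_space_def
    by (intro ring_of_sets.countably_subadditive_subadditive[OF ring_of_sets_Pow]) auto
  then have disj: "hausdorff_outer k (X \<union> Y) \<le> hausdorff_outer k X + hausdorff_outer k Y"
    if "X \<inter> Y = {}" for X Y :: "'a set"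
    using that unfolding subadditive_def by auto
  have "hausdorff_outer k (A \<union> (B - A)) \<le> hausdorff_outer k A + hausdorff_outer k (B - A)"
    by (rule disj) auto
  also have "\<dots> \<le> hausdorff_outer k A + hausdorff_outer k B"
    by (intro add_left_mono hausdorff_outer_mono) auto
  finally show ?thesis by simp
qed

lemma hausdorff_pre_separated:
  fixes A B :: "'a::metric_space set"
  assumes "d < r" and sep: "\<And>x y. x \<in> A \<Longrightarrow> y \<in> B \<Longrightarrow> r \<le> dist x y"
  shows "hausdorff_pre k d A + hausdorff_pre k d B \<le> hausdorff_pre k d (A \<union> B)"
proof (subst (3) hausdorff_pre_def, rule INF_greatest)
  fix U :: "nat \<Rightarrow> 'a set"
  assume "U \<in> {U. A \<union> B \<subseteq> (\<Union>j. U j) \<and> (\<forall>j. bounded (U j) \<and> diameter (U j) \<le> d)}"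
  then have U: "A \<union> B \<subseteq> (\<Union>j. U j)" "\<And>j. bounded (U j)" "\<And>j. diameter (U j) \<le> d"
    by auto
  define V where "V = (\<lambda>j. if U j \<inter> A \<noteq> {} then U j else {})"
  define V' where "V' = (\<lambda>j. if U j \<inter> A \<noteq> {} then {} else U j)"
  have d0: "0 \<le> d" using U(2,3)[of 0] diameter_ge_0 order_trans by blast
  have A: "A \<subseteq> (\<Union>j. V j)" using U(1) by (fastforce simp: V_def)
  have B: "B \<subseteq> (\<Union>j. V' j)"
  proof
    fix y assume y: "y \<in> B"
    then obtain j where j: "y \<in> U j" using U(1) by auto
    have "U j \<inter> A = {}"
    proof (rule ccontr)
      assume "U j \<inter> A \<noteq> {}"
      then obtain x where "x \<in> U j" "x \<in> A" by auto
      then have "r \<le> dist x y" "dist x y \<le> diameter (U j)"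
        using sep y j U(2) diameter_bounded_bound by blast+
      then show False using U(3)[of j] \<open>d < r\<close> by linarith
    qed
    then show "y \<in> (\<Union>j. V' j)" using j by (auto simp: V'_def)
  qed
  have "hausdorff_pre k d A \<le> (\<Sum>j. hausdorff_gauge k (V j))"
    unfolding hausdorff_pre_def using A U(2,3) d0 by (intro INF_lower) (auto simp: V_def)
  moreover have "hausdorff_pre k d B \<le> (\<Sum>j. hausdorff_gauge k (V' j))"
    unfolding hausdorff_pre_def using B U(2,3) d0 by (intro INF_lower) (auto simp: V'_def)
  ultimately have "hausdorff_pre k d A + hausdorff_pre k d B
      \<le> (\<Sum>j. hausdorff_gauge k (V j)) + (\<Sum>j. hausdorff_gauge k (V' j))"
    by (rule add_mono)
  also have "\<dots> = (\<Sum>j. hausdorff_gauge k (V j) + hausdorff_gauge k (V' j))"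
    by (rule suminf_add) auto
  also have "\<dots> = (\<Sum>j. hausdorff_gauge k (U j))"
    by (rule suminf_cong) (auto simp: V_def V'_def)
  finally show "hausdorff_pre k d A + hausdorff_pre k d B \<le> (\<Sum>j. hausdorff_gauge k (U j))" .
qed

lemma hausdorff_outer_separated:
  fixes A B :: "'a::metric_space set"
  assumes "0 < r" and sep: "\<And>x y. x \<in> A \<Longrightarrow> y \<in> B \<Longrightarrow> r \<le> dist x y"
  shows "hausdorff_outer k A + hausdorff_outer k B \<le> hausdorff_outer k (A \<union> B)"
proof -
  have *: "hausdorff_pre k d A + hausdorff_pre k e B \<le> hausdorff_outer k (A \<union> B)"
    if "0 < d" "0 < e" for d e
  proof -
    define m where "m = min (min d e) (r / 2)"
    have m: "0 < m" "m \<le> d" "m \<le> e" "m < r" using that \<open>0 < r\<close> by (auto simp: m_def)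
    have "hausdorff_pre k d A + hausdorff_pre k e B \<le> hausdorff_pre k m A + hausdorff_pre k m B"
      using m by (intro add_mono hausdorff_pre_antimono)
    also have "\<dots> \<le> hausdorff_pre k m (A \<union> B)"
      using m sep by (intro hausdorff_pre_separated) auto
    also have "\<dots> \<le> hausdorff_outer k (A \<union> B)"
      unfolding hausdorff_outer_def using m by (intro SUP_upper) auto
    finally show ?thesis .
  qed
  have ne: "{0::real<..} \<noteq> {}" using zero_less_one by blast
  have "hausdorff_outer k A + hausdorff_outer k B =
      (SUP d\<in>{0<..}. SUP e\<in>{0<..}. hausdorff_pre k d A + hausdorff_pre k e B)"
    by (simp only: hausdorff_outer_def ennreal_SUP_add_left[OF ne] ennreal_SUP_add_right[OF ne, symmetric])
  also have "\<dots> \<le> hausdorff_outer k (A \<union> B)"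
    using * by (intro SUP_least) auto
  finally show ?thesis .
qed

lemma hausdorff_outer_closed_split:
  fixes S X :: "'a::metric_space set"
  assumes "closed S"
  shows "hausdorff_outer k (X \<inter> S) + hausdorff_outer k (X - S) \<le> hausdorff_outer k X"
proof (cases "S = {} \<or> hausdorff_outer k X = top")
  case True
  then show ?thesis by auto
next
  case False
  let ?H = "hausdorff_outer k :: 'a set \<Rightarrow> ennreal"
  from False have S: "S \<noteq> {}" and fin: "?H X \<noteq> top" by auto
  define T where "T n = {x \<in> X. 1 / real (Suc n) \<le> infdist x S}" for n
  define R where "R n = T (Suc n) - T n" for n
  have lip: "infdist x S - infdist y S \<le> dist x y" for x y
    using infdist_triangle[of x S y] by simp
  have gap: "1 / real (Suc (Suc m)) - 1 / real (Suc n) \<le> dist x y" if "x \<in> R m" "y \<in> R n" for x y m n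
    using that lip[of x y] by (auto simp: R_def T_def)
  have sum_le: "(\<Sum>j<N. ?H (R (2 * j + c))) \<le> ?H (\<Union>j<N. R (2 * j + c))" for N c
  proof (induction N)
    case (Suc N)
    have "(\<Sum>j<Suc N. ?H (R (2 * j + c))) \<le> ?H (\<Union>j<N. R (2 * j + c)) + ?H (R (2 * N + c))"
      using Suc by (simp add: add_right_mono)
    also have "\<dots> \<le> ?H ((\<Union>j<N. R (2 * j + c)) \<union> R (2 * N + c))"
    proof (rule hausdorff_outer_separated)
      let ?r = "if N = 0 then 1 else 1 / real (2 * N + c) - 1 / real (Suc (2 * N + c))"
      show "0 < ?r" by (simp add: frac_less2)
      fix x y assume "x \<in> (\<Union>j<N. R (2 * j + c))" and y: "y \<in> R (2 * N + c)"
      then obtain j where j: "j < N" "x \<in> R (2 * j + c)" by auto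
      have "1 / real (2 * N + c) \<le> 1 / real (Suc (Suc (2 * j + c)))"
        using j by (intro divide_left_mono) auto
      then show "?r \<le> dist x y"
        using gap[OF j(2) y] j(1) by simp
    qed
    also have "(\<Union>j<N. R (2 * j + c)) \<union> R (2 * N + c) = (\<Union>j<Suc N. R (2 * j + c))"
      by (auto simp: lessThan_Suc)
    finally show ?case .
  qed simp
  have RX: "R n \<subseteq> X" for n by (auto simp: R_def T_def)
  have half: "(\<Sum>j<N. ?H (R (2 * j + c))) \<le> ?H X" for N c
    using RX by (intro order_trans[OF sum_le] hausdorff_outer_mono) auto
  have bnd: "(\<Sum>n<N. ?H (R n)) \<le> ?H X + ?H X" for N
  proof -
    have "(\<Sum>n<N. ?H (R n)) \<le> (\<Sum>n<2 * N. ?H (R n))"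
      by (rule sum_mono2) auto
    also have "\<dots> = (\<Sum>j<N. ?H (R (2 * j + 0))) + (\<Sum>j<N. ?H (R (2 * j + 1)))"
      by (induction N) (auto simp: add_ac)
    also have "\<dots> \<le> ?H X + ?H X" by (intro add_mono half)
    finally show ?thesis .
  qed
  have "(\<Sum>n. ?H (R n)) \<le> ?H X + ?H X"
    by (rule suminf_le_const[OF summableI bnd])
  then have fin': "(\<Sum>n. ?H (R n)) \<noteq> top"
    using fin by (auto simp: top_unique)
  have step: "?H (X \<inter> S) + ?H (X - S) \<le> ?H X + (\<Sum>m. ?H (R (m + n)))" for n
  proof -
    have "X - S \<subseteq> T n \<union> (\<Union>m. R (m + n))"
    proof
      fix x assume x: "x \<in> X - S"
      then have "infdist x S > 0"
        using in_closed_iff_infdist_zero[OF \<open>closed S\<close> S] infdist_nonneg[of x S] by force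
      then obtain N where "1 / real (Suc N) < infdist x S"
        using reals_Archimedean by (metis inverse_eq_divide)
      then have ex: "x \<in> T N" using x by (auto simp: T_def)
      show "x \<in> T n \<union> (\<Union>m. R (m + n))"
      proof (rule ccontr)
        assume *: "x \<notin> T n \<union> (\<Union>m. R (m + n))"
        have "x \<notin> T (m + n)" for m
          by (induction m) (use * in \<open>auto simp: R_def\<close>)
        moreover have "x \<in> T (N + n)"
        proof -
          have "1 / real (Suc (N + n)) \<le> 1 / real (Suc N)"
            by (intro divide_left_mono) auto
          then show ?thesis using ex by (auto simp: T_def)
        qed
        ultimately show False by blast
      qed
    qed
    then have "?H (X - S) \<le> ?H (T n \<union> (\<Union>m. R (m + n)))"
      by (rule hausdorff_outer_mono)
    also have "\<dots> \<le> ?H (T n) + (\<Sum>m. ?H (R (m + n)))"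
      by (intro order_trans[OF hausdorff_outer_Un_le] add_left_mono hausdorff_outer_UN_le)
    finally have "?H (X \<inter> S) + ?H (X - S) \<le> (?H (X \<inter> S) + ?H (T n)) + (\<Sum>m. ?H (R (m + n)))"
      by (simp add: add.assoc add_left_mono)
    also have "?H (X \<inter> S) + ?H (T n) \<le> ?H (X \<inter> S \<union> T n)"
    proof (rule hausdorff_outer_separated)
      show "0 < 1 / real (Suc n)" by simp
      fix x y assume "x \<in> X \<inter> S" "y \<in> T n"
      then show "1 / real (Suc n) \<le> dist x y"
        using lip[of y x] by (auto simp: T_def dist_commute)
    qed
    also have "?H (X \<inter> S \<union> T n) \<le> ?H X"
      by (rule hausdorff_outer_mono) (auto simp: T_def)
    finally show ?thesis by (simp add: add_right_mono)
  qed
  have tail: "(\<lambda>n. \<Sum>m. ?H (R (m + n))) \<longlonglongrightarrow> 0"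
  proof -
    have eq: "(\<Sum>m. ?H (R (m + n))) = (\<Sum>n. ?H (R n)) - (\<Sum>j<n. ?H (R j))" for n
    proof -
      have "(\<Sum>n. ?H (R n)) = (\<Sum>m. ?H (R (m + n))) + (\<Sum>j<n. ?H (R j))"
        by (rule suminf_offset) auto
      moreover have "(\<Sum>j<n. ?H (R j)) \<noteq> top"
        by (rule neq_top_trans[OF _ bnd]) (use fin in simp)
      ultimately show ?thesis by simp
    qed
    have "(\<lambda>n. (\<Sum>n. ?H (R n)) - (\<Sum>j<n. ?H (R j))) \<longlonglongrightarrow> (\<Sum>n. ?H (R n)) - (\<Sum>n. ?H (R n))"
      using fin' by (intro tendsto_diff_ennreal summable_LIMSEQ) (auto simp: top_unique)
    then show ?thesis using fin' by (simp add: eq)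
  qed
  have "(\<lambda>n. ?H X + (\<Sum>m. ?H (R (m + n)))) \<longlonglongrightarrow> ?H X + 0"
    by (intro tendsto_add tail tendsto_const)
  then show ?thesis
    using step by (intro LIMSEQ_le_const[where X = "\<lambda>n. ?H X + (\<Sum>m. ?H (R (m + n)))"]) auto
qed

lemma measure_space_hausdorff:
  "measure_space (UNIV :: 'a::metric_space set) (sets borel) (hausdorff_outer k)"
proof -
  interpret P: sigma_algebra "UNIV :: 'a set" "UNIV :: 'a set set"
    using sigma_algebra_Pow[of "UNIV :: 'a set"] by simp
  let ?L = "lambda_system UNIV UNIV (hausdorff_outer k) :: 'a set set"
  have ms: "measure_space UNIV ?L (hausdorff_outer k)"
    by (rule P.caratheodory_lemma[OF outer_measure_space_hausdorff])
  have cl: "S \<in> ?L" if "closed S" for S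
  proof -
    have "hausdorff_outer k (X \<inter> S) + hausdorff_outer k (X - S) = hausdorff_outer k X" for X
      using hausdorff_outer_closed_split[OF that, of k X]
        hausdorff_outer_Un_le[of k "X \<inter> S" "X - S"] by (simp add: Int_Diff_Un antisym)
    then show ?thesis by (simp add: P.lambda_system_eq)
  qed
  have "sets borel \<subseteq> ?L"
  proof -
    have "sigma_sets UNIV {S :: 'a set. closed S} \<subseteq> ?L"
      using ms cl by (intro sigma_algebra.sigma_sets_subset) (auto simp: measure_space_def)
    then show ?thesis by (simp add: borel_eq_closed)
  qed
  then show ?thesis
    using ms sets.sigma_algebra_axioms[of "borel :: 'a measure"]
    by (intro measure_down[OF ms]) auto
qed

lemma sets_hausdorff [simp, measurable_cong]: "sets (hausdorff k) = sets borel"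
  unfolding hausdorff_def using sets.sigma_sets_eq[of borel] by (simp add: sets_measure_of)

lemma space_hausdorff [simp]: "space (hausdorff k) = UNIV"
  unfolding hausdorff_def by (simp add: space_measure_of_conv)

lemma emeasure_hausdorff:
  fixes A :: "'a::metric_space set"
  assumes "A \<in> sets borel"
  shows "emeasure (hausdorff k) A = hausdorff_outer k A"
  using measure_space_hausdorff[of k, where 'a = 'a] assms unfolding hausdorff_def
  by (intro emeasure_measure_of_sigma) (auto simp: measure_space_def)

text \<open>Cardinality with value \<open>\<infinity>\<close> on infinite sets.\<close>

definition ncard :: "'a set \<Rightarrow> ennreal" where
  "ncard A = emeasure (count_space UNIV) A"

text \<open>In \<^typ>\<open>ennreal\<close>, \<open>inverse 0 = \<infinity>\<close> and \<open>0 * \<infinity> = 0\<close>.\<close>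

definition I_val :: "nat \<Rightarrow> (real ^ 'n) set \<Rightarrow> (real ^ 'n \<Rightarrow> real) \<Rightarrow> ennreal" where
  "I_val k W g =
    (if k = 0 then ncard (corners W)
     else if Lip W g = 0 \<and> (\<forall>x\<in>W. g x = 0) then 0
     else Max (insert (Lip W g) (range (\<lambda>i. Lip W (pd W i g)))) ^ k *
       (\<integral>\<^sup>+x\<in>bdry k W.
          inverse (ennreal (Max (insert \<bar>g x\<bar> ((\<lambda>i. \<bar>pd W i g x\<bar>) ` free_dirs W x))) ^ k)
        \<partial>hausdorff k))"

definition bounded_components :: "'a::metric_space set \<Rightarrow> 'a set set" where
  "bounded_components A = {C \<in> path_components_of (top_of_set A). bounded C}"

definition pixelation :: "real \<Rightarrow> (real ^ 'n) set \<Rightarrow> (real ^ 'n) set" where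
  "pixelation \<epsilon> A =
    (\<Union>x\<in>{x \<in> A. \<forall>i. \<exists>z::int. x $ i = \<epsilon> * of_int z}.
       {x + \<epsilon> *\<^sub>R u | u. \<forall>i. u $ i \<in> {-1/2..<1/2}})"

end

theory Submission
  imports Defs
begin

text \<open>
  Write \<open>g = f - l\<close>, let \<open>L\<close> be the larger of the Lipschitz constants of \<open>g\<close> and of its partial
  derivatives, and let \<open>\<kappa>\<close>-\<open>k\<close> be the volume of the \<open>k\<close>-dimensional unit ball.

  \<^emph>\<open>First bound.\<close>  Fix a bounded component \<open>C\<close> of the excursion set. For every vector \<open>\<theta>\<close> of the cube
  \<open>[-1,1]^n\<close> the function \<open>g x * exp (- \<theta> \<bullet> x)\<close> attains a positive maximum over the closure of \<open>C\<close>, at a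
  point \<open>x\<close> that still lies in \<open>C\<close> because \<open>W\<close> is locally star-shaped
  (\<open>tilted_maximum_in_component\<close>). In each free direction \<open>i\<close> of \<open>x\<close> one can move both ways inside \<open>W\<close>, so
  the derivative vanishes there: the logarithmic derivative \<open>pd W i f x / g x\<close> equals \<open>\<theta>\<close>-\<open>i\<close>. Hence the
  cube, of volume \<open>2^n\<close>, is covered by the cylinders over the images of the sets
  \<open>{x \<in> C. free_dirs W x = I}\<close> under the logarithmic gradient in the directions \<open>I\<close>. Where
  these logarithmic derivatives are at most 1 in absolute value they are \<open>2 L / g\<close>-Lipschitz, and
  \<open>g x\<close> is then exactly the maximum in the denominator of the integral. A set of diameter \<open>D\<close> is
  mapped by \<open>k\<close> such functions into a box of side \<open>2 L D / g\<close>; as the gauge of the \<open>k\<close>-dimensional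
  Hausdorff measure is \<open>\<kappa>\<close>-\<open>k\<close> times \<open>(D/2)^k\<close>, summing over a cover bounds the volume of a cylinder by
  the integral of \<open>(L/g)^k\<close> over the stratum, times \<open>2^k\<close> divided by \<open>\<kappa>\<close>-\<open>k\<close>, times \<open>2^n\<close>
  (\<open>outer_cylinder_le_integral\<close>). Dividing by \<open>2^n\<close> shows that every component without a corner of \<open>W\<close>
  contributes at least 1 to the right-hand side (\<open>one_le_component_mass\<close>), with precisely the stated
  constants. Distinct components are disjoint, so the contributions add up, and a component containing a
  corner is paid for by that corner.

  \<^emph>\<open>Second bound.\<close>  For a bounded component \<open>D\<close> of the pixelation let \<open>p\<close> be a pixel centre in \<open>D\<close> where
  \<open>f\<close> is largest, and let \<open>R\<close> be the larger of \<open>2 \<epsilon>\<close> and \<open>g p / (8 L)\<close>. On \<open>W\<close> inside the open square of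
  radius \<open>R\<close> around \<open>p\<close>, \<open>g\<close> is at most of order \<open>L R\<close>. If the square contains no corner of \<open>W\<close>, then
  it contains a full flat piece of a stratum, a chord or the whole square, such that in the free directions of that
  piece one can walk from \<open>p\<close> to both neighbouring lattice points inside \<open>W\<close>
  (\<open>free_slice_without_corners\<close>). Maximality of \<open>f\<close> at \<open>p\<close> makes the partial derivatives of \<open>f\<close> in these
  directions of order \<open>L \<epsilon>\<close> at \<open>p\<close>, so the flat piece carries a mass bounded below by a
  constant. A point lies in a bounded number of these squares (\<open>card_peak_boxes_le\<close>): small squares have
  few possible lattice centres, and on \<open>W\<close> inside a large square \<open>f\<close> exceeds \<open>l\<close>,
  so that the lattice points of a single rectangle of \<open>W\<close> in it belong to a single component. If \<open>f\<close> is constant on \<open>W\<close>,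
  then \<open>L = 0\<close> gives no scale, and the corners alone suffice
  (\<open>pixel_components_of_polyrectangle_le\<close>).
\<close>

section \<open>Local structure of polyrectangles\<close>

text \<open>Near \<open>y\<close> the set \<open>A\<close> is a cone over \<open>y\<close> that is a union of faces of orthants: whether
  \<open>y + v\<close> belongs to it is decided by the signs of the coordinates of \<open>v\<close>.\<close>

definition sign_stable :: "(real ^ 'n) set \<Rightarrow> real ^ 'n \<Rightarrow> real \<Rightarrow> bool" where
  "sign_stable A y r \<longleftrightarrow> 0 < r \<and>
    (\<forall>v v'. (\<forall>c. \<bar>v $ c\<bar> < r \<and> \<bar>v' $ c\<bar> < r \<and> sgn (v $ c) = sgn (v' $ c)) \<longrightarrow>
       (y + v \<in> A \<longleftrightarrow> y + v' \<in> A))"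

lemma interval_sign_stable:
  fixes K :: "real set" and a :: real
  assumes "is_interval K" "closed K"
  shows "\<exists>r>0. \<forall>v v'. \<bar>v\<bar> < r \<and> \<bar>v'\<bar> < r \<and> sgn v = sgn v' \<longrightarrow> (a + v \<in> K \<longleftrightarrow> a + v' \<in> K)"
proof (cases "a \<in> K")
  case False
  with \<open>closed K\<close> obtain r where r: "r > 0" "ball a r \<inter> K = {}"
    using open_contains_ball[of "- K"] by (auto simp: closed_def) (metis Compl_iff disjoint_eq_subset_Compl)
  have "a + v \<notin> K" if "\<bar>v\<bar> < r" for v
    using r(2) that by (auto simp: dist_real_def disjoint_iff)
  then show ?thesis using r(1) by blast
next
  case True
  have conv: "x \<in> K" if "b \<in> K" "c \<in> K" "b \<le> x" "x \<le> c" for b c x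
    using assms(1) that unfolding is_interval_1 by blast
  obtain r1 where r1: "r1 > 0" "\<And>v v'. 0 < v \<Longrightarrow> v < r1 \<Longrightarrow> 0 < v' \<Longrightarrow> v' < r1 \<Longrightarrow> a + v \<in> K \<Longrightarrow> a + v' \<in> K"
  proof (cases "\<exists>b\<in>K. b > a")
    case T: True
    then obtain b where "b \<in> K" "b > a" by blast
    have "a + v \<in> K" if "0 < v" "v < b - a" for v
      by (rule conv[OF True \<open>b \<in> K\<close>]) (use that in auto)
    then show ?thesis using \<open>b > a\<close> by (intro that[of "b - a"]) simp_all
  next
    case False
    have "a + v \<notin> K" if "0 < v" for v using False that by (metis less_add_same_cancel1)
    then show ?thesis by (intro that[of 1]) (use \<open>\<And>v. _ \<Longrightarrow> a + v \<notin> K\<close> in simp_all)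
  qed
  obtain r2 where r2: "r2 > 0" "\<And>v v'. v < 0 \<Longrightarrow> - r2 < v \<Longrightarrow> v' < 0 \<Longrightarrow> - r2 < v' \<Longrightarrow> a + v \<in> K \<Longrightarrow> a + v' \<in> K"
  proof (cases "\<exists>b\<in>K. b < a")
    case T: True
    then obtain b where "b \<in> K" "b < a" by blast
    have "a + v \<in> K" if "v < 0" "- (a - b) < v" for v
      by (rule conv[OF \<open>b \<in> K\<close> True]) (use that in auto)
    then show ?thesis using \<open>b < a\<close> by (intro that[of "a - b"]) simp_all
  next
    case False
    have "a + v \<notin> K" if "v < 0" for v using False that by (metis add_less_same_cancel1)
    then show ?thesis by (intro that[of 1]) (use \<open>\<And>v. _ \<Longrightarrow> a + v \<notin> K\<close> in simp_all)
  qed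
  have "a + v \<in> K \<longleftrightarrow> a + v' \<in> K" if near: "\<bar>v\<bar> < min r1 r2" "\<bar>v'\<bar> < min r1 r2" "sgn v = sgn v'" for v v'
  proof -
    consider "v > 0" "v' > 0" | "v < 0" "v' < 0" | "v = 0" "v' = 0"
      using near(3) by (auto simp: sgn_if split: if_splits)
    then show ?thesis
    proof cases
      case 1
      then have "v < r1" "v' < r1" using near(1,2) by auto
      then show ?thesis using r1(2) 1 by blast
    next
      case 2
      then have "- r2 < v" "- r2 < v'" using near(1,2) by auto
      then show ?thesis using r2(2) 2 by blast
    qed auto
  qed
  moreover have "min r1 r2 > 0" using r1(1) r2(1) by simp
  ultimately show ?thesis by blast
qed

text \<open>Finitely many sides allow a common radius. The statement is kept at the level of single sides, since
  finding the corners of the individual rectangles requires more than the union \<open>W\<close>.\<close>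

lemma sides_sign_stable:
  fixes I :: "nat \<Rightarrow> 'n::finite \<Rightarrow> real set" and y :: "real ^ 'n"
  assumes "\<And>k. k < m \<Longrightarrow> rect_sides (I k)"
  shows "\<exists>r>0. \<forall>k<m. \<forall>c v v'. \<bar>v\<bar> < r \<and> \<bar>v'\<bar> < r \<and> sgn v = sgn v' \<longrightarrow>
           (y $ c + v \<in> I k c \<longleftrightarrow> y $ c + v' \<in> I k c)"
proof -
  have "\<forall>k c. \<exists>r>0. k < m \<longrightarrow> (\<forall>v v'. \<bar>v\<bar> < r \<and> \<bar>v'\<bar> < r \<and> sgn v = sgn v' \<longrightarrow>
           (y $ c + v \<in> I k c \<longleftrightarrow> y $ c + v' \<in> I k c))"
  proof (intro allI)
    fix k c
    show "\<exists>r>0. k < m \<longrightarrow> (\<forall>v v'. \<bar>v\<bar> < r \<and> \<bar>v'\<bar> < r \<and> sgn v = sgn v' \<longrightarrow>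
           (y $ c + v \<in> I k c \<longleftrightarrow> y $ c + v' \<in> I k c))"
    proof (cases "k < m")
      case True
      then show ?thesis using interval_sign_stable[of "I k c" "y $ c"] assms[OF True]
        by (auto simp: rect_sides_def)
    qed (auto intro: exI[of _ 1])
  qed
  then obtain r where r: "\<And>k c. r k c > 0" "\<And>k c v v'. k < m \<Longrightarrow> \<bar>v\<bar> < r k c \<Longrightarrow> \<bar>v'\<bar> < r k c \<Longrightarrow>
      sgn v = sgn v' \<Longrightarrow> (y $ c + v \<in> I k c \<longleftrightarrow> y $ c + v' \<in> I k c)"
    unfolding choice_iff by blast
  define R where "R = Min (insert 1 ((\<lambda>(k, c). r k c) ` ({..<m} \<times> UNIV)))"
  have fin: "finite (insert 1 ((\<lambda>(k, c). r k c) ` ({..<m} \<times> (UNIV :: 'n set))))" by auto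
  have "R > 0" unfolding R_def using fin r(1) by (subst Min_gr_iff) auto
  moreover have "R \<le> r k c" if "k < m" for k c
    unfolding R_def using that by (intro Min_le fin) auto
  ultimately show ?thesis
  proof (intro exI[of _ R] conjI allI impI)
    fix k c v v' assume *: "k < m" "\<bar>v\<bar> < R \<and> \<bar>v'\<bar> < R \<and> sgn v = sgn v'" "\<And>k c. k < m \<Longrightarrow> R \<le> r k c"
    have "R \<le> r k c" using *(1,3) by blast
    then show "(y $ c + v \<in> I k c) = (y $ c + v' \<in> I k c)"
      using r(2)[OF *(1), of v c v'] *(2) by linarith
  qed
qed

lemma polyrectangle_closed: "polyrectangle W \<Longrightarrow> closed W"
proof -
  assume "polyrectangle W"
  then obtain m and I :: "nat \<Rightarrow> 'a \<Rightarrow> real set" where I: "\<And>k. k < m \<Longrightarrow> rect_sides (I k)"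
    "W = (\<Union>k<m. rectangle (I k))"
    unfolding polyrectangle_def by blast
  have "closed (rectangle (I k))" if "k < m" for k
  proof -
    have "rectangle (I k) = (\<Inter>c. (\<lambda>x. x $ c) -` I k c)" by (auto simp: rectangle_def)
    moreover have "closed ((\<lambda>x::real^'a. x $ c) -` I k c)" for c
      using I(1)[OF that] by (intro closed_vimage continuous_intros) (auto simp: rect_sides_def)
    ultimately show ?thesis by auto
  qed
  then show ?thesis unfolding I(2) by auto
qed

lemma polyrectangle_sign_stable:
  assumes "polyrectangle W"
  shows "\<exists>r. sign_stable W y r"
proof -
  from assms obtain m and I :: "nat \<Rightarrow> 'a \<Rightarrow> real set" where I: "\<And>k. k < m \<Longrightarrow> rect_sides (I k)"
    "W = (\<Union>k<m. rectangle (I k))"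
    unfolding polyrectangle_def by blast
  from sides_sign_stable[of m I y, OF I(1)] obtain r where r: "r > 0"
    "\<And>k c v v'. k < m \<Longrightarrow> \<bar>v\<bar> < r \<Longrightarrow> \<bar>v'\<bar> < r \<Longrightarrow> sgn v = sgn v' \<Longrightarrow>
           (y $ c + v \<in> I k c \<longleftrightarrow> y $ c + v' \<in> I k c)" by blast
  have "y + v \<in> rectangle (I k) \<longleftrightarrow> y + v' \<in> rectangle (I k)"
    if "k < m" "\<And>c. \<bar>v $ c\<bar> < r \<and> \<bar>v' $ c\<bar> < r \<and> sgn (v $ c) = sgn (v' $ c)" for k v v'
  proof -
    have "(y $ c + v $ c \<in> I k c) = (y $ c + v' $ c \<in> I k c)" for c
      using r(2)[OF that(1)] that(2) by blast
    then show ?thesis unfolding rectangle_def by simp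
  qed
  then have "sign_stable W y r" using r(1) unfolding sign_stable_def I(2) by blast
  then show ?thesis ..
qed

lemma sign_stable_star:
  assumes "closed W" "sign_stable W y r" "y + v \<in> W" "\<And>c. \<bar>v $ c\<bar> < r" "0 \<le> t" "t \<le> 1"
  shows "y + t *\<^sub>R v \<in> W"
proof -
  have pos: "y + t *\<^sub>R v \<in> W" if "0 < t" "t \<le> 1" for t
  proof -
    have "\<bar>t * v $ c\<bar> < r" for c
      using that assms(4)[of c] mult_right_mono[of t 1 "\<bar>v $ c\<bar>"] by (simp add: abs_mult)
    then have "\<forall>c. \<bar>v $ c\<bar> < r \<and> \<bar>(t *\<^sub>R v) $ c\<bar> < r \<and> sgn (v $ c) = sgn ((t *\<^sub>R v) $ c)"
      using assms(4) that by (simp add: sgn_mult)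
    then have "(y + v \<in> W) = (y + t *\<^sub>R v \<in> W)"
      using assms(2) unfolding sign_stable_def by blast
    then show ?thesis using assms(3) by blast
  qed
  show ?thesis
  proof (cases "t = 0")
    case True
    have lim: "(\<lambda>n. y + (1 / real (Suc n)) *\<^sub>R v) \<longlonglongrightarrow> y + 0 *\<^sub>R v"
      by (intro tendsto_intros LIMSEQ_Suc lim_1_over_n)
    have mem: "y + (1 / real (Suc n)) *\<^sub>R v \<in> W" for n by (rule pos) auto
    have "y + 0 *\<^sub>R v \<in> W" by (rule closed_sequentially[OF assms(1) mem lim])
    then show ?thesis using True by simp
  qed (use pos assms in auto)
qed

lemma polyrectangle_locally_star:
  assumes "polyrectangle W"
  obtains r where "r > 0" "\<And>y. y \<in> W \<Longrightarrow> dist x y < r \<Longrightarrow> closed_segment x y \<subseteq> W"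
proof -
  obtain r where r: "sign_stable W x r" using polyrectangle_sign_stable[OF assms] by blast
  show ?thesis
  proof (rule that[of r])
    show "r > 0" using r by (simp add: sign_stable_def)
    fix y assume y: "y \<in> W" "dist x y < r"
    show "closed_segment x y \<subseteq> W"
    proof
      fix z assume "z \<in> closed_segment x y"
      then obtain t where t: "0 \<le> t" "t \<le> 1" "z = x + t *\<^sub>R (y - x)"
        by (auto simp: in_segment algebra_simps)
      have "\<bar>(y - x) $ c\<bar> < r" for c
        using component_le_norm_cart[of "y - x" c] y(2) by (simp add: dist_norm norm_minus_commute)
      then show "z \<in> W" unfolding t(3)
        using sign_stable_star[OF polyrectangle_closed[OF assms] r, of "y - x" t] t y by auto
    qed
  qed
qed

text \<open>For points outside the interior the definition of \<open>free_dirs\<close> only provides arbitrarily small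
  two-sided steps ending in the frontier of \<open>W\<close>. The frontier is part of \<open>W\<close>, and the local cone
  structure fills in all shorter steps.\<close>

lemma free_dirs_two_sided:
  assumes "polyrectangle W" "i \<in> free_dirs W x"
  obtains r where "r > 0" "\<And>t. \<bar>t\<bar> < r \<Longrightarrow> x + t *\<^sub>R axis i 1 \<in> W"
proof (cases "x \<in> interior W")
  case True
  then obtain r where r: "r > 0" "ball x r \<subseteq> W" by (meson interior_subset open_contains_ball open_interior subset_trans)
  show ?thesis
  proof (rule that[OF r(1)])
    fix t :: real assume "\<bar>t\<bar> < r"
    then have "x + t *\<^sub>R axis i 1 \<in> ball x r" by (simp add: dist_norm )
    then show "x + t *\<^sub>R axis i 1 \<in> W" using r by blast
  qed
next
  case False
  have cl: "closed W" by (rule polyrectangle_closed[OF assms(1)])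
  obtain r where r: "sign_stable W x r" using polyrectangle_sign_stable[OF assms(1)] by blast
  then have "r > 0" by (simp add: sign_stable_def)
  with False assms(2) obtain e where e: "0 < e" "e < r" "x + e *\<^sub>R axis i 1 \<in> frontier W" "x - e *\<^sub>R axis i 1 \<in> frontier W"
    unfolding free_dirs_def by auto
  then have inW: "x + e *\<^sub>R axis i 1 \<in> W" "x + (- e *\<^sub>R axis i 1) \<in> W"
    using frontier_subset_closed[OF cl] by auto
  have b: "\<bar>(e *\<^sub>R axis i 1) $ c\<bar> < r" "\<bar>(- e *\<^sub>R axis i 1) $ c\<bar> < r" for c
    using e \<open>r > 0\<close> by (auto simp: axis_def)
  show ?thesis
  proof (rule that[OF e(1)])
    fix t :: real assume t: "\<bar>t\<bar> < e"
    show "x + t *\<^sub>R axis i 1 \<in> W"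
    proof (cases "t \<ge> 0")
      case True
      then show ?thesis using sign_stable_star[OF cl r inW(1) b(1), of "t / e"] t e(1) by simp
    next
      case False
      then show ?thesis using sign_stable_star[OF cl r inW(2) b(2), of "- t / e"] t e(1) by (simp add: field_simps)
    qed
  qed
qed

section \<open>Covering Lipschitz images by Hausdorff measure\<close>

lemma outer_measure_of_UN_le:
  assumes "\<And>n::nat. A n \<subseteq> space M"
  shows "outer_measure_of M (\<Union>n. A n) \<le> (\<Sum>n. outer_measure_of M (A n))"
proof -
  have "\<forall>n. \<exists>E\<in>sets M. A n \<subseteq> E \<and> outer_measure_of M (A n) = emeasure M E"
    using outer_measure_of_attain[OF assms] by blast
  then obtain E where E: "\<And>n. E n \<in> sets M" "\<And>n. A n \<subseteq> E n" "\<And>n. outer_measure_of M (A n) = emeasure M (E n)"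
    by metis
  have "outer_measure_of M (\<Union>n. A n) \<le> outer_measure_of M (\<Union>n. E n)"
    using E(2) by (intro outer_measure_of_mono) blast
  also have "\<dots> = emeasure M (\<Union>n. E n)" using E(1) by (intro outer_measure_of_eq) auto
  also have "\<dots> \<le> (\<Sum>n. emeasure M (E n))" using E(1) by (intro emeasure_subadditive_countably) auto
  finally show ?thesis using E(3) by simp
qed

text \<open>The points of the cube \<open>[-1,1]^n\<close> whose \<open>I\<close>-coordinates agree with those of a point of
  \<open>\<psi> ` E\<close>. Such sets need not be measurable, hence the outer measures below.\<close>

definition cylinder_over :: "'n set \<Rightarrow> ('a \<Rightarrow> real ^ 'n) \<Rightarrow> 'a set \<Rightarrow> (real ^ 'n) set" where
  "cylinder_over I \<psi> E = {\<theta>. (\<forall>i. \<bar>\<theta> $ i\<bar> \<le> 1) \<and> (\<exists>x\<in>E. \<forall>i\<in>I. \<theta> $ i = \<psi> x $ i)}"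

lemma outer_cylinder_bounded:
  fixes V :: "'a::metric_space set" and \<psi> :: "'a \<Rightarrow> real ^ 'n"
  assumes "bounded V" "0 \<le> M"
    and lip: "\<And>x y i. x \<in> V \<Longrightarrow> y \<in> V \<Longrightarrow> i \<in> I \<Longrightarrow> \<bar>\<psi> x $ i - \<psi> y $ i\<bar> \<le> M * dist x y"
  shows "outer_measure_of lborel (cylinder_over I \<psi> V)
           \<le> ennreal (2 ^ (CARD('n) - card I) * (M * diameter V) ^ card I)"
proof (cases "V = {}")
  case True
  then show ?thesis by (simp add: cylinder_over_def)
next
  case False
  define D where "D = M * diameter V"
  have D: "\<bar>\<psi> x $ i - \<psi> y $ i\<bar> \<le> D" if "x \<in> V" "y \<in> V" "i \<in> I" for x y i
    using lip[OF that] mult_left_mono[OF diameter_bounded_bound[OF assms(1) that(1,2)] assms(2)]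
    unfolding D_def by linarith
  have "D \<ge> 0" unfolding D_def using assms(2) diameter_ge_0[OF assms(1)] by simp
  define a where "a i = Inf ((\<lambda>x. \<psi> x $ i) ` V)" for i
  obtain x0 where x0: "x0 \<in> V" using False by blast
  have lo: "a i \<le> \<psi> x $ i" if "x \<in> V" "i \<in> I" for x i
    unfolding a_def
  proof (rule cInf_lower)
    show "bdd_below ((\<lambda>x. \<psi> x $ i) ` V)"
    proof (rule bdd_belowI2)
      fix y assume "y \<in> V" then show "\<psi> x0 $ i - D \<le> \<psi> y $ i"
        using D[OF x0 _ that(2), of y] by linarith
    qed
  qed (use that in auto)
  have hi: "\<psi> x $ i \<le> a i + D" if "x \<in> V" "i \<in> I" for x i
  proof -
    have "\<psi> x $ i - D \<le> a i" unfolding a_def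
      by (rule cInf_greatest) (use False D[OF that(1) _ that(2)] in \<open>auto simp: abs_le_iff algebra_simps\<close>)
    then show ?thesis by linarith
  qed
  define l :: "real ^ 'n" where "l = (\<chi> i. if i \<in> I then a i else - 1)"
  define u :: "real ^ 'n" where "u = (\<chi> i. if i \<in> I then a i + D else 1)"
  have sub: "cylinder_over I \<psi> V \<subseteq> cbox l u"
  proof
    fix \<theta> assume "\<theta> \<in> cylinder_over I \<psi> V"
    then obtain x where x: "x \<in> V" "\<And>i. i \<in> I \<Longrightarrow> \<theta> $ i = \<psi> x $ i" "\<And>i. \<bar>\<theta> $ i\<bar> \<le> 1"
      unfolding cylinder_over_def by auto
    have "l $ i \<le> \<theta> $ i \<and> \<theta> $ i \<le> u $ i" for i
      using lo[OF x(1)] hi[OF x(1)] x(2)[of i] x(3)[of i] by (auto simp: l_def u_def)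
    then show "\<theta> \<in> cbox l u" by (simp add: mem_box_cart)
  qed
  have ne: "cbox l u \<noteq> {}" 
    unfolding interval_ne_empty_cart l_def u_def using \<open>D \<ge> 0\<close> by auto
  have "outer_measure_of lborel (cylinder_over I \<psi> V) \<le> outer_measure_of lborel (cbox l u)"
    by (rule outer_measure_of_mono[OF sub])
  also have "\<dots> = ennreal (measure lborel (cbox l u))"
    using emeasure_lborel_cbox_finite[of l u] by (simp add: emeasure_eq_ennreal_measure)
  also have "measure lborel (cbox l u) = (\<Prod>i\<in>UNIV. if i \<in> I then D else 2)"
    unfolding content_cbox_cart[OF ne] by (rule prod.cong) (auto simp: l_def u_def)
  also have "\<dots> = 2 ^ (CARD('n) - card I) * D ^ card I"
    by (simp add: prod.If_cases Compl_eq_Diff_UNIV card_Diff_subset)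
  finally show ?thesis unfolding D_def .
qed

text \<open>Each \<open>\<psi>\<close>-coordinate in \<open>I\<close> maps a set of diameter \<open>D\<close> into an interval of length \<open>M * D\<close>,
  so the cylinder over it lies in a box of volume \<open>2 ^ (n - k) * (M * D) ^ k\<close>. This is
  \<open>2 ^ n * M ^ k\<close>, divided by the volume of the unit ball, times the Hausdorff gauge of the set.\<close>

lemma outer_cylinder_le_hausdorff:
  fixes E :: "'a::metric_space set" and \<psi> :: "'a \<Rightarrow> real ^ 'n"
  assumes "I \<noteq> {}" "0 \<le> M"
    and lip: "\<And>x y i. x \<in> E \<Longrightarrow> y \<in> E \<Longrightarrow> i \<in> I \<Longrightarrow> \<bar>\<psi> x $ i - \<psi> y $ i\<bar> \<le> M * dist x y"
  shows "outer_measure_of lborel (cylinder_over I \<psi> E)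
           \<le> ennreal (2 ^ CARD('n) * inverse (unit_ball_vol (real (card I))) * M ^ card I) *
              hausdorff_outer (card I) E"
proof -
  define k where "k = card I"
  have k: "k > 0" "k \<le> CARD('n)" unfolding k_def using assms(1) by (auto simp: card_gt_0_iff intro: card_mono)
  define \<kappa> where "\<kappa> = unit_ball_vol (real k)"
  have \<kappa>: "\<kappa> > 0" unfolding \<kappa>_def by simp
  define c where "c = 2 ^ CARD('n) * inverse \<kappa> * M ^ k"
  show ?thesis
  proof (cases "M = 0 \<or> E = {}")
    case True
    have "outer_measure_of lborel (cylinder_over I \<psi> E) = 0"
    proof (cases "E = {}")
      case False
      then obtain x0 where x0: "x0 \<in> E" by blast
      have "\<psi> x $ i = \<psi> x0 $ i" if "x \<in> E" "i \<in> I" for x i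
        using lip[OF that(1) x0 that(2)] True False by auto
      then have "cylinder_over I \<psi> E \<subseteq> cylinder_over I \<psi> {x0}"
        unfolding cylinder_over_def by force
      then have "outer_measure_of lborel (cylinder_over I \<psi> E) \<le> outer_measure_of lborel (cylinder_over I \<psi> {x0})"
        by (rule outer_measure_of_mono)
      also have "\<dots> \<le> ennreal (2 ^ (CARD('n) - card I) * (M * diameter {x0}) ^ card I)"
        by (rule outer_cylinder_bounded) (use assms in auto)
      finally show ?thesis using k by (simp add: k_def zero_power)
    qed (simp add: cylinder_over_def)
    then show ?thesis by simp
  next
    case False
    then have M: "M > 0" using assms(2) by simp
    then have c: "c > 0" unfolding c_def using \<kappa> by simp
    let ?o = "outer_measure_of lborel (cylinder_over I \<psi> E)"
    have "ennreal (1 / c) * ?o \<le> hausdorff_pre k 1 E"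
      unfolding hausdorff_pre_def
    proof (rule INF_greatest)
      fix U :: "nat \<Rightarrow> 'a set"
      assume "U \<in> {U. E \<subseteq> (\<Union>j. U j) \<and> (\<forall>j. bounded (U j) \<and> diameter (U j) \<le> 1)}"
      then have U: "E \<subseteq> (\<Union>j. U j)" "\<And>j. bounded (U j)" by auto
      have "cylinder_over I \<psi> E \<subseteq> (\<Union>j. cylinder_over I \<psi> (U j \<inter> E))"
        using U(1) unfolding cylinder_over_def by blast
      then have "?o \<le> outer_measure_of lborel (\<Union>j. cylinder_over I \<psi> (U j \<inter> E))"
        by (rule outer_measure_of_mono)
      also have "\<dots> \<le> (\<Sum>j. outer_measure_of lborel (cylinder_over I \<psi> (U j \<inter> E)))"
        by (rule outer_measure_of_UN_le) simp
      also have "\<dots> \<le> (\<Sum>j. ennreal c * hausdorff_gauge k (U j))"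
      proof (intro suminf_le)
        fix j
        have "outer_measure_of lborel (cylinder_over I \<psi> (U j \<inter> E))
            \<le> ennreal (2 ^ (CARD('n) - k) * (M * diameter (U j \<inter> E)) ^ k)"
          unfolding k_def using U(2) assms by (intro outer_cylinder_bounded) (auto intro: bounded_subset)
        also have "\<dots> \<le> ennreal c * hausdorff_gauge k (U j)"
        proof (cases "U j = {}")
          case True
          then show ?thesis using k by (simp add: diameter_def)
        next
          case False
          have "diameter (U j \<inter> E) \<le> diameter (U j)"
            using U(2) by (intro diameter_subset) auto
          then have "(M * diameter (U j \<inter> E)) ^ k \<le> (M * diameter (U j)) ^ k"
            using M diameter_ge_0[of "U j \<inter> E"] bounded_subset[OF U(2)[of j], of "U j \<inter> E"]
            by (intro power_mono mult_left_mono) auto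
          then have "2 ^ (CARD('n) - k) * (M * diameter (U j \<inter> E)) ^ k \<le> 2 ^ (CARD('n) - k) * (M * diameter (U j)) ^ k"
            by simp
          also have "\<dots> = c * (\<kappa> * (diameter (U j) / 2) ^ k)"
            using \<kappa> k by (simp add: c_def power_mult_distrib power_divide power_diff field_simps)
          finally show ?thesis using False c
            by (simp add: hausdorff_gauge_def \<kappa>_def ennreal_mult'[symmetric] ennreal_leI)
        qed
        finally show "outer_measure_of lborel (cylinder_over I \<psi> (U j \<inter> E)) \<le> ennreal c * hausdorff_gauge k (U j)" .
      qed auto
      also have "\<dots> = ennreal c * (\<Sum>j. hausdorff_gauge k (U j))"
        by (rule ennreal_suminf_cmult)
      finally have "ennreal (1 / c) * ?o \<le> ennreal (1 / c) * (ennreal c * (\<Sum>j. hausdorff_gauge k (U j)))"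
        by (rule mult_left_mono) simp
      also have "\<dots> = (\<Sum>j. hausdorff_gauge k (U j))"
        using c by (simp add: mult.assoc[symmetric] ennreal_mult'[symmetric])
      finally show "ennreal (1 / c) * ?o \<le> (\<Sum>j. hausdorff_gauge k (U j))" .
    qed
    also have "\<dots> \<le> hausdorff_outer k E"
      unfolding hausdorff_outer_def by (rule SUP_upper) simp
    finally have "ennreal c * (ennreal (1 / c) * ?o) \<le> ennreal c * hausdorff_outer k E"
      by (rule mult_left_mono) simp
    moreover have "ennreal c * (ennreal (1 / c) * ?o) = ?o"
      using c by (simp add: mult.assoc[symmetric] ennreal_mult'[symmetric])
    ultimately show ?thesis by (simp add: c_def k_def \<kappa>_def)
  qed
qed

lemma ennreal_mult_assoc_real: "0 \<le> a \<Longrightarrow> ennreal a * (ennreal b * X) = ennreal (a * b) * X"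
  by (simp add: ennreal_mult' mult.assoc)

definition flat_slice :: "'n set \<Rightarrow> real ^ 'n \<Rightarrow> real ^ 'n \<Rightarrow> real \<Rightarrow> (real ^ 'n) set" where
  "flat_slice I p a R = {x. \<forall>c. (c \<in> I \<longrightarrow> \<bar>x $ c - p $ c\<bar> < R) \<and> (c \<notin> I \<longrightarrow> x $ c = a $ c)}"

lemma emeasure_lborel_symmetric_cube:
  "emeasure lborel (box (- 1) 1 :: (real ^ 'n) set) = ennreal (2 ^ CARD('n))"
proof -
  have "\<And>b. b \<in> (Basis :: (real ^ 'n) set) \<Longrightarrow> (- 1 :: real ^ 'n) \<bullet> b \<le> 1 \<bullet> b \<and> (1 - (- 1) :: real ^ 'n) \<bullet> b = 2"
    by (auto simp: Basis_vec_def inner_axis)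
  then show ?thesis unfolding emeasure_lborel_box_eq by (simp add: ennreal_power)
qed

text \<open>The rescaled coordinates in \<open>I\<close> are \<open>1 / R\<close>-Lipschitz and the cylinder over their image of the
  slice contains the open cube; comparing volumes gives the bound.\<close>

lemma hausdorff_flat_slice:
  fixes p a :: "real ^ 'n"
  assumes "I \<noteq> {}" "R > 0"
  shows "ennreal (unit_ball_vol (real (card I)) * R ^ card I) \<le> hausdorff_outer (card I) (flat_slice I p a R)"
proof -
  let ?k = "card I" and ?E = "flat_slice I p a R"
  define \<kappa> where "\<kappa> = unit_ball_vol (real ?k)"
  have \<kappa>: "\<kappa> > 0" unfolding \<kappa>_def by simp
  define \<psi> where "\<psi> x = (1 / R) *\<^sub>R (x - p)" for x :: "real ^ 'n"
  have sub: "box (- 1) 1 \<subseteq> cylinder_over I \<psi> ?E"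
  proof
    fix \<theta> :: "real ^ 'n" assume "\<theta> \<in> box (- 1) 1"
    then have \<theta>: "\<bar>\<theta> $ i\<bar> < 1" for i by (simp add: mem_box_cart abs_less_iff minus_less_iff)
    define x :: "real ^ 'n" where "x = (\<chi> c. if c \<in> I then p $ c + R * \<theta> $ c else a $ c)"
    have "x \<in> ?E" using \<theta> assms(2) by (auto simp: flat_slice_def x_def abs_mult)
    moreover have "\<forall>i\<in>I. \<theta> $ i = \<psi> x $ i" using assms(2) by (simp add: x_def \<psi>_def)
    ultimately show "\<theta> \<in> cylinder_over I \<psi> ?E"
      using \<theta> unfolding cylinder_over_def by (auto intro: less_imp_le)
  qed
  have "ennreal (2 ^ CARD('n)) = outer_measure_of lborel (box (- 1) (1 :: real ^ 'n))"
    by (simp add: emeasure_lborel_symmetric_cube)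
  also have "\<dots> \<le> outer_measure_of lborel (cylinder_over I \<psi> ?E)"
    by (rule outer_measure_of_mono[OF sub])
  also have "\<dots> \<le> ennreal (2 ^ CARD('n) * inverse \<kappa> * (1 / R) ^ ?k) * hausdorff_outer ?k ?E"
    unfolding \<kappa>_def
  proof (rule outer_cylinder_le_hausdorff[OF assms(1)])
    fix x y :: "real ^ 'n" and i
    have "\<bar>\<psi> x $ i - \<psi> y $ i\<bar> = (1 / R) * \<bar>(x - y) $ i\<bar>"
      using assms(2) by (simp add: \<psi>_def diff_divide_distrib[symmetric])
    also have "\<dots> \<le> (1 / R) * dist x y"
      using assms(2) component_le_norm_cart[of "x - y" i] by (intro mult_left_mono) (auto simp: dist_norm)
    finally show "\<bar>\<psi> x $ i - \<psi> y $ i\<bar> \<le> (1 / R) * dist x y" .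
  qed (use assms in auto)
  finally have "ennreal (\<kappa> * R ^ ?k / 2 ^ CARD('n)) * ennreal (2 ^ CARD('n)) \<le>
     ennreal (\<kappa> * R ^ ?k / 2 ^ CARD('n)) * (ennreal (2 ^ CARD('n) * inverse \<kappa> * (1 / R) ^ ?k) * hausdorff_outer ?k ?E)"
    by (rule mult_left_mono) simp
  also have "\<dots> = hausdorff_outer ?k ?E"
  proof -
    have "\<kappa> * R ^ ?k / 2 ^ CARD('n) * (2 ^ CARD('n) * inverse \<kappa> * (1 / R) ^ ?k) = 1"
      using \<kappa> assms(2) by (simp add: field_simps)
    then show ?thesis
      using \<kappa> assms(2) by (subst ennreal_mult_assoc_real) auto
  qed
  finally show ?thesis
    using \<kappa> assms(2) by (simp add: ennreal_mult'[symmetric] \<kappa>_def)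
qed

lemma ennreal_le_of_power_factor:
  fixes X Y :: ennreal
  assumes "\<And>q::real. q > 1 \<Longrightarrow> X \<le> ennreal (q ^ k) * Y"
  shows "X \<le> Y"
proof (cases "Y = top")
  case False
  then obtain y where y: "Y = ennreal y" "y \<ge> 0" by (metis ennreal_cases)
  have "(\<lambda>n. (1 + 1 / real (Suc n)) ^ k * y) \<longlonglongrightarrow> (1 + 0) ^ k * y"
    by (intro tendsto_intros LIMSEQ_Suc lim_1_over_n)
  then have lim: "(\<lambda>n. ennreal ((1 + 1 / real (Suc n)) ^ k * y)) \<longlonglongrightarrow> ennreal ((1 + 0) ^ k * y)"
    by (rule tendsto_ennrealI)
  have "X \<le> ennreal ((1 + 1 / real (Suc n)) ^ k * y)" for n
    using assms[of "1 + 1 / real (Suc n)"] y by (simp add: ennreal_mult')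
  then have "X \<le> ennreal ((1 + 0) ^ k * y)" using lim by (intro LIMSEQ_le_const[OF lim]) auto
  then show ?thesis using y by simp
qed simp

text \<open>The local form of the covering estimate, for a Lipschitz constant that varies with the point. On the
  layers where \<open>g\<close> stays between consecutive powers of \<open>q > 1\<close> the constant is uniform up to the
  factor \<open>q\<close>; summing over the layers and letting \<open>q\<close> tend to 1 removes the loss.\<close>

lemma outer_cylinder_le_integral:
  fixes A :: "'a::metric_space set" and \<psi> :: "'a \<Rightarrow> real ^ 'n" and g :: "'a \<Rightarrow> real"
  assumes "I \<noteq> {}" "0 \<le> L" "A \<in> sets borel" and meas: "g \<in> borel_measurable borel"
    and pos: "\<And>x. x \<in> A \<Longrightarrow> g x > 0"
    and lip: "\<And>x y i. x \<in> A \<Longrightarrow> y \<in> A \<Longrightarrow> i \<in> I \<Longrightarrow> \<bar>\<psi> x $ i - \<psi> y $ i\<bar> \<le> 2 * L / g x * dist x y"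
  shows "outer_measure_of lborel (cylinder_over I \<psi> A)
           \<le> ennreal (2 ^ CARD('n)) * (ennreal (2 ^ card I * inverse (unit_ball_vol (real (card I)))) *
              (ennreal L ^ card I * (\<integral>\<^sup>+x\<in>A. inverse (ennreal (g x) ^ card I) \<partial>hausdorff (card I))))"
proof (rule ennreal_le_of_power_factor[where k = "card I"])
  fix q :: real assume q: "q > 1"
  let ?k = "card I"
  define \<kappa> where "\<kappa> = unit_ball_vol (real ?k)"
  have \<kappa>: "\<kappa> > 0" unfolding \<kappa>_def by simp
  define s where "s n = q powr real_of_int (int_decode n)" for n
  have s: "s n > 0" for n unfolding s_def using q by simp
  define B where "B n = {x \<in> A. s n \<le> g x \<and> g x < q * s n}" for n
  have B_sets: "B n \<in> sets borel" for n
    unfolding B_def using assms(3) meas by measurable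
  have cover: "A \<subseteq> (\<Union>n. B n)"
  proof
    fix x assume x: "x \<in> A"
    define z where "z = \<lfloor>log q (g x)\<rfloor>"
    have "q powr z \<le> q powr (log q (g x))" unfolding z_def using q by (intro powr_mono) auto
    moreover have "q powr (log q (g x)) < q powr (1 + z)" unfolding z_def using q by (intro powr_less_mono) linarith+
    ultimately have "x \<in> B (int_encode z)"
      using q x pos[OF x] by (simp add: B_def s_def powr_add)
    then show "x \<in> (\<Union>n. B n)" by blast
  qed
  have disj: "disjoint_family B"
    unfolding disjoint_family_on_def
  proof (intro ballI impI)
    fix m n :: nat assume "m \<noteq> n"
    then have ne: "int_decode m \<noteq> int_decode n" by (simp add: inj_eq[OF inj_int_decode])
    have *: False if "x \<in> B m" "x \<in> B n" "int_decode m < int_decode n" for x m n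
    proof -
      have "q * s m = q powr (1 + real_of_int (int_decode m))" using q by (simp add: s_def powr_add)
      also have "\<dots> \<le> s n" unfolding s_def using q that(3) by (intro powr_mono) linarith+
      finally show False using that(1,2) by (auto simp: B_def)
    qed
    show "B m \<inter> B n = {}" using ne *[of _ m n] *[of _ n m] by (cases "int_decode m" "int_decode n" rule: linorder_cases) auto
  qed
  have B_UN: "(\<Union>n. B n) = A" using cover by (auto simp: B_def)
  define \<phi> where "\<phi> x = inverse (ennreal (g x) ^ ?k)" for x
  have \<phi>_meas: "\<phi> \<in> borel_measurable (hausdorff ?k)" unfolding \<phi>_def using meas by measurable
  have piece: "outer_measure_of lborel (cylinder_over I \<psi> (B n)) \<le>
      ennreal (q ^ ?k * (2 ^ CARD('n) * (2 ^ ?k * inverse \<kappa>) * L ^ ?k)) * (\<integral>\<^sup>+x\<in>B n. \<phi> x \<partial>hausdorff ?k)" for n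
  proof -
    have "outer_measure_of lborel (cylinder_over I \<psi> (B n)) \<le>
       ennreal (2 ^ CARD('n) * inverse \<kappa> * (2 * L / s n) ^ ?k) * hausdorff_outer ?k (B n)"
      unfolding \<kappa>_def
    proof (rule outer_cylinder_le_hausdorff[OF assms(1)])
      fix x y i assume xy: "x \<in> B n" "y \<in> B n" "i \<in> I"
      have "2 * L / g x \<le> 2 * L / s n"
        using xy(1) s[of n] assms(2) by (intro divide_left_mono) (auto simp: B_def)
      then have "2 * L / g x * dist x y \<le> 2 * L / s n * dist x y" by (rule mult_right_mono) simp
      then show "\<bar>\<psi> x $ i - \<psi> y $ i\<bar> \<le> 2 * L / s n * dist x y"
        using lip[of x y i] xy by (auto simp: B_def)
    qed (use assms s[of n] in auto)
    also have "\<dots> = ennreal (q ^ ?k * (2 ^ CARD('n) * (2 ^ ?k * inverse \<kappa>) * L ^ ?k)) *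
        (ennreal (inverse ((q * s n) ^ ?k)) * hausdorff_outer ?k (B n))"
    proof -
      have "q ^ ?k * (2 ^ CARD('n) * (2 ^ ?k * inverse \<kappa>) * L ^ ?k) * inverse ((q * s n) ^ ?k) =
          2 ^ CARD('n) * inverse \<kappa> * (2 * L / s n) ^ ?k"
        using q s[of n] \<kappa> by (simp add: field_simps)
      moreover have "0 \<le> q ^ ?k * (2 ^ CARD('n) * (2 ^ ?k * inverse \<kappa>) * L ^ ?k)"
        using q \<kappa> assms(2) by simp
      ultimately show ?thesis by (simp only: ennreal_mult_assoc_real)
    qed
    also have "ennreal (inverse ((q * s n) ^ ?k)) * hausdorff_outer ?k (B n) =
       (\<integral>\<^sup>+x. ennreal (inverse ((q * s n) ^ ?k)) * indicator (B n) x \<partial>hausdorff ?k)"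
      using B_sets[of n] by (subst nn_integral_cmult_indicator) (auto simp: emeasure_hausdorff)
    also have "\<dots> \<le> (\<integral>\<^sup>+x\<in>B n. \<phi> x \<partial>hausdorff ?k)"
    proof (rule nn_integral_mono)
      fix x
      show "ennreal (inverse ((q * s n) ^ ?k)) * indicator (B n) x \<le> \<phi> x * indicator (B n) x"
      proof (cases "x \<in> B n")
        case True
        then have gx: "0 < g x" "g x \<le> q * s n" using s[of n] by (auto simp: B_def intro: pos)
        have "inverse ((q * s n) ^ ?k) \<le> inverse (g x ^ ?k)"
          using gx by (intro le_imp_inverse_le power_mono) auto
        then have "ennreal (inverse ((q * s n) ^ ?k)) \<le> \<phi> x"
          unfolding \<phi>_def using gx by (simp add: ennreal_power inverse_ennreal ennreal_leI)
        then show ?thesis using True by simp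
      qed simp
    qed
    finally show ?thesis by (simp add: mult_left_mono)
  qed
  have "outer_measure_of lborel (cylinder_over I \<psi> A) \<le> outer_measure_of lborel (\<Union>n. cylinder_over I \<psi> (B n))"
    by (rule outer_measure_of_mono) (use cover in \<open>fastforce simp: cylinder_over_def\<close>)
  also have "\<dots> \<le> (\<Sum>n. outer_measure_of lborel (cylinder_over I \<psi> (B n)))"
    by (rule outer_measure_of_UN_le) simp
  also have "\<dots> \<le> (\<Sum>n. ennreal (q ^ ?k * (2 ^ CARD('n) * (2 ^ ?k * inverse \<kappa>) * L ^ ?k)) * (\<integral>\<^sup>+x\<in>B n. \<phi> x \<partial>hausdorff ?k))"
    by (intro suminf_le piece) auto
  also have "\<dots> = ennreal (q ^ ?k * (2 ^ CARD('n) * (2 ^ ?k * inverse \<kappa>) * L ^ ?k)) * (\<Sum>n. (\<integral>\<^sup>+x\<in>B n. \<phi> x \<partial>hausdorff ?k))"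
    by (rule ennreal_suminf_cmult)
  also have "(\<Sum>n. (\<integral>\<^sup>+x\<in>B n. \<phi> x \<partial>hausdorff ?k)) = (\<integral>\<^sup>+x\<in>(\<Union>n. B n). \<phi> x \<partial>hausdorff ?k)"
    using B_sets \<phi>_meas disj by (intro nn_integral_disjoint_family[symmetric]) auto
  finally show "outer_measure_of lborel (cylinder_over I \<psi> A) \<le> ennreal (q ^ ?k) * (ennreal (2 ^ CARD('n)) * (ennreal (2 ^ card I * inverse (unit_ball_vol (real (card I)))) *
              (ennreal L ^ card I * (\<integral>\<^sup>+x\<in>A. inverse (ennreal (g x) ^ card I) \<partial>hausdorff (card I)))))"
    using q \<kappa> assms(2) unfolding B_UN \<phi>_def \<kappa>_def
    by (simp add: ennreal_mult' ennreal_power mult.assoc)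
qed

section \<open>Components of excursion sets\<close>

lemma pd_diff_const [simp]: "pd W i (\<lambda>x. f x - l) = pd W i f"
proof -
  have "((\<lambda>x. f x - l) has_derivative D) (at x within W) \<longleftrightarrow> (f has_derivative D) (at x within W)" for D x
  proof
    assume "((\<lambda>x. f x - l) has_derivative D) (at x within W)"
    from has_derivative_add[OF this has_derivative_const[of l]]
    show "(f has_derivative D) (at x within W)" by simp
  next
    assume "(f has_derivative D) (at x within W)"
    from has_derivative_diff[OF this has_derivative_const[of l]]
    show "((\<lambda>x. f x - l) has_derivative D) (at x within W)" by simp
  qed
  then show ?thesis unfolding pd_def frechet_derivative_def by simp
qed

text \<open>The derivative within \<open>W\<close> determines the derivative along a coordinate segment contained in \<open>W\<close>,
  even when the segment runs inside the frontier.\<close>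

lemma has_real_derivative_pd:
  fixes f :: "real ^ 'n \<Rightarrow> real"
  assumes "f differentiable_on W" "r > 0" and in_W: "\<And>t. \<bar>t - t0\<bar> < r \<Longrightarrow> y + t *\<^sub>R axis i 1 \<in> W"
  shows "((\<lambda>t. f (y + t *\<^sub>R axis i 1)) has_real_derivative pd W i f (y + t0 *\<^sub>R axis i 1)) (at t0)"
proof -
  let ?c = "\<lambda>t::real. y + t *\<^sub>R axis i (1::real)"
  define D where "D = frechet_derivative f (at (?c t0) within W)"
  have "?c t0 \<in> W" using in_W[of t0] assms(2) by simp
  then have D: "(f has_derivative D) (at (?c t0) within W)"
    using assms(1) unfolding D_def differentiable_on_def frechet_derivative_works by blast
  have lin: "D (t *\<^sub>R axis i 1) = D (axis i 1) * t" for t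
    using linear_scale[OF has_derivative_linear[OF D], of t "axis i 1"] by simp
  have "(?c has_derivative (\<lambda>t. t *\<^sub>R axis i 1)) (at t0 within ball t0 r)"
    by (auto intro!: derivative_eq_intros)
  moreover have "(f has_derivative D) (at (?c t0) within (?c ` ball t0 r))"
    by (rule has_derivative_subset[OF D]) (auto simp: dist_real_def abs_minus_commute intro!: in_W)
  ultimately have "((\<lambda>t. f (?c t)) has_derivative (\<lambda>t. D (t *\<^sub>R axis i 1))) (at t0 within ball t0 r)"
    by (rule has_derivative_in_compose)
  then have "((\<lambda>t. f (?c t)) has_derivative (\<lambda>t. D (axis i 1) * t)) (at t0)"
    unfolding lin using at_within_open[of t0 "ball t0 r"] assms(2) by simp
  then show ?thesis
    unfolding has_field_derivative_def pd_def D_def .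
qed

lemma C11_continuous:
  assumes "C11_on W f"
  shows "f differentiable_on W" "continuous_on W f" "continuous_on W (pd W i f)"
proof -
  show d: "f differentiable_on W" using assms by (simp add: C11_on_def)
  show "continuous_on W f" by (rule differentiable_imp_continuous_on[OF d])
  show "continuous_on W (pd W i f)"
    unfolding continuous_on_iff
  proof (intro ballI allI impI)
    fix x and e :: real assume x: "x \<in> W" "e > 0"
    then obtain r K where r: "r > 0" and K: "K-lipschitz_on (ball x r \<inter> W) (\<lambda>y. \<chi> i. pd W i f y)"
      using assms unfolding C11_on_def by blast
    then have "continuous_on (ball x r \<inter> W) (\<lambda>y. (\<chi> i. pd W i f y) $ i)"
      by (intro continuous_intros lipschitz_on_continuous_on)
    then have "continuous_on (ball x r \<inter> W) (pd W i f)" by simp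
    then obtain d where d: "d > 0" "\<And>y. y \<in> ball x r \<inter> W \<Longrightarrow> dist y x < d \<Longrightarrow> dist (pd W i f y) (pd W i f x) < e"
      unfolding continuous_on_iff using x r by (metis IntI centre_in_ball)
    show "\<exists>d>0. \<forall>y\<in>W. dist y x < d \<longrightarrow> dist (pd W i f y) (pd W i f x) < e"
      using d r by (intro exI[of _ "min d r"]) (auto simp: dist_commute)
  qed
qed

lemma path_component_absorbs:
  assumes "C \<in> path_components_of (top_of_set F)" "path_connected S" "S \<subseteq> F" "S \<inter> C \<noteq> {}"
  shows "S \<subseteq> C"
proof (rule path_components_of_maximal[OF assms(1)])
  show "path_connectedin (top_of_set F) S"
    using assms(2,3) by (simp add: path_connectedin_subtopology)
  show "\<not> disjnt C S" using assms(4) by (auto simp: disjnt_def)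
qed

lemma positive_locally_star:
  assumes "polyrectangle W" "continuous_on W f" "x \<in> W" "f x > (l::real)"
  obtains r where "r > 0" "\<And>y. y \<in> W \<Longrightarrow> dist x y < r \<Longrightarrow> closed_segment x y \<subseteq> {x \<in> W. f x > l}"
proof -
  obtain r1 where r1: "r1 > 0" "\<And>y. y \<in> W \<Longrightarrow> dist x y < r1 \<Longrightarrow> closed_segment x y \<subseteq> W"
    using polyrectangle_locally_star[OF assms(1)] by blast
  obtain r2 where r2: "r2 > 0" "\<And>y. y \<in> W \<Longrightarrow> dist y x < r2 \<Longrightarrow> dist (f y) (f x) < f x - l"
    using assms(2-4) unfolding continuous_on_iff by (metis diff_gt_0_iff_gt)
  show ?thesis
  proof (rule that[of "min r1 r2"])
    fix y assume y: "y \<in> W" "dist x y < min r1 r2"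
    show "closed_segment x y \<subseteq> {x \<in> W. f x > l}"
    proof
      fix z assume z: "z \<in> closed_segment x y"
      then have "z \<in> W" using r1(2)[OF y(1)] y(2) by auto
      moreover have "dist z x < r2"
        using dist_in_closed_segment[OF z] y(2) by (simp add: dist_commute)
      ultimately show "z \<in> {x \<in> W. f x > l}" using r2(2)[of z] by (auto simp: dist_real_def)
    qed
  qed (use r1 r2 in auto)
qed

text \<open>Common to \<open>f \<ge> l\<close> and \<open>f > l\<close>: the two variants differ only where \<open>f = l\<close>.\<close>

definition excursion :: "(real ^ 'n) set \<Rightarrow> (real ^ 'n \<Rightarrow> real) \<Rightarrow> real \<Rightarrow> (real ^ 'n) set \<Rightarrow> bool" where
  "excursion W f l F \<longleftrightarrow> {x \<in> W. f x > l} \<subseteq> F \<and> F \<subseteq> {x \<in> W. f x \<ge> l}"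

text \<open>Where \<open>f > l\<close>, components are relatively open in \<open>W\<close>, and a limit point of a component
  belongs to it: short segments towards nearby points of \<open>W\<close> stay in the excursion set.\<close>

lemma component_contains_near:
  assumes "polyrectangle W" "continuous_on W f" "excursion W f l F"
    and C: "C \<in> path_components_of (top_of_set F)" and x: "x \<in> W" "f x > l" "x \<in> closure C"
  obtains r where "r > 0" "\<And>y. y \<in> W \<Longrightarrow> dist x y < r \<Longrightarrow> y \<in> C \<and> f y > l"
proof -
  obtain r where r: "r > 0" "\<And>y. y \<in> W \<Longrightarrow> dist x y < r \<Longrightarrow> closed_segment x y \<subseteq> {x \<in> W. f x > l}"
    using positive_locally_star[OF assms(1,2) x(1,2)] by blast
  have F: "{x \<in> W. f x > l} \<subseteq> F" "F \<subseteq> W" using assms(3) by (auto simp: excursion_def)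
  have "C \<subseteq> F" using C path_components_of_subset by fastforce
  obtain c where c: "c \<in> C" "dist c x < r" using x(3) r(1) unfolding closure_approachable by blast
  have seg: "closed_segment x y \<subseteq> F" if "y \<in> W" "dist x y < r" for y
    using r(2)[OF that] F(1) by blast
  have "closed_segment x c \<subseteq> C"
    using c \<open>C \<subseteq> F\<close> F(2) by (intro path_component_absorbs[OF C] seg) (auto simp: dist_commute)
  then have "x \<in> C" by auto
  have "y \<in> C \<and> f y > l" if "y \<in> W" "dist x y < r" for y
  proof -
    have "closed_segment x y \<subseteq> C"
      using \<open>x \<in> C\<close> that by (intro path_component_absorbs[OF C] seg) auto
    moreover have "y \<in> closed_segment x y" by simp
    ultimately show ?thesis using r(2)[OF that] by blast
  qed
  then show ?thesis using that[OF r(1)] by blast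
qed

text \<open>This is where regularity enters: at a point of level \<open>l\<close> some derivative in a free
  direction does not vanish, and moving along this direction, with the right sign, raises \<open>f\<close> above \<open>l\<close>.\<close>

lemma component_meets_positive:
  assumes "polyrectangle W" "C11_on W f" "regular_within W f l" "excursion W f l F"
    and C: "C \<in> path_components_of (top_of_set F)"
  obtains x where "x \<in> C" "f x > l"
proof -
  have F: "{x \<in> W. f x > l} \<subseteq> F" "F \<subseteq> {x \<in> W. f x \<ge> l}" using assms(4) by (auto simp: excursion_def)
  have "C \<subseteq> F" "C \<noteq> {}" using C path_components_of_subset nonempty_path_components_of by fastforce+
  then obtain x where x: "x \<in> C" "x \<in> F" by blast
  show ?thesis
  proof (cases "f x > l")
    case True then show ?thesis using that x by blast
  next
    case False
    then have fx: "f x = l" "x \<in> W" using x F by force+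
    have "card (free_dirs W x) \<le> CARD('a)" by (rule card_mono) auto
    then have "x \<notin> {x \<in> bdry (card (free_dirs W x)) W. f x = l \<and> (\<forall>i\<in>free_dirs W x. pd W i f x = 0)}"
      using assms(3) unfolding regular_within_def by blast
    then obtain i where i: "i \<in> free_dirs W x" "pd W i f x \<noteq> 0" using fx by (auto simp: bdry_def)
    obtain r where r: "r > 0" "\<And>t. \<bar>t\<bar> < r \<Longrightarrow> x + t *\<^sub>R axis i 1 \<in> W"
      using free_dirs_two_sided[OF assms(1) i(1)] by blast
    have der: "((\<lambda>t. f (x + t *\<^sub>R axis i 1)) has_real_derivative pd W i f x) (at 0)"
      using has_real_derivative_pd[of f W r 0 x i] r C11_continuous(1)[OF assms(2)] by simp
    obtain s d where s: "s = 1 \<or> s = -1" and d: "d > 0" "\<And>t. 0 < t \<Longrightarrow> t < d \<Longrightarrow> f (x + (s * t) *\<^sub>R axis i 1) > l"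
    proof (cases "pd W i f x > 0")
      case True
      from DERIV_pos_inc_right[OF der True] obtain d where "d > 0" "\<forall>h>0. h < d \<longrightarrow> f (x + 0 *\<^sub>R axis i 1) < f (x + (0 + h) *\<^sub>R axis i 1)"
        by blast
      then show ?thesis using that[of 1 d] fx by simp
    next
      case False
      with i(2) have "pd W i f x < 0" by simp
      from DERIV_neg_dec_left[OF der this] obtain d where "d > 0" "\<forall>h>0. h < d \<longrightarrow> f (x + 0 *\<^sub>R axis i 1) < f (x + (0 - h) *\<^sub>R axis i 1)"
        by blast
      then show ?thesis using that[of "-1" d] fx by simp
    qed
    define e where "e = min r d / 2"
    have e: "e > 0" "e < r" "e < d" using r(1) d(1) by (auto simp: e_def)
    let ?y = "x + (s * e) *\<^sub>R axis i 1"
    have "closed_segment x ?y \<subseteq> F"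
    proof
      fix z assume "z \<in> closed_segment x ?y"
      then obtain u where u: "0 \<le> u" "u \<le> 1" "z = x + (s * (u * e)) *\<^sub>R axis i 1"
        by (auto simp: in_segment algebra_simps)
      have ue: "u * e \<le> e" using u e by (simp add: mult_left_le_one_le)
      have zW: "z \<in> W" unfolding u(3) 
      proof (rule r(2))
        have "u * e < r" "0 \<le> u * e" using ue e(1,2) u(1) by (linarith, simp)
        then show "\<bar>s * (u * e)\<bar> < r" using s by auto
      qed
      show "z \<in> F"
      proof (cases "u = 0")
        case True
        then show ?thesis using x u by simp
      next
        case False
        then have "0 < u * e" using u(1) e(1) by simp
        then have "f z > l" unfolding u(3) using e(3) ue by (intro d(2)) linarith+
        then show ?thesis using zW F by auto
      qed
    qed
    then have "closed_segment x ?y \<subseteq> C"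
      using x by (intro path_component_absorbs[OF C]) auto
    then have "?y \<in> C" by auto
    moreover have "f ?y > l" using d(2)[of e] e by simp
    ultimately show ?thesis using that by blast
  qed
qed

text \<open>The exponential tilt turns each \<open>\<theta>\<close> into a value of the logarithmic gradient. At the maximum point,
  the derivatives of \<open>log (f - l) - \<theta> \<bullet> x\<close> in the free directions vanish.\<close>

lemma tilted_maximum_in_component:
  fixes f :: "real ^ 'n \<Rightarrow> real"
  assumes "polyrectangle W" "C11_on W f" "regular_within W f l" "excursion W f l F"
    and C: "C \<in> path_components_of (top_of_set F)" "bounded C"
  obtains x where "x \<in> C" "f x > l" "\<And>i. i \<in> free_dirs W x \<Longrightarrow> pd W i f x = \<theta> $ i * (f x - l)"
proof -
  have cl: "closed W" by (rule polyrectangle_closed[OF assms(1)])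
  have cont: "continuous_on W f" by (rule C11_continuous(2)[OF assms(2)])
  have F: "{x \<in> W. f x > l} \<subseteq> F" "F \<subseteq> W" using assms(4) by (auto simp: excursion_def)
  have "C \<subseteq> F" using C path_components_of_subset by fastforce
  then have CW: "closure C \<subseteq> W" using F(2) cl by (simp add: closure_minimal)
  obtain x0 where x0: "x0 \<in> C" "f x0 > l" by (rule component_meets_positive[OF assms(1-4) C(1)])
  define \<phi> where "\<phi> x = (f x - l) * exp (- (\<theta> \<bullet> x))" for x
  have "continuous_on (closure C) \<phi>"
    unfolding \<phi>_def by (intro continuous_intros continuous_on_subset[OF cont CW])
  moreover have "compact (closure C)" "closure C \<noteq> {}" using C(2) x0 by auto
  ultimately obtain x where x: "x \<in> closure C" "\<And>y. y \<in> closure C \<Longrightarrow> \<phi> y \<le> \<phi> x"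
    using continuous_attains_sup by metis
  have "0 < \<phi> x0" using x0 by (simp add: \<phi>_def)
  also have "\<dots> \<le> \<phi> x" using x(2)[of x0] x0(1) closure_subset by blast
  finally have fx: "f x > l" by (simp add: \<phi>_def zero_less_mult_iff)
  obtain r where r: "r > 0" "\<And>y. y \<in> W \<Longrightarrow> dist x y < r \<Longrightarrow> y \<in> C \<and> f y > l"
    using component_contains_near[OF assms(1) cont assms(4) C(1) _ fx x(1)] x(1) CW by blast
  have "x \<in> C" using r(2)[of x] r(1) x(1) CW by auto
  moreover have "pd W i f x = \<theta> $ i * (f x - l)" if i: "i \<in> free_dirs W x" for i
  proof -
    obtain r' where r': "r' > 0" "\<And>t. \<bar>t\<bar> < r' \<Longrightarrow> x + t *\<^sub>R axis i 1 \<in> W"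
      using free_dirs_two_sided[OF assms(1) i] by blast
    have der: "((\<lambda>t. f (x + t *\<^sub>R axis i 1)) has_real_derivative pd W i f x) (at 0)"
      using has_real_derivative_pd[of f W r' 0 x i] r' C11_continuous(1)[OF assms(2)] by simp
    have ax: "\<theta> \<bullet> (x + t *\<^sub>R axis i 1) = \<theta> \<bullet> x + t * \<theta> $ i" for t
      by (simp add: inner_add_right inner_axis)
    have "((\<lambda>t. \<phi> (x + t *\<^sub>R axis i 1)) has_real_derivative
        (pd W i f x * exp (- (\<theta> \<bullet> x + 0 * \<theta> $ i)) + (exp (- (\<theta> \<bullet> x + 0 * \<theta> $ i)) * (- \<theta> $ i)) * (f (x + 0 *\<^sub>R axis i 1) - l))) (at 0)"
      unfolding \<phi>_def ax by (auto intro!: derivative_eq_intros der)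
    moreover have "\<phi> (x + t *\<^sub>R axis i 1) \<le> \<phi> (x + 0 *\<^sub>R axis i 1)" if "\<bar>0 - t\<bar> < min r r'" for t
    proof -
      have "x + t *\<^sub>R axis i 1 \<in> C"
        using r(2)[of "x + t *\<^sub>R axis i 1"] r'(2)[of t] that by (auto simp: dist_norm)
      then show ?thesis using x(2) closure_subset by auto
    qed
    ultimately have "pd W i f x * exp (- (\<theta> \<bullet> x + 0 * \<theta> $ i)) + (exp (- (\<theta> \<bullet> x + 0 * \<theta> $ i)) * (- \<theta> $ i)) * (f (x + 0 *\<^sub>R axis i 1) - l) = 0"
      using r(1) r'(1) by (intro DERIV_local_max[where d = "min r r'"]) auto
    then have "exp (- (\<theta> \<bullet> x)) * (pd W i f x - \<theta> $ i * (f x - l)) = 0" by (simp add: algebra_simps)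
    then show ?thesis by simp
  qed
  ultimately show ?thesis using that fx by blast
qed

section \<open>The mass of one component\<close>

text \<open>The condition on arbitrarily small steps becomes a countable combination of closed sets: the points
  admitting a step with length in a given compact interval form the projection of a closed set along a
  compact fibre.\<close>

lemma borel_free_dirs_eq: "{x. free_dirs W x = I} \<in> sets (borel :: (real ^ 'n) measure)"
proof -
  have one: "{x. i \<in> free_dirs W x} \<in> sets borel" for i
  proof -
    define T where "T = {(e, x::real ^ 'n). x + e *\<^sub>R axis i 1 \<in> frontier W \<and> x - e *\<^sub>R axis i 1 \<in> frontier W}"
    have "T = ((\<lambda>p. snd p + fst p *\<^sub>R axis i 1) -` frontier W) \<inter> ((\<lambda>p. snd p - fst p *\<^sub>R axis i 1) -` frontier W)"
      unfolding T_def by auto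
    then have "closed T" by (auto intro!: closed_Int closed_vimage continuous_intros)
    define K where "K m n = {x. \<exists>e. e \<in> {1 / real (Suc m) .. 1 / real (Suc n) - 1 / real (Suc m)} \<and> (e, x) \<in> T}" for m n
    have K: "closed (K m n)" for m n
      unfolding K_def by (rule closed_compact_projection[OF compact_Icc \<open>closed T\<close>])
    have *: "(\<forall>\<delta>>0. \<exists>e. 0 < e \<and> e < \<delta> \<and> (e, x) \<in> T) \<longleftrightarrow> (\<forall>n. \<exists>m. x \<in> K m n)" for x
    proof
      assume L: "\<forall>\<delta>>0. \<exists>e. 0 < e \<and> e < \<delta> \<and> (e, x) \<in> T"
      show "\<forall>n. \<exists>m. x \<in> K m n"
      proof
        fix n
        obtain e where e: "0 < e" "e < 1 / real (Suc n)" "(e, x) \<in> T" using L by (meson of_nat_0_less_iff zero_less_Suc zero_less_divide_1_iff)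
        obtain m where "1 / real (Suc m) < min e (1 / real (Suc n) - e)"
          using reals_Archimedean[of "min e (1 / real (Suc n) - e)"] e by (auto simp: inverse_eq_divide)
        then have "e \<in> {1 / real (Suc m) .. 1 / real (Suc n) - 1 / real (Suc m)}"
          unfolding atLeastAtMost_iff min_less_iff_conj by linarith
        then have "x \<in> K m n" unfolding K_def using e(3) by blast
        then show "\<exists>m. x \<in> K m n" ..
      qed
    next
      assume R: "\<forall>n. \<exists>m. x \<in> K m n"
      show "\<forall>\<delta>>0. \<exists>e. 0 < e \<and> e < \<delta> \<and> (e, x) \<in> T"
      proof (intro allI impI)
        fix \<delta> :: real assume "\<delta> > 0"
        then obtain n where n: "1 / real (Suc n) < \<delta>" using reals_Archimedean[of \<delta>] by (auto simp: inverse_eq_divide)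
        obtain m where "x \<in> K m n" using R by blast
        then obtain e where e: "1 / real (Suc m) \<le> e" "e \<le> 1 / real (Suc n) - 1 / real (Suc m)" "(e, x) \<in> T"
          unfolding K_def by auto
        have "0 < 1 / real (Suc m)" by simp
        then have "0 < e" "e < \<delta>" using e n by linarith+
        then show "\<exists>e. 0 < e \<and> e < \<delta> \<and> (e, x) \<in> T" using e(3) by blast
      qed
    qed
    have "{x. i \<in> free_dirs W x} = interior W \<union> (- interior W \<inter> (\<Inter>n. \<Union>m. K m n))"
      using * unfolding free_dirs_def T_def by auto
    also have "\<dots> \<in> sets borel"
      using K by (intro sets.Un sets.Int sets.countable_INT'' sets.countable_UN'' borel_comp borel_closed borel_open open_interior sets.countable_INT sets.countable_UN) (auto intro: borel_closed)
    finally show ?thesis .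
  qed
  have "{x. free_dirs W x = I} = (\<Inter>i. if i \<in> I then {x. i \<in> free_dirs W x} else - {x. i \<in> free_dirs W x})"
    by (auto split: if_splits)
  also have "\<dots> \<in> sets borel"
    using one by (intro sets.finite_INT) (auto intro: borel_comp)
  finally show ?thesis .
qed

text \<open>The part of a component on which the logarithmic derivatives in the free directions lie in
  \<open>[-1,1]\<close>; only these values are needed to cover the cube. There \<open>f - l\<close> dominates the free partial
  derivatives, so it is the denominator in the integral defining \<open>I_val\<close>.\<close>

definition tame_part ::
  "(real ^ 'n) set \<Rightarrow> (real ^ 'n \<Rightarrow> real) \<Rightarrow> real \<Rightarrow> (real ^ 'n) set \<Rightarrow> 'n set \<Rightarrow> (real ^ 'n) set" where
  "tame_part W f l C I =
    {x \<in> C. f x > l \<and> free_dirs W x = I \<and> (\<forall>i\<in>I. \<bar>pd W i f x\<bar> \<le> f x - l)}"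

lemma borel_tame_part:
  assumes "polyrectangle W" "C11_on W f" "excursion W f l F"
    and C: "C \<in> path_components_of (top_of_set F)"
  shows "tame_part W f l C I \<in> sets borel"
proof -
  have W: "closed W" "W \<in> sets borel" using polyrectangle_closed[OF assms(1)] by auto
  have cont: "continuous_on W f" by (rule C11_continuous(2)[OF assms(2)])
  have "C \<subseteq> F" using C path_components_of_subset by fastforce
  then have CW: "C \<subseteq> W" using assms(3) by (auto simp: excursion_def)
  have "openin (top_of_set W) {x \<in> C. f x > l}"
    unfolding openin_euclidean_subtopology_iff
  proof (intro conjI ballI)
    fix x assume x: "x \<in> {x \<in> C. f x > l}"
    have "x \<in> closure C" using x closure_subset by blast
    then obtain r where "r > 0" "\<And>y. y \<in> W \<Longrightarrow> dist x y < r \<Longrightarrow> y \<in> C \<and> f y > l"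
      using component_contains_near[OF assms(1) cont assms(3) C] x CW by blast
    then show "\<exists>e>0. \<forall>x'\<in>W. dist x' x < e \<longrightarrow> x' \<in> {x \<in> C. f x > l}"
      by (intro exI[of _ r]) (auto simp: dist_commute)
  qed (use CW in auto)
  then obtain T where T: "open T" "{x \<in> C. f x > l} = W \<inter> T" by (auto simp: openin_open)
  define h where "h x = indicator W x *\<^sub>R (f x - l)" for x
  define p where "p i x = indicator W x *\<^sub>R pd W i f x" for i x
  have [measurable]: "h \<in> borel_measurable borel"
    unfolding h_def by (intro borel_measurable_continuous_on_indicator W continuous_intros cont)
  have [measurable]: "p i \<in> borel_measurable borel" for i
    unfolding p_def by (intro borel_measurable_continuous_on_indicator W C11_continuous(3)[OF assms(2)])
  have "{x. \<bar>p i x\<bar> \<le> h x} \<in> sets borel" for i by measurable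
  then have "(\<Inter>i\<in>I. {x. \<bar>p i x\<bar> \<le> h x}) \<in> sets borel"
    by (cases "I = {}") (auto intro!: sets.finite_INT)
  moreover have "tame_part W f l C I = W \<inter> T \<inter> {x. free_dirs W x = I} \<inter> (\<Inter>i\<in>I. {x. \<bar>p i x\<bar> \<le> h x})"
    unfolding T(2)[symmetric] using CW by (auto simp: tame_part_def h_def p_def)
  ultimately show ?thesis
    using W(2) T(1) borel_free_dirs_eq[of W I] by auto
qed

lemma lipschitz_of_Lip_le:
  assumes "Lip W g \<le> ennreal L" "0 \<le> L" "x \<in> W" "y \<in> W"
  shows "\<bar>g x - g y\<bar> \<le> L * dist x y"
proof (rule field_le_epsilon)
  fix e :: real assume e: "e > 0"
  define d where "d = e / (dist x y + 1)"
  have d: "d > 0" "d * dist x y \<le> e" using e unfolding d_def by (auto simp: field_simps add_pos_nonneg)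
  have "Lip W g < ennreal (L + d)" using assms(1,2) d(1) by (auto intro: le_less_trans simp: ennreal_lessI)
  then obtain K where K: "K-lipschitz_on W g" "ennreal K < ennreal (L + d)"
    unfolding Lip_def INF_less_iff by auto
  then have "K < L + d" using assms(2) d(1) by (metis ennreal_less_iff lipschitz_on_nonneg)
  have "\<bar>g x - g y\<bar> \<le> K * dist x y"
    using lipschitz_onD[OF K(1) assms(3,4)] by (simp add: dist_real_def)
  also have "\<dots> \<le> (L + d) * dist x y" using \<open>K < L + d\<close> by (intro mult_right_mono) auto
  also have "\<dots> \<le> L * dist x y + e" using d(2) by (simp add: algebra_simps)
  finally show "\<bar>g x - g y\<bar> \<le> L * dist x y + e" .
qed

lemma outer_measure_of_Un_le:
  assumes "A \<subseteq> space M" "B \<subseteq> space M"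
  shows "outer_measure_of M (A \<union> B) \<le> outer_measure_of M A + outer_measure_of M B"
proof -
  obtain A' where A: "A' \<in> sets M" "A \<subseteq> A'" "outer_measure_of M A = emeasure M A'"
    using outer_measure_of_attain[OF assms(1)] by blast
  obtain B' where B: "B' \<in> sets M" "B \<subseteq> B'" "outer_measure_of M B = emeasure M B'"
    using outer_measure_of_attain[OF assms(2)] by blast
  have "outer_measure_of M (A \<union> B) \<le> outer_measure_of M (A' \<union> B')"
    using A(2) B(2) by (intro outer_measure_of_mono) blast
  also have "\<dots> = emeasure M (A' \<union> B')" using A(1) B(1) by (intro outer_measure_of_eq) auto
  also have "\<dots> \<le> emeasure M A' + emeasure M B'" by (rule emeasure_subadditive[OF A(1) B(1)])
  finally show ?thesis using A(3) B(3) by simp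
qed

lemma outer_measure_of_finite_UN_le:
  assumes "finite S" "\<And>s. s \<in> S \<Longrightarrow> A s \<subseteq> space M"
  shows "outer_measure_of M (\<Union>s\<in>S. A s) \<le> (\<Sum>s\<in>S. outer_measure_of M (A s))"
  using assms
proof (induction S rule: finite_induct)
  case (insert x S)
  have "outer_measure_of M (\<Union>s\<in>insert x S. A s) \<le> outer_measure_of M (A x) + outer_measure_of M (\<Union>s\<in>S. A s)"
    using insert.prems by (simp, intro outer_measure_of_Un_le) auto
  also have "\<dots> \<le> outer_measure_of M (A x) + (\<Sum>s\<in>S. outer_measure_of M (A s))"
    using insert by (intro add_left_mono) auto
  finally show ?case using insert by simp
qed auto

text \<open>The cylinders over the logarithmic gradient cover the open cube, which has volume \<open>2 ^ n\<close>. The empty set of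
  directions does not occur, since it would be attained at a corner.\<close>

lemma one_le_component_mass:
  fixes f :: "real ^ 'n \<Rightarrow> real"
  assumes "polyrectangle W" "C11_on W f" "regular_within W f l" "excursion W f l F"
    and C: "C \<in> path_components_of (top_of_set F)" "bounded C" "C \<inter> corners W = {}"
    and L: "0 \<le> L" "\<And>x y. x \<in> W \<Longrightarrow> y \<in> W \<Longrightarrow> \<bar>f x - f y\<bar> \<le> L * dist x y"
      "\<And>i x y. x \<in> W \<Longrightarrow> y \<in> W \<Longrightarrow> \<bar>pd W i f x - pd W i f y\<bar> \<le> L * dist x y"
  shows "1 \<le> (\<Sum>I\<in>- {{}}. ennreal (2 ^ card I * inverse (unit_ball_vol (real (card I)))) *
      (ennreal L ^ card I * (\<integral>\<^sup>+x\<in>tame_part W f l C I. inverse (ennreal (f x - l) ^ card I) \<partial>hausdorff (card I))))"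
proof -
  have cont: "continuous_on W f" and W: "closed W"
    by (rule C11_continuous(2)[OF assms(2)], rule polyrectangle_closed[OF assms(1)])
  have "C \<subseteq> F" using C path_components_of_subset by fastforce
  then have CW: "C \<subseteq> W" using assms(4) by (auto simp: excursion_def)
  define A where "A = tame_part W f l C"
  define \<psi> :: "real ^ 'n \<Rightarrow> real ^ 'n" where "\<psi> x = (\<chi> i. pd W i f x / (f x - l))" for x
  define h where "h x = indicator W x *\<^sub>R (f x - l)" for x
  have h_meas: "h \<in> borel_measurable borel"
    unfolding h_def by (intro borel_measurable_continuous_on_indicator borel_closed W continuous_intros cont)
  have h_eq: "h x = f x - l" if "x \<in> A I" for x I
    using that CW by (auto simp: h_def A_def tame_part_def)
  have cover: "box (- 1) 1 \<subseteq> (\<Union>I\<in>- {{}}. cylinder_over I \<psi> (A I))"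
  proof
    fix \<theta> :: "real ^ 'n" assume "\<theta> \<in> box (- 1) 1"
    then have \<theta>: "\<bar>\<theta> $ i\<bar> < 1" for i by (simp add: mem_box_cart abs_less_iff minus_less_iff)
    obtain x where x: "x \<in> C" "f x > l" "\<And>i. i \<in> free_dirs W x \<Longrightarrow> pd W i f x = \<theta> $ i * (f x - l)"
      using tilted_maximum_in_component[OF assms(1-4) C(1,2)] by blast
    define I where "I = free_dirs W x"
    have "I \<noteq> {}" using x(1) C(3) CW by (auto simp: I_def corners_def bdry_def)
    have "\<bar>pd W i f x\<bar> \<le> f x - l" if "i \<in> I" for i
      using x(3)[of i] that \<theta>[of i] x(2) by (simp add: I_def abs_mult mult_left_le_one_le)
    then have "x \<in> A I" using x by (auto simp: A_def tame_part_def I_def)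
    moreover have "\<forall>i\<in>I. \<theta> $ i = \<psi> x $ i" using x by (simp add: \<psi>_def I_def)
    ultimately have "\<theta> \<in> cylinder_over I \<psi> (A I)" unfolding cylinder_over_def using \<theta> by (auto intro: less_imp_le)
    then show "\<theta> \<in> (\<Union>I\<in>- {{}}. cylinder_over I \<psi> (A I))" using \<open>I \<noteq> {}\<close> by blast
  qed
  define c where "c I = ennreal (2 ^ card I * inverse (unit_ball_vol (real (card I)))) *
      (ennreal L ^ card I * (\<integral>\<^sup>+x\<in>A I. inverse (ennreal (f x - l) ^ card I) \<partial>hausdorff (card I)))" for I
  have piece: "outer_measure_of lborel (cylinder_over I \<psi> (A I)) \<le> ennreal (2 ^ CARD('n)) * c I" if "I \<noteq> {}" for I
  proof -
    have "outer_measure_of lborel (cylinder_over I \<psi> (A I)) \<le>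
      ennreal (2 ^ CARD('n)) * (ennreal (2 ^ card I * inverse (unit_ball_vol (real (card I)))) *
      (ennreal L ^ card I * (\<integral>\<^sup>+x\<in>A I. inverse (ennreal (h x) ^ card I) \<partial>hausdorff (card I))))"
    proof (rule outer_cylinder_le_integral[OF that L(1) _ h_meas])
      show "A I \<in> sets borel" unfolding A_def by (rule borel_tame_part[OF assms(1,2,4) C(1)])
      show "h x > 0" if "x \<in> A I" for x using that h_eq[OF that] by (simp add: A_def tame_part_def)
      fix x y i assume xy: "x \<in> A I" "y \<in> A I" "i \<in> I"
      define gx gy px py where "gx = f x - l" and "gy = f y - l" and "px = pd W i f x" and "py = pd W i f y"
      have gp: "gx > 0" "gy > 0" "\<bar>py\<bar> \<le> gy" and W: "x \<in> W" "y \<in> W"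
        using xy CW by (auto simp: A_def tame_part_def gx_def gy_def py_def)
      \<comment> \<open>The factor \<open>py / gy\<close> is at most 1 in absolute value, which leaves \<open>gx\<close> as the only denominator.\<close>
      have "px / gx - py / gy = (px - py) / gx + (py / gy) * ((gy - gx) / gx)"
        using gp by (simp add: field_simps)
      then have "\<bar>px / gx - py / gy\<bar> \<le> \<bar>(px - py) / gx\<bar> + \<bar>(py / gy) * ((gy - gx) / gx)\<bar>"
        by linarith
      also have "\<dots> = \<bar>px - py\<bar> / gx + (\<bar>py\<bar> / gy) * (\<bar>gy - gx\<bar> / gx)"
        using gp by (simp add: abs_mult)
      also have "\<dots> \<le> L * dist x y / gx + 1 * (L * dist x y / gx)"
      proof (intro add_mono mult_mono divide_right_mono)
        show "\<bar>px - py\<bar> \<le> L * dist x y" unfolding px_def py_def by (rule L(3)[OF W])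
        show "\<bar>gy - gx\<bar> \<le> L * dist x y"
          using L(2)[OF W] unfolding gx_def gy_def by (simp add: abs_minus_commute)
        show "\<bar>py\<bar> / gy \<le> 1" using gp by simp
      qed (use gp in auto)
      also have "\<dots> = 2 * L / h x * dist x y" unfolding h_eq[OF xy(1)] gx_def[symmetric] by simp
      finally show "\<bar>\<psi> x $ i - \<psi> y $ i\<bar> \<le> 2 * L / h x * dist x y"
        by (simp add: \<psi>_def px_def py_def gx_def gy_def)
    qed
    also have "(\<integral>\<^sup>+x\<in>A I. inverse (ennreal (h x) ^ card I) \<partial>hausdorff (card I)) =
        (\<integral>\<^sup>+x\<in>A I. inverse (ennreal (f x - l) ^ card I) \<partial>hausdorff (card I))"
      by (rule nn_integral_cong) (simp add: h_eq split: split_indicator)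
    finally show ?thesis by (simp add: c_def)
  qed
  have "ennreal (2 ^ CARD('n)) = outer_measure_of lborel (box (- 1) (1 :: real ^ 'n))"
    by (simp add: emeasure_lborel_symmetric_cube)
  also have "\<dots> \<le> outer_measure_of lborel (\<Union>I\<in>- {{}}. cylinder_over I \<psi> (A I))"
    by (rule outer_measure_of_mono[OF cover])
  also have "\<dots> \<le> (\<Sum>I\<in>- {{}}. outer_measure_of lborel (cylinder_over I \<psi> (A I)))"
    by (rule outer_measure_of_finite_UN_le) auto
  also have "\<dots> \<le> (\<Sum>I\<in>- {{}}. ennreal (2 ^ CARD('n)) * c I)"
    by (intro sum_mono piece) auto
  also have "\<dots> = ennreal (2 ^ CARD('n)) * (\<Sum>I\<in>- {{}}. c I)" by (simp add: sum_distrib_left)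
  finally have "ennreal (1 / 2 ^ CARD('n)) * ennreal (2 ^ CARD('n)) \<le>
      ennreal (1 / 2 ^ CARD('n)) * (ennreal (2 ^ CARD('n)) * (\<Sum>I\<in>- {{}}. c I))"
    by (rule mult_left_mono) simp
  moreover have cancel: "ennreal (1 / 2 ^ CARD('n)) * (ennreal (2 ^ CARD('n)) * X) = X" for X
    by (subst ennreal_mult_assoc_real) simp_all
  moreover have "ennreal (1 / 2 ^ CARD('n)) * ennreal (2 ^ CARD('n)) = 1"
    using cancel[of 1] by simp
  ultimately have "1 \<le> (\<Sum>I\<in>- {{}}. c I)" by simp
  then show ?thesis by (simp add: c_def A_def)
qed

text \<open>A sum of integrals over sets of multiplicity at most \<open>N\<close>. The bound \<open>\<phi>\<close> is not assumed to be measurable,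
  so the factor \<open>N\<close> has to be moved to the other side before integrating.\<close>

lemma sum_nn_integral_le_overlap:
  assumes "finite S" "\<And>s. s \<in> S \<Longrightarrow> v s \<in> borel_measurable M"
    and le: "\<And>s x. s \<in> S \<Longrightarrow> v s x \<le> (if x \<in> A s then \<phi> x else 0)"
    and N: "\<And>x. card {s \<in> S. x \<in> A s} \<le> N"
  shows "(\<Sum>s\<in>S. \<integral>\<^sup>+x. v s x \<partial>M) \<le> of_nat N * (\<integral>\<^sup>+x. \<phi> x \<partial>M)"
proof -
  have pt: "(\<Sum>s\<in>S. v s x) \<le> of_nat N * \<phi> x" for x
  proof -
    have "(\<Sum>s\<in>S. v s x) \<le> (\<Sum>s\<in>S. if x \<in> A s then \<phi> x else 0)" by (intro sum_mono le)
    also have "\<dots> = of_nat (card {s \<in> S. x \<in> A s}) * \<phi> x"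
      using assms(1) by (simp add: sum.If_cases Int_def)
    also have "\<dots> \<le> of_nat N * \<phi> x" using N by (intro mult_right_mono) auto
    finally show ?thesis .
  qed
  have sum: "(\<Sum>s\<in>S. \<integral>\<^sup>+x. v s x \<partial>M) = (\<integral>\<^sup>+x. (\<Sum>s\<in>S. v s x) \<partial>M)"
    using assms(2) by (intro nn_integral_sum[symmetric]) auto
  show ?thesis
  proof (cases "N = 0")
    case True
    then have "(\<Sum>s\<in>S. v s x) = 0" for x using pt[of x] by simp
    then show ?thesis unfolding sum by simp
  next
    case False
    have inv: "inverse (of_nat N) * (of_nat N * X) = X" "of_nat N * (inverse (of_nat N) * X) = X" for X :: ennreal
    proof -
      have "inverse (of_nat N :: ennreal) * of_nat N = 1"
        using False by (simp add: ennreal_of_nat_eq_real_of_nat inverse_ennreal ennreal_mult'[symmetric])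
      then show "inverse (of_nat N) * (of_nat N * X) = X" "of_nat N * (inverse (of_nat N) * X) = X"
        by (metis mult.assoc mult.commute mult_1)+
    qed
    have "(\<integral>\<^sup>+x. inverse (of_nat N) * (\<Sum>s\<in>S. v s x) \<partial>M) \<le> (\<integral>\<^sup>+x. \<phi> x \<partial>M)"
    proof (rule nn_integral_mono)
      fix x
      show "inverse (of_nat N) * (\<Sum>s\<in>S. v s x) \<le> \<phi> x"
        using mult_left_mono[OF pt[of x], of "inverse (of_nat N)"] by (simp add: inv)
    qed
    moreover have "(\<integral>\<^sup>+x. inverse (of_nat N) * (\<Sum>s\<in>S. v s x) \<partial>M) = inverse (of_nat N) * (\<integral>\<^sup>+x. (\<Sum>s\<in>S. v s x) \<partial>M)"
      using assms(2) by (intro nn_integral_cmult borel_measurable_sum) auto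
    ultimately have "of_nat N * (inverse (of_nat N) * (\<integral>\<^sup>+x. (\<Sum>s\<in>S. v s x) \<partial>M)) \<le> of_nat N * (\<integral>\<^sup>+x. \<phi> x \<partial>M)"
      by (intro mult_left_mono) auto
    then show ?thesis unfolding sum inv .
  qed
qed

section \<open>Counting bounded components\<close>

definition critical_weight :: "(real ^ 'n) set \<Rightarrow> (real ^ 'n \<Rightarrow> real) \<Rightarrow> nat \<Rightarrow> real ^ 'n \<Rightarrow> ennreal" where
  "critical_weight W g k x =
     inverse (ennreal (Max (insert \<bar>g x\<bar> ((\<lambda>i. \<bar>pd W i g x\<bar>) ` free_dirs W x))) ^ k)"

definition lip_scale :: "(real ^ 'n) set \<Rightarrow> (real ^ 'n \<Rightarrow> real) \<Rightarrow> ennreal" where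
  "lip_scale W g = Max (insert (Lip W g) (range (\<lambda>i. Lip W (pd W i g))))"

lemma I_val_eq:
  assumes "0 < k" "\<not> (Lip W g = 0 \<and> (\<forall>x\<in>W. g x = 0))"
  shows "I_val k W g = lip_scale W g ^ k * (\<integral>\<^sup>+x\<in>bdry k W. critical_weight W g k x \<partial>hausdorff k)"
  using assms unfolding I_val_def critical_weight_def lip_scale_def by (simp only: if_False) simp

lemma Lip_le_lip_scale: "Lip W g \<le> lip_scale W g" "Lip W (pd W i g) \<le> lip_scale W g"
  unfolding lip_scale_def by (rule Max_ge; simp)+

lemma ncard_finite: "finite A \<Longrightarrow> ncard A = of_nat (card A)"
  unfolding ncard_def by (simp add: emeasure_count_space_finite)

lemma card_le_ncard:
  assumes "finite S" "inj_on c S" "c ` S \<subseteq> A"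
  shows "of_nat (card S) \<le> ncard A"
proof -
  have "of_nat (card S) = ncard (c ` S)"
    using assms(1,2) by (simp add: ncard_finite card_image)
  also have "\<dots> \<le> ncard A" unfolding ncard_def using assms(3) by (intro emeasure_mono) auto
  finally show ?thesis .
qed

lemma ncard_le_of_finite_subsets:
  assumes "\<And>S. finite S \<Longrightarrow> S \<subseteq> A \<Longrightarrow> of_nat (card S) \<le> X"
  shows "ncard A \<le> X"
proof (cases "finite A")
  case True
  then show ?thesis using assms[of A] by (simp add: ncard_finite)
next
  case False
  have "of_nat n \<le> X" for n
    using infinite_arbitrarily_large[OF False, of n] assms by metis
  then have "X = top"
  proof (cases X)
    case (real x)
    obtain n where "x < real n" using reals_Archimedean2 by blast
    with \<open>of_nat n \<le> X\<close> real show ?thesis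
      by (simp add: ennreal_of_nat_eq_real_of_nat ennreal_le_iff)
  qed auto
  then show ?thesis by simp
qed

lemma critical_weight_on_tame_part:
  assumes "x \<in> tame_part W f l C I"
  shows "critical_weight W (\<lambda>x. f x - l) k x = inverse (ennreal (f x - l) ^ k)"
proof -
  have "Max (insert \<bar>f x - l\<bar> ((\<lambda>i. \<bar>pd W i f x\<bar>) ` free_dirs W x)) = f x - l"
    using assms by (intro Max_eqI) (auto simp: tame_part_def)
  then show ?thesis by (simp add: critical_weight_def)
qed

text \<open>The tame parts for different components or different sets of free directions are disjoint.\<close>

lemma sum_tame_parts_le:
  fixes f :: "real ^ 'n \<Rightarrow> real"
  assumes "polyrectangle W" "C11_on W f" "excursion W f l F"
    and fam: "finite \<C>" "\<C> \<subseteq> path_components_of (top_of_set F)"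
  shows "(\<Sum>I | card I = k. \<Sum>C\<in>\<C>. \<integral>\<^sup>+x\<in>tame_part W f l C I. inverse (ennreal (f x - l) ^ k) \<partial>hausdorff k)
     \<le> (\<integral>\<^sup>+x\<in>bdry k W. critical_weight W (\<lambda>x. f x - l) k x \<partial>hausdorff k)"
proof -
  have cont: "continuous_on W f" and W: "closed W"
    by (rule C11_continuous(2)[OF assms(2)], rule polyrectangle_closed[OF assms(1)])
  have CW: "C \<subseteq> W" if "C \<in> \<C>" for C
    using that fam(2) path_components_of_subset[of C "top_of_set F"] assms(3) by (auto simp: excursion_def)
  define h where "h x = indicator W x *\<^sub>R (f x - l)" for x
  have h_meas [measurable]: "h \<in> borel_measurable borel"
    unfolding h_def by (intro borel_measurable_continuous_on_indicator borel_closed W continuous_intros cont)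
  define S where "S = {I :: 'n set. card I = k} \<times> \<C>"
  define T where "T s = tame_part W f l (snd s) (fst s)" for s
  define v where "v s x = inverse (ennreal (f x - l) ^ k) * indicator (T s) x" for s x
  define \<phi> where "\<phi> x = critical_weight W (\<lambda>x. f x - l) k x * indicator (bdry k W) x" for x
  have "(\<Sum>s\<in>S. \<integral>\<^sup>+x. v s x \<partial>hausdorff k) \<le> of_nat 1 * (\<integral>\<^sup>+x. \<phi> x \<partial>hausdorff k)"
  proof (rule sum_nn_integral_le_overlap)
    show "finite S" unfolding S_def using fam(1) by auto
    fix s assume s: "s \<in> S"
    then have C: "snd s \<in> path_components_of (top_of_set F)" "snd s \<in> \<C>" using fam(2) by (auto simp: S_def)
    have [measurable]: "T s \<in> sets borel"
      unfolding T_def by (rule borel_tame_part[OF assms(1-3) C(1)])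
    have "v s = (\<lambda>x. inverse (ennreal (h x) ^ k) * indicator (T s) x)"
      using CW[OF C(2)] by (auto simp: v_def h_def T_def tame_part_def fun_eq_iff split: split_indicator)
    then show "v s \<in> borel_measurable (hausdorff k)" by simp
    fix x
    show "v s x \<le> (if x \<in> T s then \<phi> x else 0)"
    proof (cases "x \<in> T s")
      case True
      then have "x \<in> bdry k W"
        using s CW[OF C(2)] by (auto simp: T_def tame_part_def bdry_def S_def)
      then show ?thesis using True critical_weight_on_tame_part[of x W f l "snd s" "fst s" k]
        by (simp add: v_def \<phi>_def T_def)
    qed (simp add: v_def)
  next
    fix x
    have "s = t" if "s \<in> S" "t \<in> S" "x \<in> T s" "x \<in> T t" for s t
    proof -
      have "fst s = fst t" "x \<in> snd s" "x \<in> snd t" using that(3,4) by (auto simp: T_def tame_part_def)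
      moreover have "snd s \<in> path_components_of (top_of_set F)" "snd t \<in> path_components_of (top_of_set F)"
        using that(1,2) fam(2) by (auto simp: S_def)
      ultimately show ?thesis
        using pairwise_disjoint_path_components_of[of "top_of_set F"] unfolding pairwise_def disjnt_def
        by (metis IntI empty_iff prod_eqI)
    qed
    then show "card {s \<in> S. x \<in> T s} \<le> 1"
      using fam(1) by (auto simp: card_le_Suc0_iff_eq S_def)
  qed
  moreover have "(\<Sum>s\<in>S. \<integral>\<^sup>+x. v s x \<partial>hausdorff k) =
     (\<Sum>I | card I = k. \<Sum>C\<in>\<C>. \<integral>\<^sup>+x\<in>tame_part W f l C I. inverse (ennreal (f x - l) ^ k) \<partial>hausdorff k)"
    unfolding S_def v_def T_def by (simp add: sum.cartesian_product split_def)
  ultimately show ?thesis by (simp add: \<phi>_def)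
qed

lemma polyrectangle_interior_nonempty:
  fixes W :: "(real ^ 'n) set"
  assumes "polyrectangle W" "W \<noteq> {}"
  shows "interior W \<noteq> {}"
proof -
  from assms obtain m and I :: "nat \<Rightarrow> 'n \<Rightarrow> real set" where I: "\<And>k. k < m \<Longrightarrow> rect_sides (I k)"
    "W = (\<Union>k<m. rectangle (I k))"
    unfolding polyrectangle_def by blast
  with assms(2) have m: "0 < m" by (cases m) auto
  then have "rect_sides (I 0)" by (rule I(1))
  then have "\<forall>c. \<exists>a. a \<in> interior (I 0 c)" by (auto simp: rect_sides_def)
  then obtain a where a: "\<And>c. a c \<in> interior (I 0 c)" by metis
  define U where "U = {x :: real ^ 'n. \<forall>c. x $ c \<in> interior (I 0 c)}"
  have "U = (\<Inter>c. (\<lambda>x. x $ c) -` interior (I 0 c))" by (auto simp: U_def)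
  moreover have "open ((\<lambda>x::real^'n. x $ c) -` interior (I 0 c))" for c
    by (intro open_vimage open_interior continuous_intros)
  ultimately have "open U" by auto
  moreover have "U \<subseteq> W"
  proof
    fix x assume "x \<in> U"
    then have "x \<in> rectangle (I 0)"
      using interior_subset[of "I 0 _"] by (auto simp: U_def rectangle_def)
    then show "x \<in> W" unfolding I(2) using m by blast
  qed
  ultimately have "U \<subseteq> interior W" by (simp add: interior_maximal)
  moreover have "(\<chi> c. a c) \<in> U" using a by (simp add: U_def)
  ultimately show ?thesis by blast
qed

lemma borel_flat_slice: "flat_slice I p a R \<in> sets borel"
proof -
  have "flat_slice I p a R = (\<Inter>c. if c \<in> I then {x. \<bar>x $ c - p $ c\<bar> < R} else {x. x $ c = a $ c})"
    by (auto simp: flat_slice_def split: if_splits)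
  also have "\<dots> \<in> sets borel"
  proof (intro sets.finite_INT)
    fix c
    have "open {x :: real ^ 'a. \<bar>x $ c - p $ c\<bar> < R}"
      by (intro open_Collect_less continuous_intros)
    moreover have "closed {x :: real ^ 'a. x $ c = a $ c}"
      by (intro closed_Collect_eq continuous_intros)
    ultimately show "(if c \<in> I then {x. \<bar>x $ c - p $ c\<bar> < R} else {x. x $ c = a $ c}) \<in> sets borel"
      by auto
  qed auto
  finally show ?thesis .
qed

lemma norm_le_card_cart:
  fixes v :: "real ^ 'n"
  assumes "\<And>c. \<bar>v $ c\<bar> \<le> R"
  shows "norm v \<le> real CARD('n) * R"
proof -
  have "norm v \<le> (\<Sum>c\<in>UNIV. \<bar>v $ c\<bar>)" by (rule norm_le_l1_cart)
  also have "\<dots> \<le> (\<Sum>c\<in>(UNIV::'n set). R)" by (intro sum_mono assms)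
  finally show ?thesis by simp
qed

lemma ennreal_inverse_antimono: "a \<le> b \<Longrightarrow> inverse b \<le> inverse (a :: ennreal)"
proof (cases "a = 0 \<or> b = top")
  case True
  then show ?thesis by auto
next
  case False
  assume le: "a \<le> b"
  have "a < top" using le False by (metis top.not_eq_extremum top.extremum_unique)
  then obtain x y where "a = ennreal x" "0 < x" "b = ennreal y" "0 < y"
    using False le by (metis ennreal_cases ennreal_0 ennreal_eq_0_iff less_irrefl linorder_not_less top.not_eq_extremum le_zero_eq)
  then show ?thesis using le by (simp add: inverse_ennreal)
qed

lemma critical_weight_ge:
  assumes "\<bar>g x\<bar> \<le> B" "\<And>i. i \<in> free_dirs W x \<Longrightarrow> \<bar>pd W i g x\<bar> \<le> B" "B > 0"
  shows "ennreal (inverse (B ^ k)) \<le> critical_weight W g k x"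
proof -
  let ?M = "Max (insert \<bar>g x\<bar> ((\<lambda>i. \<bar>pd W i g x\<bar>) ` free_dirs W x))"
  have "?M \<le> B" using assms by (subst Max_le_iff) auto
  then have "ennreal ?M ^ k \<le> ennreal B ^ k" by (intro power_mono ennreal_leI) auto
  then have "inverse (ennreal B ^ k) \<le> inverse (ennreal ?M ^ k)" by (rule ennreal_inverse_antimono)
  moreover have "inverse (ennreal B ^ k) = ennreal (inverse (B ^ k))"
    using assms(3) by (simp add: ennreal_power inverse_ennreal)
  ultimately show ?thesis unfolding critical_weight_def by simp
qed

text \<open>The weight is bounded below on a small cube in the interior of \<open>W\<close>, which has positive measure; with an
  infinite Lipschitz scale the full-dimensional term is therefore infinite.\<close>

lemma I_val_infinite_scale:
  fixes f :: "real ^ 'n \<Rightarrow> real"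
  assumes "polyrectangle W" "C11_on W f" "W \<noteq> {}" "lip_scale W (\<lambda>x. f x - l) = top"
    and nd: "\<not> (Lip W (\<lambda>x. f x - l) = 0 \<and> (\<forall>x\<in>W. f x - l = 0))"
  shows "I_val CARD('n) W (\<lambda>x. f x - l) = top"
proof -
  let ?n = "CARD('n)" and ?g = "\<lambda>x. f x - l"
  obtain p where "p \<in> interior W" using polyrectangle_interior_nonempty[OF assms(1,3)] by blast
  then obtain r where r: "r > 0" "cball p r \<subseteq> interior W"
    using open_contains_cball[of "interior W"] by auto
  then have rW: "cball p r \<subseteq> W" using interior_subset by blast
  have bd: "\<exists>B. \<forall>x\<in>cball p r. \<bar>u x\<bar> \<le> B" if "continuous_on W u" for u :: "real ^ 'n \<Rightarrow> real"
  proof -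
    have "compact (u ` cball p r)"
      by (intro compact_continuous_image continuous_on_subset[OF that rW]) auto
    then show ?thesis using compact_imp_bounded[of "u ` cball p r"] unfolding bounded_iff by auto
  qed
  obtain B0 where B0: "\<forall>x\<in>cball p r. \<bar>f x - l\<bar> \<le> B0"
    using bd[OF continuous_on_diff[OF C11_continuous(2)[OF assms(2)] continuous_on_const]] by blast
  have "\<forall>i. \<exists>B. \<forall>x\<in>cball p r. \<bar>pd W i f x\<bar> \<le> B"
    using bd C11_continuous(3)[OF assms(2)] by blast
  then obtain B1 where B1: "\<And>i x. x \<in> cball p r \<Longrightarrow> \<bar>pd W i f x\<bar> \<le> B1 i" by metis
  define B where "B = 1 + \<bar>B0\<bar> + (\<Sum>i\<in>UNIV. \<bar>B1 i\<bar>)"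
  have B1B: "B1 i \<le> B" for i
    unfolding B_def using member_le_sum[of i UNIV "\<lambda>i. \<bar>B1 i\<bar>"] by (auto simp: sum_nonneg)
  have B: "B > 0" "B0 \<le> B" unfolding B_def by (auto simp: sum_nonneg add_pos_nonneg intro: add_increasing2)
  define R where "R = r / real ?n"
  have R: "R > 0" unfolding R_def using r(1) by simp
  define E where "E = flat_slice UNIV p p R"
  have E: "E \<subseteq> cball p r"
  proof
    fix x assume "x \<in> E"
    then have "norm (x - p) \<le> real ?n * R"
      by (intro norm_le_card_cart) (auto simp: E_def flat_slice_def intro: less_imp_le)
    then show "x \<in> cball p r" by (simp add: R_def dist_norm norm_minus_commute)
  qed
  have Eb: "E \<subseteq> bdry ?n W"
    using E r(2) rW by (auto simp: bdry_def free_dirs_def)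
  have "0 < ennreal (inverse (B ^ ?n)) * ennreal (unit_ball_vol (real ?n) * R ^ ?n)"
    using B R by (simp add: ennreal_zero_less_mult_iff)
  also have "\<dots> \<le> ennreal (inverse (B ^ ?n)) * emeasure (hausdorff ?n) E"
    using hausdorff_flat_slice[of UNIV R p p] R borel_flat_slice[of UNIV p p R]
    by (intro mult_left_mono) (auto simp: E_def emeasure_hausdorff)
  also have "\<dots> = (\<integral>\<^sup>+x. ennreal (inverse (B ^ ?n)) * indicator E x \<partial>hausdorff ?n)"
    by (rule nn_integral_cmult_indicator[symmetric]) (simp add: E_def borel_flat_slice)
  also have "\<dots> \<le> (\<integral>\<^sup>+x\<in>bdry ?n W. critical_weight W ?g ?n x \<partial>hausdorff ?n)"
  proof (rule nn_integral_mono)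
    fix x
    show "ennreal (inverse (B ^ ?n)) * indicator E x \<le> critical_weight W ?g ?n x * indicator (bdry ?n W) x"
    proof (cases "x \<in> E")
      case True
      then have x: "x \<in> cball p r" using E by blast
      have "ennreal (inverse (B ^ ?n)) \<le> critical_weight W ?g ?n x"
      proof (rule critical_weight_ge[OF _ _ B(1)])
        show "\<bar>f x - l\<bar> \<le> B" using B0 x B(2) by fastforce
        show "\<bar>pd W i ?g x\<bar> \<le> B" for i using B1[OF x, of i] B1B[of i] by simp
      qed
      then show ?thesis using True Eb by (simp add: subset_iff)
    qed simp
  qed
  finally have "(\<integral>\<^sup>+x\<in>bdry ?n W. critical_weight W ?g ?n x \<partial>hausdorff ?n) \<noteq> 0" by simp
  then show ?thesis
    by (simp add: I_val_eq[OF _ nd] assms(4) ennreal_top_mult power_eq_top_ennreal)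
qed

lemma bounded_components_bound:
  fixes f :: "real ^ 'n \<Rightarrow> real"
  assumes "polyrectangle W" "C11_on W f" "regular_within W f l" "excursion W f l F"
  shows "ncard (bounded_components F) \<le>
    (\<Sum>k=0..CARD('n). ennreal (2 ^ k * inverse (unit_ball_vol (real k))) * I_val k W (\<lambda>x. f x - l))"
proof (rule ncard_le_of_finite_subsets)
  let ?n = "CARD('n)" and ?g = "\<lambda>x. f x - l"
  define \<gamma> where "\<gamma> k = ennreal (2 ^ k * inverse (unit_ball_vol (real k)))" for k
  fix \<C> assume fam: "finite \<C>" "\<C> \<subseteq> bounded_components F"
  then have pc: "\<C> \<subseteq> path_components_of (top_of_set F)" by (auto simp: bounded_components_def)
  have "of_nat (card \<C>) \<le> (\<Sum>k=0..?n. \<gamma> k * I_val k W ?g)"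
  proof (cases "\<C> = {}")
    case False
    then obtain C0 where C0: "C0 \<in> path_components_of (top_of_set F)" using pc by blast
    obtain x0 where x0: "x0 \<in> C0" "f x0 > l" by (rule component_meets_positive[OF assms C0])
    have CW: "C \<subseteq> W" if "C \<in> path_components_of (top_of_set F)" for C
      using path_components_of_subset[OF that] assms(4) by (auto simp: excursion_def)
    have W: "W \<noteq> {}" and nd: "\<not> (Lip W ?g = 0 \<and> (\<forall>x\<in>W. ?g x = 0))"
      using CW[OF C0] x0 by (blast, force)
    show ?thesis
    proof (cases "lip_scale W ?g = top")
      case True
      have "2 ^ ?n * inverse (unit_ball_vol (real ?n)) > 0" by simp
      then have "\<gamma> ?n \<noteq> 0" unfolding \<gamma>_def by (metis ennreal_eq_0_iff not_le)
      then have "top = \<gamma> ?n * I_val ?n W ?g"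
        unfolding I_val_infinite_scale[OF assms(1,2) W True nd] by (simp add: ennreal_mult_top)
      also have "\<dots> \<le> (\<Sum>k=0..?n. \<gamma> k * I_val k W ?g)" by (rule member_le_sum) auto
      finally have "(\<Sum>k=0..?n. \<gamma> k * I_val k W ?g) = top" by (rule top.extremum_uniqueI)
      then show ?thesis by (simp only: top_greatest)
    next
      case False
      then obtain L where L: "lip_scale W ?g = ennreal L" "L \<ge> 0" by (metis ennreal_cases)
      have lipf: "\<bar>f x - f y\<bar> \<le> L * dist x y" if "x \<in> W" "y \<in> W" for x y
        using lipschitz_of_Lip_le[OF _ L(2) that, of ?g] Lip_le_lip_scale(1)[of W ?g] L(1) by simp
      have lippd: "\<bar>pd W i f x - pd W i f y\<bar> \<le> L * dist x y" if "x \<in> W" "y \<in> W" for i x y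
        using lipschitz_of_Lip_le[OF _ L(2) that, of "pd W i f"] Lip_le_lip_scale(2)[of W i ?g] L(1) by simp
      define \<C>0 where "\<C>0 = {C \<in> \<C>. C \<inter> corners W \<noteq> {}}"
      define \<C>1 where "\<C>1 = \<C> - \<C>0"
      have fin: "finite \<C>0" "finite \<C>1" using fam(1) by (auto simp: \<C>0_def \<C>1_def)
      define m where "m I C = (\<integral>\<^sup>+x\<in>tame_part W f l C I. inverse (ennreal (f x - l) ^ card I) \<partial>hausdorff (card I))" for I C
      have "of_nat (card \<C>0) \<le> ncard (corners W)"
      proof -
        have "\<forall>C\<in>\<C>0. \<exists>c. c \<in> C \<inter> corners W" by (auto simp: \<C>0_def)
        then obtain c where c: "\<And>C. C \<in> \<C>0 \<Longrightarrow> c C \<in> C \<inter> corners W" by metis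
        have "inj_on c \<C>0"
        proof (rule inj_onI)
          fix C D assume CD: "C \<in> \<C>0" "D \<in> \<C>0" "c C = c D"
          then have "\<not> disjnt C D" using c[of C] c[of D] by (auto simp: disjnt_def)
          then show "C = D"
            using pairwise_disjoint_path_components_of[of "top_of_set F"] CD pc
            by (auto simp: pairwise_def \<C>0_def)
        qed
        then show ?thesis using c fin(1) by (intro card_le_ncard[of _ c]) auto
      qed
      also have "\<dots> = \<gamma> 0 * I_val 0 W ?g" by (simp add: I_val_def \<gamma>_def)
      finally have zero: "of_nat (card \<C>0) \<le> \<gamma> 0 * I_val 0 W ?g" .
      have "of_nat (card \<C>1) = (\<Sum>C\<in>\<C>1. 1 :: ennreal)" by simp
      also have "\<dots> \<le> (\<Sum>C\<in>\<C>1. \<Sum>I\<in>- {{}}. \<gamma> (card I) * (ennreal L ^ card I * m I C))"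
        unfolding \<gamma>_def m_def
      proof (rule sum_mono)
        fix C assume C: "C \<in> \<C>1"
        show "1 \<le> (\<Sum>I\<in>- {{}}. ennreal (2 ^ card I * inverse (unit_ball_vol (real (card I)))) *
          (ennreal L ^ card I * (\<integral>\<^sup>+x\<in>tame_part W f l C I. inverse (ennreal (f x - l) ^ card I) \<partial>hausdorff (card I))))"
          by (rule one_le_component_mass[OF assms _ _ _ L(2) lipf lippd])
            (use C fam in \<open>auto simp: \<C>1_def \<C>0_def bounded_components_def\<close>)
      qed
      also have "\<dots> = (\<Sum>I\<in>- {{}}. \<gamma> (card I) * (ennreal L ^ card I * (\<Sum>C\<in>\<C>1. m I C)))"
        by (subst sum.swap) (simp add: sum_distrib_left)
      also have "\<dots> = (\<Sum>k=1..?n. \<Sum>I | I \<in> - {{}} \<and> card I = k. \<gamma> (card I) * (ennreal L ^ card I * (\<Sum>C\<in>\<C>1. m I C)))"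
        by (rule sum.group[symmetric]) (use card_mono[of "UNIV :: 'n set"] in \<open>auto simp: card_gt_0_iff Suc_le_eq\<close>)
      also have "\<dots> \<le> (\<Sum>k=1..?n. \<gamma> k * I_val k W ?g)"
      proof (rule sum_mono)
        fix k assume k: "k \<in> {1..?n}"
        have "{I. I \<in> - {{}} \<and> card I = k} = {I :: 'n set. card I = k}" using k by auto
        then have "(\<Sum>I | I \<in> - {{}} \<and> card I = k. \<gamma> (card I) * (ennreal L ^ card I * (\<Sum>C\<in>\<C>1. m I C)))
           = (\<Sum>I | card I = k. \<gamma> k * (ennreal L ^ k * (\<Sum>C\<in>\<C>1. m I C)))" by simp
        also have "\<dots> = \<gamma> k * (ennreal L ^ k * (\<Sum>I | card I = k. \<Sum>C\<in>\<C>1. m I C))"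
          by (simp add: sum_distrib_left)
        also have "(\<Sum>I | card I = k. \<Sum>C\<in>\<C>1. m I C) =
           (\<Sum>I | card I = k. \<Sum>C\<in>\<C>1. \<integral>\<^sup>+x\<in>tame_part W f l C I. inverse (ennreal (f x - l) ^ k) \<partial>hausdorff k)"
          by (intro sum.cong refl) (simp add: m_def)
        also have "\<dots> \<le> (\<integral>\<^sup>+x\<in>bdry k W. critical_weight W ?g k x \<partial>hausdorff k)"
          by (rule sum_tame_parts_le[OF assms(1,2,4) fin(2)]) (use pc in \<open>auto simp: \<C>1_def\<close>)
        finally show "(\<Sum>I | I \<in> - {{}} \<and> card I = k. \<gamma> (card I) * (ennreal L ^ card I * (\<Sum>C\<in>\<C>1. m I C))) \<le> \<gamma> k * I_val k W ?g"
          using k by (simp add: I_val_eq[OF _ nd] L(1) mult_left_mono)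
      qed
      finally have "of_nat (card \<C>1) \<le> (\<Sum>k=1..?n. \<gamma> k * I_val k W ?g)" .
      with zero have "of_nat (card \<C>0) + of_nat (card \<C>1) \<le> \<gamma> 0 * I_val 0 W ?g + (\<Sum>k=1..?n. \<gamma> k * I_val k W ?g)"
        by (rule add_mono)
      moreover have "card \<C> = card \<C>0 + card \<C>1"
        using fam(1) card_mono[OF fam(1), of \<C>0] by (simp add: \<C>1_def card_Diff_subset \<C>0_def)
      ultimately show ?thesis by (simp add: sum.atLeast_Suc_atMost[of 0 ?n])
    qed
  qed simp
  then show "of_nat (card \<C>) \<le> (\<Sum>k=0..?n. ennreal (2 ^ k * inverse (unit_ball_vol (real k))) * I_val k W ?g)"
    by (simp add: \<gamma>_def)
qed

section \<open>Planar polyrectangles near points without corners\<close>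

text \<open>Here \<open>\<sigma>\<close> is a sign, 1 or -1.\<close>

definition blocked :: "(real ^ 'n) set \<Rightarrow> 'n \<Rightarrow> real \<Rightarrow> real ^ 'n \<Rightarrow> bool" where
  "blocked W i \<sigma> y \<longleftrightarrow> (\<exists>r>0. \<forall>s. 0 < s \<and> s < r \<longrightarrow> y + (\<sigma> * s) *\<^sub>R axis i 1 \<notin> W)"

lemma blocked_not_free:
  assumes "polyrectangle W" "blocked W i \<sigma> y" "\<bar>\<sigma>\<bar> = 1"
  shows "i \<notin> free_dirs W y"
proof
  assume "i \<in> free_dirs W y"
  then obtain r where r: "r > 0" "\<And>t. \<bar>t\<bar> < r \<Longrightarrow> y + t *\<^sub>R axis i 1 \<in> W"
    using free_dirs_two_sided[OF assms(1)] by blast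
  obtain r' where r': "r' > 0" "\<And>s. 0 < s \<Longrightarrow> s < r' \<Longrightarrow> y + (\<sigma> * s) *\<^sub>R axis i 1 \<notin> W"
    using assms(2) unfolding blocked_def by blast
  define s where "s = min r r' / 2"
  have "0 < s" "s < r" "s < r'" using r(1) r'(1) by (auto simp: s_def)
  then show False using r(2)[of "\<sigma> * s"] r'(2)[of s] assms(3) by (simp add: abs_mult)
qed

lemma sign_stable_drop:
  assumes "closed W" "sign_stable W y r" "y + v \<in> W" "\<And>c. \<bar>v $ c\<bar> < r"
    and v': "\<And>c. v' $ c = v $ c \<or> v' $ c = 0"
  shows "y + v' \<in> W"
proof -
  define w where "w n = v' + (1 / real (Suc n)) *\<^sub>R (v - v')" for n
  have mem: "y + w n \<in> W" for n
  proof -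
    have "\<bar>w n $ c\<bar> < r \<and> sgn (v $ c) = sgn (w n $ c)" for c
    proof (cases "v' $ c = v $ c")
      case True
      then show ?thesis using assms(4)[of c] by (simp add: w_def)
    next
      case False
      then have w: "w n $ c = v $ c / real (Suc n)" using v'[of c] by (simp add: w_def)
      have "\<bar>v $ c\<bar> / real (Suc n) \<le> \<bar>v $ c\<bar> / 1" by (intro divide_left_mono) auto
      then show ?thesis unfolding w using assms(4)[of c] by (auto simp: sgn_divide)
    qed
    then have "(y + v \<in> W) = (y + w n \<in> W)"
      using assms(2,4) unfolding sign_stable_def by blast
    then show ?thesis using assms(3) by blast
  qed
  have "w \<longlonglongrightarrow> v' + 0 *\<^sub>R (v - v')"
    unfolding w_def by (intro tendsto_intros LIMSEQ_Suc lim_1_over_n)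
  then have lim: "(\<lambda>n. y + w n) \<longlonglongrightarrow> y + v'" by (auto intro!: tendsto_intros)
  show ?thesis by (rule closed_sequentially[OF assms(1) mem lim])
qed

text \<open>An interval with interior points that cannot be continued on one side of \<open>a\<close> continues on the other.\<close>

lemma one_sided_endpoint:
  fixes S :: "real set"
  assumes "is_interval S" "interior S \<noteq> {}" "a \<in> S" "e > 0" "\<bar>\<sigma>\<bar> = 1"
    and stable: "\<And>v v'. \<bar>v\<bar> < 2 * e \<Longrightarrow> \<bar>v'\<bar> < 2 * e \<Longrightarrow> sgn v = sgn v' \<Longrightarrow> (a + v \<in> S \<longleftrightarrow> a + v' \<in> S)"
    and out: "a + \<sigma> * e \<notin> S"
  shows "a - \<sigma> * e \<in> S" "a \<in> frontier S"
proof -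
  have \<sigma>: "\<sigma> = 1 \<or> \<sigma> = -1" using assms(5) by linarith
  have conv: "x \<in> S" if "b \<in> S" "c \<in> S" "b \<le> x" "x \<le> c" for b c x
    using assms(1) that unfolding is_interval_1 by blast
  have outside: "a + \<sigma> * d \<notin> S" if "0 < d" "d < 2 * e" for d
    using out stable[of "\<sigma> * d" "\<sigma> * e"] that \<sigma> assms(4) by (auto simp: sgn_mult)
  obtain b where b: "b \<in> S" "b \<noteq> a"
  proof -
    have "S \<noteq> {a}" using assms(2) by auto
    then show ?thesis using assms(3) that by blast
  qed
  show "a - \<sigma> * e \<in> S"
  proof -
    \<comment> \<open>Moving from \<open>a\<close> towards \<open>b\<close> by \<open>d\<close> stays in the interval and within the stability radius.\<close>
    define d where "d = min e \<bar>b - a\<bar>"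
    have d: "0 < d" "d \<le> e" "d \<le> \<bar>b - a\<bar>" using b(2) assms(4) by (auto simp: d_def)
    have "a + \<sigma> * d \<in> S \<or> a - \<sigma> * d \<in> S"
      using \<sigma> d conv[OF assms(3) b(1), of "a + d"] conv[OF b(1) assms(3), of "a - d"] b(2)
      by (cases "b > a") auto
    then have "a - \<sigma> * d \<in> S" using outside[of d] d assms(4) by auto
    then show ?thesis using stable[of "- \<sigma> * d" "- \<sigma> * e"] d assms(4) \<sigma> by (auto simp: sgn_mult)
  qed
  have "a \<notin> interior S"
  proof
    assume "a \<in> interior S"
    then obtain r where r: "r > 0" "ball a r \<subseteq> S" by (meson interior_subset open_contains_ball open_interior subset_trans)
    define d where "d = min r e / 2"
    have d: "0 < d" "d < r" "d < 2 * e" using r(1) assms(4) by (auto simp: d_def)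
    then have "a + \<sigma> * d \<in> ball a r" using \<sigma> by (auto simp: dist_real_def)
    then show False using r(2) outside[OF d(1,3)] by blast
  qed
  then show "a \<in> frontier S" using assms(3) closure_subset by (auto simp: frontier_def)
qed

text \<open>Suppose that two adjacent axis directions at \<open>y\<close> lead into \<open>W\<close> but the quadrant between them does
  not. One rectangle contains the first direction, and hence the quadrant on its other side; likewise for the
  second direction. If the remaining fourth quadrant belongs to \<open>W\<close>, then \<open>y\<close> is a reentrant corner. Otherwise both
  rectangles have a corner at \<open>y\<close>, and they are distinct, contrary to the definition of a polyrectangle.\<close>

lemma corner_of_missing_quadrant:
  fixes W :: "(real ^ 'n) set"
  assumes W: "polyrectangle W" and ij: "UNIV = {i, j}" "i \<noteq> j" and "y \<in> W"
    and \<sigma>: "\<bar>\<sigma>\<bar> = 1" and \<tau>: "\<bar>\<tau>\<bar> = 1" and r0: "r0 > 0"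
    and up: "\<And>t. 0 < t \<Longrightarrow> t < r0 \<Longrightarrow> y + (\<tau> * t) *\<^sub>R axis j 1 \<in> W"
    and right: "\<And>s. 0 < s \<Longrightarrow> s < r0 \<Longrightarrow> y + (\<sigma> * s) *\<^sub>R axis i 1 \<in> W"
    and missing: "\<And>s t. 0 < s \<Longrightarrow> s < r0 \<Longrightarrow> 0 < t \<Longrightarrow> t < r0 \<Longrightarrow>
      y + (\<sigma> * s) *\<^sub>R axis i 1 + (\<tau> * t) *\<^sub>R axis j 1 \<notin> W"
  shows "y \<in> corners W"
proof -
  from W obtain m and I :: "nat \<Rightarrow> 'n \<Rightarrow> real set" where I: "\<And>k. k < m \<Longrightarrow> rect_sides (I k)"
    "W = (\<Union>k<m. rectangle (I k))"
    "\<And>k k'. k < m \<Longrightarrow> k' < m \<Longrightarrow> k \<noteq> k' \<Longrightarrow> rect_corners (I k) \<inter> rect_corners (I k') = {}"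
    unfolding polyrectangle_def by blast
  obtain r1 where r1: "r1 > 0" "\<And>k c v v'. k < m \<Longrightarrow> \<bar>v\<bar> < r1 \<Longrightarrow> \<bar>v'\<bar> < r1 \<Longrightarrow> sgn v = sgn v' \<Longrightarrow>
      (y $ c + v \<in> I k c \<longleftrightarrow> y $ c + v' \<in> I k c)"
    using sides_sign_stable[of m I y, OF I(1)] by blast
  define e where "e = min r0 r1 / 2"
  have e: "e > 0" "e < r0" "2 * e \<le> r1" "2 * e \<le> r0" using r0 r1(1) by (auto simp: e_def)
  have stable: "y $ c + v \<in> I k c \<longleftrightarrow> y $ c + v' \<in> I k c"
    if "k < m" "\<bar>v\<bar> < 2 * e" "\<bar>v'\<bar> < 2 * e" "sgn v = sgn v'" for k c v v'
    using r1(2)[of k v v' c] that e(3) by linarith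
  have side: "is_interval (I k c)" "closed (I k c)" "interior (I k c) \<noteq> {}" if "k < m" for k c
    using I(1)[OF that] by (auto simp: rect_sides_def)
  have two: "(\<forall>c. P c) \<longleftrightarrow> P i \<and> P j" for P using ij(1) by (metis UNIV_I insertE singletonD)
  have mem: "y + v \<in> W \<longleftrightarrow> (\<exists>k<m. y $ i + v $ i \<in> I k i \<and> y $ j + v $ j \<in> I k j)" for v
    unfolding I(2) rectangle_def two by auto
  have near: "y $ c \<in> I k c" if "k < m" "y $ c + s * e \<in> I k c" "\<bar>s\<bar> = 1" for k c s
  proof (rule closed_sequentially[OF side(2)[OF that(1)]])
    fix n :: nat
    have "0 < e / real (Suc n)" "e / real (Suc n) < 2 * e" using e(1) by (auto simp: divide_less_eq)
    then show "y $ c + s * (e / real (Suc n)) \<in> I k c"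
      using stable[OF that(1), of "s * e" "s * (e / real (Suc n))" c] that(2,3) e(1)
      by (simp add: abs_mult sgn_mult)
  next
    have "(\<lambda>n. y $ c + (s * e) * (1 / real (Suc n))) \<longlonglongrightarrow> y $ c + (s * e) * 0"
      by (intro tendsto_intros LIMSEQ_Suc lim_1_over_n)
    then show "(\<lambda>n. y $ c + s * (e / real (Suc n))) \<longlonglongrightarrow> y $ c" by simp
  qed
  have ax: "axis i (1::real) $ j = 0" "axis j (1::real) $ i = 0" using ij(2) by (auto simp: axis_def)
  obtain a where a: "a < m" "y $ i \<in> I a i" "y $ j + \<tau> * e \<in> I a j"
    using up[of e] e ax unfolding mem by auto
  obtain b where b: "b < m" "y $ i + \<sigma> * e \<in> I b i" "y $ j \<in> I b j"
    using right[of e] e ax unfolding mem by auto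
  have miss: "\<not> (y $ i + \<sigma> * e \<in> I k i \<and> y $ j + \<tau> * e \<in> I k j)" if "k < m" for k
    using missing[of e e] e that unfolding add.assoc mem by (auto simp: ax)
  have a': "y $ j \<in> I a j" using near[OF a(1,3) \<tau>] .
  have b': "y $ i \<in> I b i" using near[OF b(1,2) \<sigma>] .
  have aout: "y $ i + \<sigma> * e \<notin> I a i" using miss[OF a(1)] a(3) by blast
  have bout: "y $ j + \<tau> * e \<notin> I b j" using miss[OF b(1)] b(2) by blast
  have ai: "y $ i - \<sigma> * e \<in> I a i" "y $ i \<in> frontier (I a i)"
    using one_sided_endpoint[OF side(1,3)[OF a(1)] a(2) e(1) \<sigma> _ aout] stable[OF a(1)] by blast+
  have bj: "y $ j - \<tau> * e \<in> I b j" "y $ j \<in> frontier (I b j)"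
    using one_sided_endpoint[OF side(1,3)[OF b(1)] b(3) e(1) \<tau> _ bout] stable[OF b(1)] by blast+
  show ?thesis
  proof (cases "\<exists>k<m. y $ i - \<sigma> * e \<in> I k i \<and> y $ j - \<tau> * e \<in> I k j")
    case False
    have "y $ j - \<tau> * e \<notin> I a j" using False a(1) ai(1) by blast
    then have "y $ j + (- \<tau>) * e \<notin> I a j" by simp
    then have "y $ j \<in> frontier (I a j)"
      by (intro one_sided_endpoint(2)[OF side(1,3)[OF a(1)] a' e(1), where \<sigma> = "- \<tau>"] stable[OF a(1)])
        (simp_all add: \<tau>)
    then have ca: "y \<in> rect_corners (I a)" using ai(2) by (simp add: rect_corners_def two)
    have "y $ i + (- \<sigma>) * e \<notin> I b i" using False b(1) bj(1) by auto
    then have "y $ i \<in> frontier (I b i)"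
      by (intro one_sided_endpoint(2)[OF side(1,3)[OF b(1)] b' e(1), where \<sigma> = "- \<sigma>"] stable[OF b(1)])
        (simp_all add: \<sigma>)
    then have cb: "y \<in> rect_corners (I b)" using bj(2) by (simp add: rect_corners_def two)
    have "a \<noteq> b" using a(3) bout by blast
    then show ?thesis using I(3)[OF a(1) b(1)] ca cb by blast
  next
    case True
    then obtain k where k: "k < m" "y $ i - \<sigma> * e \<in> I k i" "y $ j - \<tau> * e \<in> I k j" by blast
    have three: "v = 0 \<or> sgn v = s \<or> sgn v = - s" if "\<bar>s\<bar> = 1" for v s :: real
      using that by (auto simp: sgn_if abs_if split: if_splits)
    have cell: "y $ c + v \<in> I k' c"
      if "k' < m" "\<bar>v\<bar> < 2 * e" "sgn v = s" "\<bar>s\<bar> = 1" "y $ c + s * e \<in> I k' c" for k' c v s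
      using stable[OF that(1), of v "s * e" c] that e(1)
      by (simp add: abs_mult sgn_mult) (auto simp: abs_if split: if_splits)
    have ak: "y $ i + (- \<sigma>) * e \<in> I a i" "y $ i + (- \<sigma>) * e \<in> I k i"
      and bk: "y $ j + (- \<tau>) * e \<in> I b j" "y $ j + (- \<tau>) * e \<in> I k j"
      using ai(1) bj(1) k by simp_all
    have neg: "\<bar>- \<sigma>\<bar> = 1" "\<bar>- \<tau>\<bar> = 1" using \<sigma> \<tau> by auto
    have L: "y + v \<in> W" if v: "\<bar>v $ i\<bar> < 2 * e" "\<bar>v $ j\<bar> < 2 * e" "sgn (v $ i) = - \<sigma>" for v
    proof -
      note i = cell[OF _ v(1,3) neg(1)]
      consider "v $ j = 0" | "sgn (v $ j) = \<tau>" | "sgn (v $ j) = - \<tau>" using three[OF \<tau>] by blast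
      then show ?thesis
      proof cases
        case 1 then show ?thesis unfolding mem using i[OF a(1) ak(1)] a a' by auto
      next
        case 2 then show ?thesis unfolding mem using i[OF a(1) ak(1)] cell[OF a(1) v(2) 2 \<tau> a(3)] a(1) by blast
      next
        case 3 then show ?thesis unfolding mem using i[OF k(1) ak(2)] cell[OF k(1) v(2) 3 neg(2) bk(2)] k(1) by blast
      qed
    qed
    have D: "y + v \<in> W" if v: "\<bar>v $ i\<bar> < 2 * e" "\<bar>v $ j\<bar> < 2 * e" "sgn (v $ j) = - \<tau>" for v
    proof -
      note j = cell[OF b(1) v(2,3) neg(2) bk(1)]
      consider "v $ i = 0" | "sgn (v $ i) = \<sigma>" | "sgn (v $ i) = - \<sigma>" using three[OF \<sigma>] by blast
      then show ?thesis
      proof cases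
        case 1 then show ?thesis unfolding mem using j b b' by auto
      next
        case 2 then show ?thesis unfolding mem using j cell[OF b(1) v(1) 2 \<sigma> b(2)] b(1) by blast
      next
        case 3 then show ?thesis using L v by blast
      qed
    qed
    have not_int: "y \<notin> interior W"
    proof
      assume "y \<in> interior W"
      then obtain r where r: "r > 0" "ball y r \<subseteq> W" by (meson interior_subset open_contains_ball open_interior subset_trans)
      define d where "d = min r e / 3"
      have d: "0 < d" "2 * d < r" "d < r0" using r(1) e by (auto simp: d_def)
      let ?v = "(\<sigma> * d) *\<^sub>R axis i 1 + (\<tau> * d) *\<^sub>R axis j (1::real)"
      have "norm ?v \<le> norm ((\<sigma> * d) *\<^sub>R axis i (1::real)) + norm ((\<tau> * d) *\<^sub>R axis j (1::real))" by (rule norm_triangle_ineq)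
      also have "\<dots> = 2 * d" using d(1) \<sigma> \<tau> by (simp add: abs_mult)
      finally have "norm ?v < r" using d(2) by linarith
      then have "y + ?v \<in> ball y r" unfolding mem_ball dist_norm by (metis diff_add_cancel add_diff_cancel_left' minus_diff_eq norm_minus_cancel)
      then show False using r(2) missing[OF d(1,3) d(1,3)] by (metis add.assoc subsetD)
    qed
    have int: "y + v \<in> interior W" if "\<bar>v $ i\<bar> < e" "\<bar>v $ j\<bar> < e" "sgn (v $ i) = - \<sigma> \<or> sgn (v $ j) = - \<tau>" for v
    proof -
      define c where "c = (if sgn (v $ i) = - \<sigma> then i else j)"
      have vc: "v $ c \<noteq> 0" using that(3) \<sigma> \<tau> by (auto simp: c_def)
      define d where "d = min e \<bar>v $ c\<bar>"
      have d: "d > 0" "d \<le> e" "d \<le> \<bar>v $ c\<bar>" using e(1) vc by (auto simp: d_def)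
      have "ball (y + v) d \<subseteq> W"
      proof
        fix z assume z: "z \<in> ball (y + v) d"
        define w where "w = z - y"
        have "\<bar>w $ c' - v $ c'\<bar> < d" for c'
          using component_le_norm_cart[of "w - v" c'] z by (simp add: w_def dist_norm norm_minus_commute algebra_simps)
        then have w: "\<bar>w $ i - v $ i\<bar> < d" "\<bar>w $ j - v $ j\<bar> < d" "\<bar>w $ c - v $ c\<bar> < \<bar>v $ c\<bar>"
          using d(3) by (blast, blast, metis order_less_le_trans)
        have wb: "\<bar>w $ i\<bar> < 2 * e" "\<bar>w $ j\<bar> < 2 * e" using w that(1,2) d(2) by linarith+
        have "sgn (w $ c) = sgn (v $ c)" using w(3) by (auto simp: sgn_if abs_if split: if_splits)
        then have "y + w \<in> W" using L[OF wb] D[OF wb] that(3) by (auto simp: c_def split: if_splits)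
        then show "z \<in> W" by (simp add: w_def)
      qed
      then show ?thesis using d(1) by (meson centre_in_ball interior_maximal open_ball subsetD)
    qed
    have no: "c \<notin> free_dirs W y" if c: "c = i \<and> \<rho> = \<sigma> \<or> c = j \<and> \<rho> = \<tau>" for c \<rho>
    proof
      have \<rho>: "\<bar>\<rho>\<bar> = 1" using c \<sigma> \<tau> by auto
      assume "c \<in> free_dirs W y"
      then obtain d where d: "0 < d" "d < e" "y + d *\<^sub>R axis c 1 \<in> frontier W" "y - d *\<^sub>R axis c 1 \<in> frontier W"
        using not_int e(1) unfolding free_dirs_def by auto
      have "y + (- \<rho> * d) *\<^sub>R axis c 1 \<in> frontier W" using d(3,4) \<rho> by (auto simp: abs_if split: if_splits)
      moreover have "y + (- \<rho> * d) *\<^sub>R axis c 1 \<in> interior W"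
        using d(1,2) \<rho> c ax e(1) by (intro int) (auto simp: abs_mult sgn_mult, auto simp: sgn_if abs_if split: if_splits)
      ultimately show False by (simp add: frontier_def)
    qed
    have "free_dirs W y = {}" using no[of i \<sigma>] no[of j \<tau>] ij(1) by (metis UNIV_I all_not_in_conv insertE singletonD)
    then show ?thesis using \<open>y \<in> W\<close> by (simp add: corners_def bdry_def)
  qed
qed

lemma blocked_iff_near:
  assumes "sign_stable W y r" "\<bar>\<sigma>\<bar> = 1" "0 < s" "s < r"
  shows "blocked W i \<sigma> y \<longleftrightarrow> y + (\<sigma> * s) *\<^sub>R axis i 1 \<notin> W"
proof -
  have r: "r > 0" using assms(1) by (simp add: sign_stable_def)
  have same: "y + (\<sigma> * s') *\<^sub>R axis i 1 \<in> W \<longleftrightarrow> y + (\<sigma> * s) *\<^sub>R axis i 1 \<in> W" if "0 < s'" "s' < r" for s'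
  proof -
    have "\<bar>((\<sigma> * s') *\<^sub>R axis i (1::real)) $ c\<bar> < r \<and> \<bar>((\<sigma> * s) *\<^sub>R axis i (1::real)) $ c\<bar> < r \<and>
      sgn (((\<sigma> * s') *\<^sub>R axis i (1::real)) $ c) = sgn (((\<sigma> * s) *\<^sub>R axis i (1::real)) $ c)" for c
      using that assms(2-4) r by (simp add: axis_def abs_mult sgn_mult)
    then show ?thesis using assms(1) unfolding sign_stable_def by blast
  qed
  show ?thesis
  proof
    assume "blocked W i \<sigma> y"
    then obtain r' where r': "r' > 0" "\<And>s. 0 < s \<Longrightarrow> s < r' \<Longrightarrow> y + (\<sigma> * s) *\<^sub>R axis i 1 \<notin> W"
      unfolding blocked_def by blast
    have "0 < min r r' / 2" "min r r' / 2 < r" "min r r' / 2 < r'" using r r'(1) by auto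
    then show "y + (\<sigma> * s) *\<^sub>R axis i 1 \<notin> W" using same r'(2) by blast
  next
    assume "y + (\<sigma> * s) *\<^sub>R axis i 1 \<notin> W"
    then show "blocked W i \<sigma> y" unfolding blocked_def using same r by blast
  qed
qed

text \<open>The last point before a coordinate line first leaves \<open>W\<close>.\<close>

lemma line_exit_blocked:
  assumes W: "polyrectangle W" and "p \<in> W" "p + t0 *\<^sub>R axis c 1 \<notin> W"
  obtains t \<sigma> where "\<bar>t\<bar> < \<bar>t0\<bar>" "p + t *\<^sub>R axis c 1 \<in> W" "\<bar>\<sigma>\<bar> = 1" "blocked W c \<sigma> (p + t *\<^sub>R axis c 1)"
proof -
  have cl: "closed W" by (rule polyrectangle_closed[OF W])
  define \<sigma> where "\<sigma> = sgn t0"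
  have "t0 \<noteq> 0" using assms(2,3) by auto
  then have \<sigma>: "\<bar>\<sigma>\<bar> = 1" "\<sigma> * \<bar>t0\<bar> = t0" by (auto simp: \<sigma>_def abs_sgn_eq sgn_mult_abs)
  let ?q = "\<lambda>t. p + (\<sigma> * t) *\<^sub>R axis c (1::real)"
  define S where "S = {t. 0 \<le> t \<and> t \<le> \<bar>t0\<bar> \<and> ?q t \<notin> W}"
  have S: "\<bar>t0\<bar> \<in> S" "bdd_below S" using assms(3) \<sigma>(2) by (auto simp: S_def intro!: bdd_belowI[of _ 0])
  define T where "T = Inf S"
  have T: "0 \<le> T" "T \<le> \<bar>t0\<bar>"
    unfolding T_def using S by (auto intro!: cInf_greatest cInf_lower simp: S_def)
  have before: "?q t \<in> W" if "0 \<le> t" "t < T" for t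
  proof (rule ccontr)
    assume "?q t \<notin> W"
    then have "t \<in> S" using that T by (simp add: S_def)
    then show False using cInf_lower[OF _ S(2)] that(2) unfolding T_def by fastforce
  qed
  have inW: "?q T \<in> W"
  proof (cases "T = 0")
    case False
    define u where "u n = T * (1 - 1 / real (Suc n))" for n
    have "?q (u n) \<in> W" for n
    proof (rule before)
      have "0 \<le> 1 - 1 / real (Suc n)" "1 - 1 / real (Suc n) < 1" by (simp_all add: field_simps)
      then show "0 \<le> u n" "u n < T" using T(1) False unfolding u_def
        by (auto intro: mult_nonneg_nonneg simp: mult_less_cancel_left2)
    qed
    moreover have "(\<lambda>n. ?q (u n)) \<longlonglongrightarrow> ?q (T * (1 - 0))"
      unfolding u_def by (intro tendsto_intros LIMSEQ_Suc lim_1_over_n)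
    ultimately have "?q (T * (1 - 0)) \<in> W" by (rule closed_sequentially[OF cl])
    then show ?thesis by simp
  qed (use assms(2) in simp)
  then have "T \<noteq> \<bar>t0\<bar>" using assms(3) \<sigma>(2) by auto
  then have T': "T < \<bar>t0\<bar>" using T(2) by simp
  obtain r where r: "sign_stable W (?q T) r" using polyrectangle_sign_stable[OF W] by blast
  then have "r > 0" by (simp add: sign_stable_def)
  then obtain t where t: "t \<in> S" "t < T + r"
    using cInf_lessD[of S "T + r"] S(1) unfolding T_def by auto
  have "T \<le> t" unfolding T_def by (rule cInf_lower[OF t(1) S(2)])
  moreover have "t \<noteq> T" using t(1) inW by (auto simp: S_def)
  ultimately have "0 < t - T" "t - T < r" using t(2) by auto
  moreover have eq: "?q T + (\<sigma> * (t - T)) *\<^sub>R axis c 1 = ?q t" by (simp add: algebra_simps flip: scaleR_add_left)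
  have "?q T + (\<sigma> * (t - T)) *\<^sub>R axis c 1 \<notin> W" unfolding eq using t(1) by (simp add: S_def)
  ultimately have "blocked W c \<sigma> (?q T)"
    using blocked_iff_near[OF r \<sigma>(1), of "t - T" c] by blast
  moreover have "\<bar>\<sigma> * T\<bar> < \<bar>t0\<bar>" using T T' \<sigma>(1) by (simp add: abs_mult)
  ultimately show ?thesis using that[of "\<sigma> * T" \<sigma>] inW \<sigma>(1) by blast
qed

lemma blocked_twice_corner:
  assumes "polyrectangle W" "UNIV = {i, j}" "y \<in> W" "\<bar>\<sigma>\<bar> = 1" "\<bar>\<tau>\<bar> = 1" "blocked W i \<sigma> y" "blocked W j \<tau> y"
  shows "y \<in> corners W"
proof -
  have "i \<notin> free_dirs W y" "j \<notin> free_dirs W y"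
    using blocked_not_free assms by blast+
  then have "free_dirs W y = {}" using assms(2) by (metis UNIV_I all_not_in_conv insertE singletonD)
  then show ?thesis using assms(3) by (simp add: corners_def bdry_def)
qed

text \<open>A straight edge of a planar polyrectangle continues until it meets a corner: along the line,
  the property of being a point of \<open>W\<close> blocked in direction \<open>i\<close> is locally constant away from
  corners. At a blocked point direction \<open>j\<close> must be free; and the property cannot start at a point that is not
  blocked, since a quadrant would be missing there.\<close>

lemma chord_blocked:
  fixes W :: "(real ^ 'n) set"
  assumes W: "polyrectangle W" and ij: "UNIV = {i, j}" "i \<noteq> j" and \<sigma>: "\<bar>\<sigma>\<bar> = 1"
    and x: "x \<in> W" "blocked W i \<sigma> x" and T: "connected T" "0 \<in> T"
    and no_corner: "\<And>t. t \<in> T \<Longrightarrow> x + t *\<^sub>R axis j 1 \<notin> corners W" and t: "t \<in> T"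
  shows "x + t *\<^sub>R axis j 1 \<in> W \<and> blocked W i \<sigma> (x + t *\<^sub>R axis j 1)"
proof -
  have cl: "closed W" by (rule polyrectangle_closed[OF W])
  define P where "P t \<longleftrightarrow> x + t *\<^sub>R axis j 1 \<in> W \<and> blocked W i \<sigma> (x + t *\<^sub>R axis j 1)" for t
  have comp: "((s *\<^sub>R axis i (1::real)) + (t *\<^sub>R axis j 1)) $ c = (if c = i then s else if c = j then t else 0)" for s t c
    using ij(2) by (simp add: axis_def)
  have local_const: "\<exists>d>0. \<forall>t. \<bar>t - t0\<bar> < d \<longrightarrow> (P t \<longleftrightarrow> P t0)" if t0: "t0 \<in> T" for t0
  proof -
    let ?y = "x + t0 *\<^sub>R axis j 1"
    have shift: "x + t *\<^sub>R axis j 1 = ?y + (t - t0) *\<^sub>R axis j 1" for t by (simp add: algebra_simps)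
    show ?thesis
    proof (cases "?y \<in> W")
      case False
      then have "open (- W)" "?y \<in> - W" using cl by auto
      then obtain d where d: "d > 0" "ball ?y d \<subseteq> - W" by (meson open_contains_ball)
      have "\<not> P t" if "\<bar>t - t0\<bar> < d" for t
      proof -
        have "x + t *\<^sub>R axis j 1 \<in> ball ?y d" using that unfolding shift[of t] by (simp add: dist_norm)
        then show ?thesis using d(2) unfolding P_def by blast
      qed
      then show ?thesis using d(1) by (metis abs_zero diff_self)
    next
      case y: True
      obtain r where r: "sign_stable W ?y r" using polyrectangle_sign_stable[OF W] by blast
      then have r0: "r > 0" by (simp add: sign_stable_def)
      show ?thesis
      proof (cases "blocked W i \<sigma> ?y")
        case True
        have "i \<notin> free_dirs W ?y" by (rule blocked_not_free[OF W True \<sigma>])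
        moreover have "free_dirs W ?y \<noteq> {}" using no_corner[OF t0] y by (auto simp: corners_def bdry_def)
        ultimately have "j \<in> free_dirs W ?y" using ij(1) by (metis UNIV_I all_not_in_conv insertE singletonD)
        then obtain r' where r': "r' > 0" "\<And>t. \<bar>t\<bar> < r' \<Longrightarrow> ?y + t *\<^sub>R axis j 1 \<in> W"
          using free_dirs_two_sided[OF W] by blast
        have "P t" if t: "\<bar>t - t0\<bar> < min r r'" for t
        proof -
          have "blocked W i \<sigma> (?y + (t - t0) *\<^sub>R axis j 1)"
            unfolding blocked_def
          proof (intro exI[of _ r] conjI allI impI notI)
            fix s assume s: "0 < s \<and> s < r" and in_W: "?y + (t - t0) *\<^sub>R axis j 1 + (\<sigma> * s) *\<^sub>R axis i 1 \<in> W"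
            let ?v = "(\<sigma> * s) *\<^sub>R axis i 1 + (t - t0) *\<^sub>R axis j 1"
            have "?y + ?v \<in> W" using in_W by (simp add: add_ac)
            moreover have "\<bar>?v $ c\<bar> < r" for c unfolding comp using s t r0 \<sigma> by (simp add: abs_mult)
            moreover have "((\<sigma> * s) *\<^sub>R axis i (1::real)) $ c = ?v $ c \<or> ((\<sigma> * s) *\<^sub>R axis i (1::real)) $ c = 0" for c
              unfolding comp using ij(2) by (simp add: axis_def)
            ultimately have "?y + (\<sigma> * s) *\<^sub>R axis i 1 \<in> W" by (rule sign_stable_drop[OF cl r])
            then show False using blocked_iff_near[OF r \<sigma>, of s i] True s by blast
          qed (rule r0)
          then show ?thesis using r'(2)[of "t - t0"] t unfolding P_def shift[of t] by simp
        qed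
        moreover have "P t0" using True y by (simp add: P_def)
        ultimately show ?thesis using r0 r'(1) by (intro exI[of _ "min r r'"]) auto
      next
        case False
        have "\<not> P t" if t: "\<bar>t - t0\<bar> < r" for t
        proof
          assume Pt: "P t"
          define d where "d = t - t0"
          have d: "\<bar>d\<bar> < r" "d \<noteq> 0" using t Pt False by (auto simp: d_def P_def)
          have Pd: "?y + d *\<^sub>R axis j 1 \<in> W" "blocked W i \<sigma> (?y + d *\<^sub>R axis j 1)"
            using Pt unfolding P_def shift[of t] d_def by auto
          define \<tau> where "\<tau> = sgn d"
          have \<tau>: "\<bar>\<tau>\<bar> = 1" "\<tau> * \<bar>d\<bar> = d" using d(2) by (auto simp: \<tau>_def abs_sgn_eq sgn_mult_abs)
          obtain r' where r': "r' > 0" "\<And>s. 0 < s \<Longrightarrow> s < r' \<Longrightarrow> ?y + d *\<^sub>R axis j 1 + (\<sigma> * s) *\<^sub>R axis i 1 \<notin> W"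
            using Pd(2) unfolding blocked_def by blast
          define s0 where "s0 = min r r' / 2"
          have s0: "0 < s0" "s0 < r" "s0 < r'" using r0 r'(1) by (auto simp: s0_def)
          have "?y \<in> corners W"
          proof (rule corner_of_missing_quadrant[OF W ij y \<sigma> \<tau>(1) r0])
            fix u assume u: "0 < u" "u < r"
            have "\<not> blocked W j \<tau> ?y"
              using blocked_iff_near[OF r \<tau>(1), of "\<bar>d\<bar>" j] d \<tau>(2) Pd(1) by simp
            then show "?y + (\<tau> * u) *\<^sub>R axis j 1 \<in> W" using blocked_iff_near[OF r \<tau>(1) u] by blast
            show "?y + (\<sigma> * u) *\<^sub>R axis i 1 \<in> W" using blocked_iff_near[OF r \<sigma> u] False by blast
          next
            fix s u assume su: "0 < s" "s < r" "0 < u" "u < r"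
            let ?v = "(\<sigma> * s) *\<^sub>R axis i (1::real) + (\<tau> * u) *\<^sub>R axis j 1"
            let ?v' = "(\<sigma> * s0) *\<^sub>R axis i (1::real) + d *\<^sub>R axis j 1"
            have "\<bar>?v $ c\<bar> < r \<and> \<bar>?v' $ c\<bar> < r \<and> sgn (?v $ c) = sgn (?v' $ c)" for c
              unfolding comp using su s0 d(1) r0 \<sigma> \<tau>(1) by (auto simp: abs_mult sgn_mult \<tau>_def)
            then have "(?y + ?v \<in> W) = (?y + ?v' \<in> W)"
              using r unfolding sign_stable_def by blast
            moreover have "?y + ?v' \<notin> W" using r'(2)[OF s0(1,3)] by (simp add: add_ac)
            ultimately show "?y + (\<sigma> * s) *\<^sub>R axis i 1 + (\<tau> * u) *\<^sub>R axis j 1 \<notin> W" by (simp add: add.assoc)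
          qed
          then show False using no_corner[OF t0] by blast
        qed
        then show ?thesis using r0 by (metis abs_zero diff_self)
      qed
    qed
  qed
  have "P constant_on T"
  proof (rule locally_constant_imp_constant[OF T(1)])
    fix a assume "a \<in> T"
    then obtain d where d: "d > 0" "\<And>t. \<bar>t - a\<bar> < d \<Longrightarrow> P t \<longleftrightarrow> P a" using local_const by blast
    show "\<exists>U. openin (top_of_set T) U \<and> a \<in> U \<and> (\<forall>x\<in>U. P x = P a)"
    proof (intro exI[of _ "T \<inter> ball a d"] conjI ballI)
      show "openin (top_of_set T) (T \<inter> ball a d)" by (rule openin_open_Int) simp
      show "a \<in> T \<inter> ball a d" using \<open>a \<in> T\<close> d(1) by simp
      fix x assume "x \<in> T \<inter> ball a d"
      then have "\<bar>x - a\<bar> < d" by (simp add: dist_real_def abs_minus_commute)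
      then show "P x = P a" by (rule d(2))
    qed
  qed
  then obtain b where "\<And>u. u \<in> T \<Longrightarrow> P u = b" unfolding constant_on_def by blast
  then have "P t = P 0" using t T(2) by simp
  moreover have "P 0" using x by (simp add: P_def)
  ultimately show ?thesis unfolding P_def by simp
qed

lemma free_slice_of_blocked:
  fixes W :: "(real ^ 'n) set"
  assumes W: "polyrectangle W" and ij: "UNIV = {i, j}" "i \<noteq> j" and \<sigma>: "\<bar>\<sigma>\<bar> = 1"
    and y: "y \<in> W" "\<And>c. \<bar>y $ c - p $ c\<bar> < R" "blocked W i \<sigma> y"
    and no_corner: "\<And>x. (\<And>c. \<bar>x $ c - p $ c\<bar> < R) \<Longrightarrow> x \<notin> corners W"
    and z: "z \<in> flat_slice {j} p y R"
  shows "z \<in> W" "\<bar>z $ c - p $ c\<bar> < R" "free_dirs W z = {j}" "blocked W i \<sigma> z"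
proof -
  have two: "c = i \<or> c = j" for c using ij(1) by (metis UNIV_I insertE singletonD)
  define T where "T = {t. \<bar>y $ j + t - p $ j\<bar> < R}"
  have T: "T = {p $ j - y $ j - R <..< p $ j - y $ j + R}" by (auto simp: T_def abs_less_iff)
  have box: "\<bar>(y + t *\<^sub>R axis j 1) $ c - p $ c\<bar> < R" if "t \<in> T" for t c
    using that two[of c] y(2)[of c] ij(2) by (auto simp: T_def axis_def)
  have z_eq: "z = y + (z $ j - y $ j) *\<^sub>R axis j 1"
    unfolding vec_eq_iff
  proof
    fix c show "z $ c = (y + (z $ j - y $ j) *\<^sub>R axis j 1) $ c"
      using z two[of c] ij(2) by (auto simp: flat_slice_def axis_def)
  qed
  have zT: "z $ j - y $ j \<in> T" using z by (simp add: T_def flat_slice_def)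
  show box_z: "\<bar>z $ c - p $ c\<bar> < R" for c using box[OF zT, of c] z_eq by simp
  have "z \<in> W \<and> blocked W i \<sigma> z"
    by (subst (1 2) z_eq, rule chord_blocked[OF W ij \<sigma> y(1,3) _ _ _ zT])
      (use y(2)[of j] box no_corner in \<open>auto simp: T\<close>)
  then show zW: "z \<in> W" and bl: "blocked W i \<sigma> z" by auto
  have "i \<notin> free_dirs W z" by (rule blocked_not_free[OF W bl \<sigma>])
  moreover have "free_dirs W z \<noteq> {}" using no_corner[OF box_z] zW by (auto simp: corners_def bdry_def)
  ultimately show "free_dirs W z = {j}" using two by (metis (full_types) all_not_in_conv insertI1 singletonD subsetI subset_antisym empty_subsetI insert_subset)
qed

text \<open>In a square around \<open>p\<close> without corners, either the whole square lies in \<open>W\<close>, or some edge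
  crosses the square along a full chord. In the second case the line through \<open>p\<close> parallel to the edge stays in \<open>W\<close>: if both
  coordinate lines through \<open>p\<close> were interrupted, the two resulting chords would cross at a point blocked in
  both directions, which is a corner.\<close>

lemma free_slice_without_corners:
  fixes W :: "(real ^ 'n) set" and i j :: 'n
  assumes W: "polyrectangle W" and ij: "UNIV = {i, j}" "i \<noteq> j" and p: "p \<in> W" and R: "R > 0"
    and no_corner: "\<And>x. (\<And>c. \<bar>x $ c - p $ c\<bar> < R) \<Longrightarrow> x \<notin> corners W"
  obtains I x where "I \<noteq> {}"
    "\<And>z. z \<in> flat_slice I p x R \<Longrightarrow> z \<in> W \<and> (\<forall>c. \<bar>z $ c - p $ c\<bar> < R) \<and> free_dirs W z = I"
    "\<And>c t. c \<in> I \<Longrightarrow> \<bar>t\<bar> < R \<Longrightarrow> p + t *\<^sub>R axis c 1 \<in> W"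
proof -
  note goal = that
  have two: "c = i \<or> c = j" for c using ij(1) by (metis UNIV_I insertE singletonD)
  have box: "\<bar>(p + t *\<^sub>R axis a 1) $ c - p $ c\<bar> < R" if "\<bar>t\<bar> < R" for t a c
    using that R by (auto simp: axis_def)
  have exits: thesis if ab: "UNIV = {a, b}" "a \<noteq> b" and s: "\<bar>s\<bar> < R" "p + s *\<^sub>R axis a 1 \<notin> W" for a b :: 'n and s
  proof -
    obtain t \<sigma> where t: "\<bar>t\<bar> < \<bar>s\<bar>" "p + t *\<^sub>R axis a 1 \<in> W" "\<bar>\<sigma>\<bar> = 1" "blocked W a \<sigma> (p + t *\<^sub>R axis a 1)"
      by (rule line_exit_blocked[OF W p s(2)])
    let ?y = "p + t *\<^sub>R axis a (1::real)"
    have tR: "\<bar>t\<bar> < R" using t(1) s(1) by simp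
    note slice = free_slice_of_blocked[OF W ab t(3,2) box[OF tR] t(4) no_corner]
    have line: "p + u *\<^sub>R axis b 1 \<in> W" if u: "\<bar>u\<bar> < R" for u
    proof (rule ccontr)
      assume "p + u *\<^sub>R axis b 1 \<notin> W"
      then obtain v \<tau> where v: "\<bar>v\<bar> < \<bar>u\<bar>" "p + v *\<^sub>R axis b 1 \<in> W" "\<bar>\<tau>\<bar> = 1" "blocked W b \<tau> (p + v *\<^sub>R axis b 1)"
        by (rule line_exit_blocked[OF W p])
      have vR: "\<bar>v\<bar> < R" using v(1) u by simp
      have ba: "UNIV = {b, a}" "b \<noteq> a" using ab by auto
      note slice' = free_slice_of_blocked[OF W ba v(3,2) box[OF vR] v(4) no_corner]
      define z where "z = p + t *\<^sub>R axis a 1 + v *\<^sub>R axis b (1::real)"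
      have z1: "z \<in> flat_slice {b} p ?y R" using vR ab(2) by (auto simp: z_def flat_slice_def axis_def)
      have z2: "z \<in> flat_slice {a} p (p + v *\<^sub>R axis b 1) R" using tR ab(2) by (auto simp: z_def flat_slice_def axis_def)
      have "z \<in> corners W"
        by (rule blocked_twice_corner[OF W ab(1) slice(1)[OF _ z1] t(3) v(3) slice(4)[OF _ z1] slice'(4)[OF _ z2]])
      then show False using no_corner[OF slice(2)[OF _ z1]] by blast
    qed
    show thesis
      by (rule goal[of "{b}" ?y]) (use slice(1,2,3) line in auto)
  qed
  show thesis
  proof (cases "\<exists>s. \<bar>s\<bar> < R \<and> (p + s *\<^sub>R axis i 1 \<notin> W \<or> p + s *\<^sub>R axis j 1 \<notin> W)")
    case True
    then show thesis using exits[OF ij] exits[of j i] ij by auto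
  next
    case False
    then have lines: "p + s *\<^sub>R axis c 1 \<in> W" if "\<bar>s\<bar> < R" for s c using that two[of c] by blast
    define Q where "Q = flat_slice UNIV p p R"
    show thesis
    proof (cases "Q \<subseteq> W")
      case True
      have "Q = (\<Inter>c. {x. \<bar>x $ c - p $ c\<bar> < R})" by (auto simp: Q_def flat_slice_def)
      moreover have "open {x :: real ^ 'n. \<bar>x $ c - p $ c\<bar> < R}" for c by (intro open_Collect_less continuous_intros)
      ultimately have "open Q" by auto
      then have "Q \<subseteq> interior W" using True by (simp add: interior_maximal)
      then show thesis
        using that[of UNIV p] lines True unfolding Q_def by (auto simp: flat_slice_def free_dirs_def subset_iff)
    next
      case False
      then obtain q where q: "q \<in> Q" "q \<notin> W" by blast
      have qR: "\<bar>q $ c - p $ c\<bar> < R" for c using q(1) by (simp add: Q_def flat_slice_def)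
      define z where "z = p + (q $ i - p $ i) *\<^sub>R axis i (1::real)"
      have z: "z \<in> W" unfolding z_def by (rule lines[OF qR])
      have "z + (q $ j - p $ j) *\<^sub>R axis j 1 = q"
        unfolding vec_eq_iff
      proof
        fix c show "(z + (q $ j - p $ j) *\<^sub>R axis j 1) $ c = q $ c"
          using two[of c] ij(2) by (auto simp: z_def axis_def)
      qed
      then have "z + (q $ j - p $ j) *\<^sub>R axis j 1 \<notin> W" using q(2) by simp
      then obtain t \<tau> where t: "\<bar>t\<bar> < \<bar>q $ j - p $ j\<bar>" "z + t *\<^sub>R axis j 1 \<in> W" "\<bar>\<tau>\<bar> = 1" "blocked W j \<tau> (z + t *\<^sub>R axis j 1)"
        by (rule line_exit_blocked[OF W z])
      let ?y = "z + t *\<^sub>R axis j (1::real)"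
      have ybox: "\<bar>?y $ c - p $ c\<bar> < R" for c
        using two[of c] ij(2) t(1) qR[of i] qR[of j] by (auto simp: z_def axis_def)
      have ji: "UNIV = {j, i}" "j \<noteq> i" using ij by auto
      note slice = free_slice_of_blocked[OF W ji t(3,2) ybox t(4) no_corner]
      show thesis by (rule that[of "{i}" ?y]) (use slice(1,2,3) lines in auto)
    qed
  qed
qed

section \<open>Pixelated sets\<close>

definition lattice_points :: "real \<Rightarrow> (real ^ 'n) set \<Rightarrow> (real ^ 'n) set" where
  "lattice_points e A = {x \<in> A. \<forall>i. \<exists>z::int. x $ i = e * of_int z}"

definition pixel :: "real \<Rightarrow> real ^ 'n \<Rightarrow> (real ^ 'n) set" where
  "pixel e x = {x + e *\<^sub>R u | u. \<forall>i. u $ i \<in> {-1/2..<1/2}}"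

lemma pixelation_eq: "pixelation e A = (\<Union>x\<in>lattice_points e A. pixel e x)"
  unfolding pixelation_def lattice_points_def pixel_def by blast

lemma pixel_iff:
  assumes "e > 0"
  shows "y \<in> pixel e x \<longleftrightarrow> (\<forall>i. - e / 2 \<le> y $ i - x $ i \<and> y $ i - x $ i < e / 2)"
proof
  assume "y \<in> pixel e x"
  then obtain u where u: "y = x + e *\<^sub>R u" "\<And>i. u $ i \<in> {-1/2..<1/2}" by (auto simp: pixel_def)
  have "- 1 / 2 * e \<le> u $ i * e" "u $ i * e < 1 / 2 * e" for i
    using u(2)[of i] assms by (intro mult_right_mono mult_strict_right_mono; simp)+
  then show "\<forall>i. - e / 2 \<le> y $ i - x $ i \<and> y $ i - x $ i < e / 2" unfolding u(1) by (simp add: mult.commute)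
next
  assume *: "\<forall>i. - e / 2 \<le> y $ i - x $ i \<and> y $ i - x $ i < e / 2"
  show "y \<in> pixel e x"
    unfolding pixel_def
  proof (intro CollectI exI conjI allI)
    show "y = x + e *\<^sub>R ((1 / e) *\<^sub>R (y - x))" using assms by simp
    fix i show "((1 / e) *\<^sub>R (y - x)) $ i \<in> {-1/2..<1/2}"
      using *[rule_format, of i] assms by (simp add: field_simps)
  qed
qed

lemma pixel_segment:
  assumes "e > 0" "y \<in> pixel e x"
  shows "closed_segment y x \<subseteq> pixel e x"
proof
  fix z assume "z \<in> closed_segment y x"
  then obtain t where t: "0 \<le> t" "t \<le> 1" "z = (1 - t) *\<^sub>R y + t *\<^sub>R x" by (auto simp: in_segment)
  have zi: "z $ i - x $ i = (1 - t) * (y $ i - x $ i)" for i by (simp add: t(3) algebra_simps)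
  have y: "- e / 2 \<le> y $ i - x $ i" "y $ i - x $ i < e / 2" for i
    using assms(2) unfolding pixel_iff[OF assms(1)] by auto
  have "- e / 2 \<le> (1 - t) * (y $ i - x $ i) \<and> (1 - t) * (y $ i - x $ i) < e / 2" for i
  proof
    have "(1 - t) * (- e / 2) \<le> (1 - t) * (y $ i - x $ i)" using y(1)[of i] t by (intro mult_left_mono) auto
    moreover have "- e / 2 \<le> (1 - t) * (- e / 2)" using t assms(1) by (simp add: field_simps)
    ultimately show "- e / 2 \<le> (1 - t) * (y $ i - x $ i)" by linarith
    show "(1 - t) * (y $ i - x $ i) < e / 2"
    proof (cases "y $ i - x $ i \<ge> 0")
      case True
      have "(1 - t) * (y $ i - x $ i) \<le> 1 * (y $ i - x $ i)" using True t by (intro mult_right_mono) auto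
      then show ?thesis using y(2)[of i] by simp
    next
      case False
      then have "(1 - t) * (y $ i - x $ i) \<le> 0" using t by (intro mult_nonneg_nonpos) auto
      then show ?thesis using assms(1) by simp
    qed
  qed
  then show "z \<in> pixel e x" unfolding pixel_iff[OF assms(1)] zi by simp
qed

text \<open>Each point of the segment lies in the pixel centred at the nearest lattice point of the line.\<close>

lemma lattice_segment_in_pixelation:
  assumes e: "e > 0" and x: "x \<in> lattice_points e A" and y: "y = x + (e * of_int n) *\<^sub>R axis c 1"
    and between: "\<And>k::int. min 0 n \<le> k \<Longrightarrow> k \<le> max 0 n \<Longrightarrow> x + (e * of_int k) *\<^sub>R axis c 1 \<in> A"
  shows "closed_segment x y \<subseteq> pixelation e A"
proof
  fix z assume "z \<in> closed_segment x y"
  then obtain t where t: "0 \<le> t" "t \<le> 1" "z = x + (e * (t * of_int n)) *\<^sub>R axis c 1"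
    by (auto simp: in_segment y algebra_simps)
  define k where "k = \<lfloor>t * of_int n + 1 / 2\<rfloor>"
  have k: "min 0 n \<le> k \<and> k \<le> max 0 n"
  proof (cases "n \<ge> 0")
    case True
    then have "0 \<le> t * of_int n" "t * of_int n \<le> of_int n" using t by (auto simp: mult_left_le_one_le)
    then have "0 \<le> k" "k \<le> n" unfolding k_def by linarith+
    then show ?thesis using True by simp
  next
    case False
    then have "t * of_int n \<le> 0" "(1 - t) * of_int n \<le> 0" using t by (auto simp: mult_nonneg_nonpos)
    then have "t * of_int n \<le> 0" "of_int n \<le> t * of_int n" by (linarith, simp only: left_diff_distrib)
    then have "n \<le> k" "k \<le> 0" unfolding k_def by linarith+
    then show ?thesis using False by simp
  qed
  let ?q = "x + (e * of_int k) *\<^sub>R axis c (1::real)"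
  have "\<exists>z::int. ?q $ i = e * of_int z" for i
  proof -
    obtain a :: int where "x $ i = e * of_int a" using x by (auto simp: lattice_points_def)
    then have "?q $ i = e * of_int (if i = c then a + k else a)"
      by (auto simp: axis_def algebra_simps)
    then show ?thesis by blast
  qed
  then have q: "?q \<in> lattice_points e A" using between k by (simp add: lattice_points_def)
  have "- 1 / 2 \<le> t * of_int n - of_int k" "t * of_int n - of_int k < 1 / 2"
    unfolding k_def by linarith+
  then have "e * (- 1 / 2) \<le> e * (t * of_int n - of_int k)" "e * (t * of_int n - of_int k) < e * (1 / 2)"
    using e by (intro mult_left_mono mult_strict_left_mono; simp)+
  then have "z \<in> pixel e ?q"
    unfolding pixel_iff[OF e] t(3) using e by (auto simp: axis_def algebra_simps)
  then show "z \<in> pixelation e A" unfolding pixelation_eq using q by blast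
qed

lemma pixel_component_contains_lattice_step:
  assumes e: "e > 0" and D: "D \<in> path_components_of (top_of_set (pixelation e A))"
    and x: "x \<in> lattice_points e A" "x \<in> D"
    and between: "\<And>k::int. min 0 n \<le> k \<Longrightarrow> k \<le> max 0 n \<Longrightarrow> x + (e * of_int k) *\<^sub>R axis c 1 \<in> A"
  shows "x + (e * of_int n) *\<^sub>R axis c 1 \<in> D"
proof -
  have "closed_segment x (x + (e * of_int n) *\<^sub>R axis c 1) \<subseteq> D"
    using x(2) by (intro path_component_absorbs[OF D] lattice_segment_in_pixelation[OF e x(1) refl between]) auto
  then show ?thesis by auto
qed

lemma lattice_points_shift:
  assumes "x \<in> lattice_points e A" "x + (e * of_int n) *\<^sub>R axis c 1 \<in> B"
  shows "x + (e * of_int n) *\<^sub>R axis c 1 \<in> lattice_points e B"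
proof -
  have "\<exists>z::int. (x + (e * of_int n) *\<^sub>R axis c (1::real)) $ i = e * of_int z" for i
  proof -
    obtain a :: int where "x $ i = e * of_int a" using assms(1) by (auto simp: lattice_points_def)
    then have "(x + (e * of_int n) *\<^sub>R axis c (1::real)) $ i = e * of_int (if i = c then a + n else a)"
      by (auto simp: axis_def algebra_simps)
    then show ?thesis by blast
  qed
  then show ?thesis using assms(2) by (simp add: lattice_points_def)
qed

text \<open>Two lattice points of a rectangle are joined by an L-shaped path.\<close>

lemma rectangle_lattice_connected:
  fixes A :: "(real ^ 'n) set" and i j :: 'n
  assumes e: "e > 0" and ij: "UNIV = {i, j}" "i \<noteq> j"
    and D: "D \<in> path_components_of (top_of_set (pixelation e A))"
    and J: "\<And>c. is_interval (J c)" and JA: "lattice_points e {x. \<forall>c. x $ c \<in> J c} \<subseteq> A"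
    and p: "p \<in> lattice_points e {x. \<forall>c. x $ c \<in> J c}" "p \<in> D"
    and q: "q \<in> lattice_points e {x. \<forall>c. x $ c \<in> J c}"
  shows "q \<in> D"
proof -
  let ?B = "{x :: real ^ 'n. \<forall>c. x $ c \<in> J c}"
  have two: "c = i \<or> c = j" for c using ij(1) by (metis UNIV_I insertE singletonD)
  have conv: "x \<in> J c" if "a \<in> J c" "b \<in> J c" "a \<le> x" "x \<le> b" for a b c x
    using J[of c] that unfolding is_interval_1 by blast
  have step: "x + (e * of_int n) *\<^sub>R axis c 1 \<in> D \<and> x + (e * of_int n) *\<^sub>R axis c 1 \<in> lattice_points e ?B"
    if x: "x \<in> lattice_points e ?B" "x \<in> D" and end_in: "x $ c + e * of_int n \<in> J c" for x c and n :: int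
  proof -
    have mid: "x + (e * of_int k) *\<^sub>R axis c 1 \<in> lattice_points e ?B" if k: "min 0 n \<le> k" "k \<le> max 0 n" for k
    proof (rule lattice_points_shift[OF x(1)])
      have xJ: "x $ d \<in> J d" for d using x(1) by (simp add: lattice_points_def)
      have "x $ c + e * of_int k \<in> J c"
      proof (cases "n \<ge> 0")
        case True
        then show ?thesis using k e by (intro conv[OF xJ end_in]) auto
      next
        case False
        then show ?thesis using k e by (intro conv[OF end_in xJ]) (auto simp: mult_nonneg_nonpos)
      qed
      then show "x + (e * of_int k) *\<^sub>R axis c 1 \<in> ?B" using xJ by (auto simp: axis_def)
    qed
    have "x \<in> lattice_points e A" using x(1) JA by (auto simp: lattice_points_def)
    then have "x + (e * of_int n) *\<^sub>R axis c 1 \<in> D"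
      by (rule pixel_component_contains_lattice_step[OF e D _ x(2)]) (use mid JA in auto)
    then show ?thesis using mid[of n] by auto
  qed
  have diff: "\<exists>n::int. q $ c = p $ c + e * of_int n" for c
  proof -
    obtain a b :: int where "p $ c = e * of_int a" "q $ c = e * of_int b"
      using p(1) q unfolding lattice_points_def by blast
    then show ?thesis by (intro exI[of _ "b - a"]) (simp add: algebra_simps)
  qed
  obtain ni nj :: int where n: "q $ i = p $ i + e * of_int ni" "q $ j = p $ j + e * of_int nj"
    using diff by blast
  have qJ: "q $ c \<in> J c" for c using q by (simp add: lattice_points_def)
  define r where "r = p + (e * of_int ni) *\<^sub>R axis i (1::real)"
  have r: "r \<in> D" "r \<in> lattice_points e ?B" using step[OF p, of i ni] qJ[of i] n(1) by (auto simp: r_def)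
  have rj: "r $ j = p $ j" using ij(2) by (simp add: r_def axis_def)
  have "q = r + (e * of_int nj) *\<^sub>R axis j 1"
    unfolding vec_eq_iff
  proof
    fix c show "q $ c = (r + (e * of_int nj) *\<^sub>R axis j 1) $ c"
      using two[of c] n ij(2) by (auto simp: r_def axis_def)
  qed
  then show ?thesis using step[OF r(2,1), of j nj] qJ[of j] n(2) rj by auto
qed

lemma finite_lattice_points:
  fixes D :: "(real ^ 'n) set"
  assumes "e > 0" "bounded D"
  shows "finite (lattice_points e A \<inter> D)"
proof -
  obtain B where B: "\<And>x. x \<in> D \<Longrightarrow> norm x \<le> B" using assms(2) unfolding bounded_iff by blast
  define N where "N = \<lceil>B / e\<rceil>"
  have "lattice_points e A \<inter> D \<subseteq> (\<lambda>z. \<chi> i. e * of_int (z i)) ` (PiE UNIV (\<lambda>_. {-N..N}))"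
  proof
    fix x assume x: "x \<in> lattice_points e A \<inter> D"
    then have "\<forall>i. \<exists>z::int. x $ i = e * of_int z" by (auto simp: lattice_points_def)
    then obtain z :: "'n \<Rightarrow> int" where z: "\<And>i. x $ i = e * of_int (z i)" by metis
    have "z i \<in> {-N..N}" for i
    proof -
      have "\<bar>x $ i\<bar> \<le> B" using component_le_norm_cart[of x i] B[of x] x by auto
      then have "e * \<bar>of_int (z i)\<bar> \<le> B" using z[of i] assms(1) by (simp add: abs_mult)
      then have "\<bar>of_int (z i)\<bar> \<le> B / e" using assms(1) by (simp add: field_simps)
      also have "\<dots> \<le> of_int N" unfolding N_def by linarith
      finally have "of_int \<bar>z i\<bar> \<le> (of_int N :: real)" by simp
      then show ?thesis by (simp only: of_int_le_iff abs_le_iff) auto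
    qed
    then have "z \<in> PiE UNIV (\<lambda>_. {-N..N})" by auto
    moreover have "x = (\<chi> i. e * of_int (z i))" using z by (simp add: vec_eq_iff)
    ultimately show "x \<in> (\<lambda>z. \<chi> i. e * of_int (z i)) ` (PiE UNIV (\<lambda>_. {-N..N}))" by blast
  qed
  moreover have "finite (PiE (UNIV :: 'n set) (\<lambda>_. {-N..N}))" by (intro finite_PiE) auto
  ultimately show ?thesis by (meson finite_imageI finite_subset)
qed

text \<open>A pixel contains the segments to its centre, so every component contains pixel centres, and a
  bounded component contains finitely many.\<close>

lemma pixel_component_peak:
  fixes f :: "real ^ 'n \<Rightarrow> real"
  assumes "e > 0" and D: "D \<in> bounded_components (pixelation e A)"
  obtains p where "p \<in> D" "p \<in> lattice_points e A" "\<And>q. q \<in> lattice_points e A \<Longrightarrow> q \<in> D \<Longrightarrow> f q \<le> f p"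
proof -
  have pc: "D \<in> path_components_of (top_of_set (pixelation e A))" "bounded D"
    using D by (auto simp: bounded_components_def)
  have "D \<noteq> {}" "D \<subseteq> pixelation e A"
    using nonempty_path_components_of[OF pc(1)] path_components_of_subset[OF pc(1)] by auto
  then obtain y x where y: "y \<in> D" "x \<in> lattice_points e A" "y \<in> pixel e x" unfolding pixelation_eq by blast
  have "closed_segment y x \<subseteq> D"
    using y pixel_segment[OF assms(1) y(3)]
    by (intro path_component_absorbs[OF pc(1)]) (auto simp: pixelation_eq)
  then have "x \<in> lattice_points e A \<inter> D" using y(2) by auto
  moreover have fin: "finite (lattice_points e A \<inter> D)" by (rule finite_lattice_points[OF assms(1) pc(2)])
  ultimately have "Max (f ` (lattice_points e A \<inter> D)) \<in> f ` (lattice_points e A \<inter> D)"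
    by (intro Max_in) auto
  then obtain p where p: "p \<in> lattice_points e A \<inter> D" "Max (f ` (lattice_points e A \<inter> D)) = f p" by auto
  have "f q \<le> f p" if "q \<in> lattice_points e A" "q \<in> D" for q
    unfolding p(2)[symmetric] using fin that by (intro Max_ge) auto
  then show ?thesis using that p(1) by blast
qed

section \<open>Peaks of pixel components\<close>

lemma pixel_component_contains_neighbour:
  assumes "e > 0" "D \<in> path_components_of (top_of_set (pixelation e A))"
    and x: "x \<in> lattice_points e A" "x \<in> D" and n: "\<bar>n\<bar> = (1::int)" "x + (e * of_int n) *\<^sub>R axis c 1 \<in> A"
  shows "x + (e * of_int n) *\<^sub>R axis c 1 \<in> D"
proof (rule pixel_component_contains_lattice_step[OF assms(1-4)])
  fix k :: int assume "min 0 n \<le> k" "k \<le> max 0 n"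
  then have "k = 0 \<or> k = n" using n(1) by auto
  then show "x + (e * of_int k) *\<^sub>R axis c 1 \<in> A" using n(2) x(1) by (auto simp: lattice_points_def)
qed

text \<open>Neither neighbour of the peak in direction \<open>c\<close> has a larger value of \<open>f\<close>: a neighbour in the excursion
  set belongs to the same component, and any other neighbour has value at most \<open>l\<close>. By the mean
  value theorem the derivative takes both signs within distance \<open>e\<close> of the peak.\<close>

lemma peak_derivative_le:
  fixes f :: "real ^ 'n \<Rightarrow> real"
  assumes e: "e > 0" "e < R" and f: "C11_on W f" and F: "excursion W f l F" and L: "0 \<le> L"
    and lip: "\<And>x y. x \<in> W \<Longrightarrow> y \<in> W \<Longrightarrow> \<bar>pd W c f x - pd W c f y\<bar> \<le> L * dist x y"
    and D: "D \<in> path_components_of (top_of_set (pixelation e F))"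
    and p: "p \<in> D" "p \<in> lattice_points e F" "\<And>q. q \<in> lattice_points e F \<Longrightarrow> q \<in> D \<Longrightarrow> f q \<le> f p"
    and line: "\<And>t. \<bar>t\<bar> < R \<Longrightarrow> p + t *\<^sub>R axis c 1 \<in> W"
  shows "\<bar>pd W c f p\<bar> \<le> L * e"
proof -
  let ?q = "\<lambda>t. p + t *\<^sub>R axis c (1::real)"
  have "p \<in> F" using p(2) by (simp add: lattice_points_def)
  then have fp: "f p \<ge> l" using F by (auto simp: excursion_def)
  have "f (?q (e * of_int n)) \<le> f p" if n: "\<bar>n\<bar> = (1::int)" for n
  proof (cases "?q (e * of_int n) \<in> F")
    case True
    then show ?thesis
      using p pixel_component_contains_neighbour[OF e(1) D p(2,1) n True] lattice_points_shift[OF p(2) True] by blast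
  next
    case False
    have "\<bar>e * of_int n\<bar> < R" using n e by (cases "n \<ge> 0") auto
    then have "f (?q (e * of_int n)) \<le> l" using False line F by (force simp: excursion_def)
    then show ?thesis using fp by simp
  qed
  from this[of 1] this[of "-1"] have nb: "f (?q e) \<le> f p" "f (?q (- e)) \<le> f p" by simp_all
  have der: "((\<lambda>t. f (?q t)) has_real_derivative pd W c f (?q t0)) (at t0)" if "\<bar>t0\<bar> < R" for t0
    using that by (intro has_real_derivative_pd[where r = "R - \<bar>t0\<bar>"] C11_continuous(1)[OF f] line) auto
  have close: "\<bar>pd W c f p - pd W c f (?q z)\<bar> \<le> L * e" if "\<bar>z\<bar> \<le> e" for z
  proof -
    have "p \<in> W" "?q z \<in> W" using line[of 0] line[of z] that e by auto
    then have "\<bar>pd W c f p - pd W c f (?q z)\<bar> \<le> L * dist p (?q z)" by (rule lip)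
    also have "\<dots> \<le> L * e" using that L by (intro mult_left_mono) (auto simp: dist_norm)
    finally show ?thesis .
  qed
  obtain z where z: "0 < z" "z < e" "f (?q e) - f (?q 0) = (e - 0) * pd W c f (?q z)"
    using MVT2[of 0 e "\<lambda>t. f (?q t)" "\<lambda>t. pd W c f (?q t)"] der e by auto
  have "e * pd W c f (?q z) \<le> 0" using z(3) nb(1) by simp
  then have "pd W c f (?q z) \<le> 0" using e(1) by (simp add: mult_le_0_iff)
  then have upper: "pd W c f p \<le> L * e" using close[of z] z by linarith
  obtain z' where z': "- e < z'" "z' < 0" "f (?q 0) - f (?q (- e)) = (0 - (- e)) * pd W c f (?q z')"
    using MVT2[of "- e" 0 "\<lambda>t. f (?q t)" "\<lambda>t. pd W c f (?q t)"] der e by auto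
  have "0 \<le> e * pd W c f (?q z')" using z'(3) nb(2) by simp
  then have "0 \<le> pd W c f (?q z')" using e(1) by (simp add: zero_le_mult_iff)
  then have "- (L * e) \<le> pd W c f p" using close[of z'] z' by linarith
  with upper show ?thesis by linarith
qed

text \<open>Compare all boxes containing \<open>y\<close> with a largest one. If its radius is \<open>2 * e\<close>, all peaks lie among the
  lattice points at distance less than \<open>2 * e\<close> from \<open>y\<close>, of which there are at most 4 per coordinate.
  Otherwise \<open>f\<close> exceeds \<open>l\<close> on the part of \<open>W\<close> in the box of twice the radius, which contains all
  peaks, so two peaks in the same rectangle are connected through lattice points of the excursion set.\<close>

lemma card_peak_boxes_le:
  fixes f :: "real ^ 'n \<Rightarrow> real" and i j :: 'n and I :: "nat \<Rightarrow> 'n \<Rightarrow> real set"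
  assumes e: "e > 0" and ij: "UNIV = {i, j}" "i \<noteq> j"
    and W: "W = (\<Union>k<m. rectangle (I k))" "\<And>k. k < m \<Longrightarrow> rect_sides (I k)"
    and F: "excursion W f l F" and L: "L > 0"
    and lip: "\<And>x y. x \<in> W \<Longrightarrow> y \<in> W \<Longrightarrow> \<bar>f x - f y\<bar> \<le> L * dist x y"
    and fam: "finite \<D>" "\<And>D. D \<in> \<D> \<Longrightarrow> D \<in> path_components_of (top_of_set (pixelation e F))"
    and P: "\<And>D. D \<in> \<D> \<Longrightarrow> P D \<in> D" "\<And>D. D \<in> \<D> \<Longrightarrow> P D \<in> lattice_points e F"
    and R: "\<And>D. R D = max (2 * e) ((f (P D) - l) / (8 * L))"
  shows "card {D \<in> \<D>. \<forall>c. \<bar>y $ c - P D $ c\<bar> < R D} \<le> 16 + m"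
proof -
  define S where "S = {D \<in> \<D>. \<forall>c. \<bar>y $ c - P D $ c\<bar> < R D}"
  have two: "c = i \<or> c = j" for c using ij(1) by (metis UNIV_I insertE singletonD)
  have finS: "finite S" using fam(1) by (simp add: S_def)
  have uniq: "D = D'" if "D \<in> S" "D' \<in> S" "P D' \<in> D" for D D'
  proof -
    have "\<not> disjnt D D'" using that P(1)[of D'] by (auto simp: S_def disjnt_def)
    moreover have "D \<in> path_components_of (top_of_set (pixelation e F))"
      "D' \<in> path_components_of (top_of_set (pixelation e F))"
      using that(1,2) fam(2) by (simp_all add: S_def)
    ultimately show ?thesis
      using pairwise_disjoint_path_components_of[of "top_of_set (pixelation e F)"]
      unfolding pairwise_def by blast
  qed
  show ?thesis
  proof (cases "S = {}")
    case True
    then show ?thesis unfolding S_def[symmetric] by simp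
  next
    case False
    have "Max (R ` S) \<in> R ` S" using finS False by (intro Max_in) auto
    then obtain D0 where D0: "D0 \<in> S" "Max (R ` S) = R D0" by auto
    have max: "R D \<le> R D0" if "D \<in> S" for D
      unfolding D0(2)[symmetric] using finS that by (intro Max_ge) auto
    show ?thesis
    proof (cases "R D0 = 2 * e")
      case True
      define \<phi> where "\<phi> D = (\<lfloor>P D $ i / e\<rfloor>, \<lfloor>P D $ j / e\<rfloor>)" for D
      define Z where "Z c = {\<lfloor>y $ c / e\<rfloor> - 1..\<lfloor>y $ c / e\<rfloor> + 2}" for c
      have lat: "P D $ c = e * of_int \<lfloor>P D $ c / e\<rfloor> \<and> \<lfloor>P D $ c / e\<rfloor> \<in> Z c" if DS: "D \<in> S" for D c
      proof -
        obtain z :: int where z: "P D $ c = e * of_int z"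
          using P(2)[of D] DS by (auto simp: lattice_points_def S_def)
        then have fl: "\<lfloor>P D $ c / e\<rfloor> = z" using e by simp
        have "R D \<le> 2 * e" using max[OF DS] True by simp
        moreover have "\<bar>y $ c - P D $ c\<bar> < R D" using DS unfolding S_def by blast
        ultimately have "\<bar>y $ c - e * of_int z\<bar> < 2 * e" unfolding z by linarith
        moreover have "y $ c - e * of_int z = e * (y $ c / e - of_int z)" using e by (simp add: field_simps)
        ultimately have "\<bar>y $ c / e - of_int z\<bar> < 2" using e by (simp add: abs_mult)
        then have "z \<in> Z c" unfolding Z_def atLeastAtMost_iff by linarith
        then show ?thesis using z fl by simp
      qed
      have "card S \<le> card (Z i \<times> Z j)"
      proof (rule card_inj_on_le)
        show "inj_on \<phi> S"
        proof (rule inj_onI)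
          fix D D' assume DD: "D \<in> S" "D' \<in> S" "\<phi> D = \<phi> D'"
          have "P D $ c = P D' $ c" for c
            using lat[OF DD(1), of c] lat[OF DD(2), of c] DD(3) two[of c] by (auto simp: \<phi>_def)
          then have "P D = P D'" by (simp add: vec_eq_iff)
          then show "D = D'" using uniq[OF DD(1,2)] P(1)[of D] DD(1) by (auto simp: S_def)
        qed
        show "\<phi> ` S \<subseteq> Z i \<times> Z j" using lat by (auto simp: \<phi>_def)
        show "finite (Z i \<times> Z j)" by (simp add: Z_def)
      qed
      also have "\<dots> = 16" by (simp add: Z_def card_cartesian_product)
      finally show ?thesis unfolding S_def[symmetric] by simp
    next
      case False
      define h where "h = f (P D0) - l"
      have R0: "R D0 = h / (8 * L)" "R D0 > 0" "h > 0"
      proof -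
        show "R D0 = h / (8 * L)" using False R[of D0] by (auto simp: h_def max_def split: if_splits)
        show pos: "R D0 > 0" using R[of D0] e by simp
        then show "h > 0" using L unfolding \<open>R D0 = h / (8 * L)\<close> by (simp add: zero_less_divide_iff)
      qed
      have FW: "F \<subseteq> W" "{x \<in> W. f x > l} \<subseteq> F" using F by (auto simp: excursion_def)
      have PW: "P D \<in> W" if "D \<in> S" for D using P(2)[of D] that FW(1) by (auto simp: S_def lattice_points_def)
      then have "\<forall>D\<in>S. \<exists>k<m. P D \<in> rectangle (I k)" unfolding W(1) by auto
      then obtain \<kappa> where \<kappa>: "\<And>D. D \<in> S \<Longrightarrow> \<kappa> D < m \<and> P D \<in> rectangle (I (\<kappa> D))" by metis
      have nearF: "x \<in> F" if x: "x \<in> W" "\<And>c. \<bar>x $ c - P D0 $ c\<bar> < 2 * R D0" for x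
      proof -
        have "CARD('n) = 2" using ij by (metis card_2_iff)
        moreover have "norm (x - P D0) \<le> real CARD('n) * (2 * R D0)"
          using x(2) by (intro norm_le_card_cart) (auto intro: less_imp_le)
        ultimately have "L * dist x (P D0) \<le> L * (4 * R D0)"
          using L by (intro mult_left_mono) (auto simp: dist_norm)
        also have "\<dots> = h / 2" using R0(1) L by simp
        finally have "\<bar>f x - f (P D0)\<bar> \<le> h / 2" using lip[OF x(1) PW[OF D0(1)]] by linarith
        then have "f (P D0) - f x \<le> h / 2" by (simp only: abs_le_iff minus_diff_eq)
        then have "f x \<ge> f (P D0) - h / 2" by simp
        moreover have "f (P D0) - h / 2 > l" using R0(3) by (simp add: h_def field_simps)
        ultimately have "f x > l" by (rule less_le_trans[rotated])
        then show ?thesis using x(1) FW(2) by blast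
      qed
      have "inj_on \<kappa> S"
      proof (rule inj_onI)
        fix D D' assume DD: "D \<in> S" "D' \<in> S" "\<kappa> D = \<kappa> D'"
        define J where "J c = I (\<kappa> D) c \<inter> {P D0 $ c - 2 * R D0<..<P D0 $ c + 2 * R D0}" for c
        have k: "\<kappa> D < m" using \<kappa>[OF DD(1)] by simp
        have J: "is_interval (J c)" for c
          using W(2)[OF k] unfolding J_def rect_sides_def by (intro is_interval_Int) (auto simp: is_interval_oo)
        have mem: "P D'' \<in> lattice_points e {x. \<forall>c. x $ c \<in> J c}" if D'': "D'' \<in> S" "\<kappa> D'' = \<kappa> D" for D''
        proof -
          have "\<bar>P D'' $ c - P D0 $ c\<bar> < 2 * R D0" for c
          proof -
            have "\<bar>y $ c - P D'' $ c\<bar> < R D''" "\<bar>y $ c - P D0 $ c\<bar> < R D0" using D''(1) D0(1) by (auto simp: S_def)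
            then show ?thesis using max[OF D''(1)] by linarith
          qed
          then have "P D'' $ c \<in> J c" for c
            using \<kappa>[OF D''(1)] D''(2) unfolding J_def by (auto simp: rectangle_def abs_less_iff algebra_simps)
          then show ?thesis using P(2)[of D''] D''(1) by (auto simp: S_def lattice_points_def)
        qed
        have sub: "lattice_points e {x. \<forall>c. x $ c \<in> J c} \<subseteq> F"
        proof
          fix x assume "x \<in> lattice_points e {x. \<forall>c. x $ c \<in> J c}"
          then have x: "x $ c \<in> J c" for c by (simp add: lattice_points_def)
          have "x \<in> W" unfolding W(1) using x k by (auto simp: J_def rectangle_def)
          moreover have "\<bar>x $ c - P D0 $ c\<bar> < 2 * R D0" for c using x[of c] by (auto simp: J_def abs_less_iff)
          ultimately show "x \<in> F" by (rule nearF)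
        qed
        have "D \<in> path_components_of (top_of_set (pixelation e F))" "P D \<in> D"
          using DD(1) fam(2) P(1) by (auto simp: S_def)
        then have "P D' \<in> D"
          using rectangle_lattice_connected[OF e ij _ J sub mem[OF DD(1) refl] _ mem[OF DD(2)]] DD(3) by metis
        then show "D = D'" by (rule uniq[OF DD(1,2)])
      qed
      then have "card S \<le> card {..<m}"
        using \<kappa> by (intro card_inj_on_le[of \<kappa>]) auto
      then show ?thesis unfolding S_def[symmetric] by simp
    qed
  qed
qed

text \<open>The case of a constant function. Each of the \<open>m\<close> rectangles meets at most one component. If there is a
  bounded component, then \<open>W\<close> has a corner: otherwise some line through a lattice point of
  the component would stay in \<open>W\<close> for an arbitrarily long distance.\<close>

lemma pixel_components_of_polyrectangle_le:
  fixes W :: "(real ^ 'n) set" and i j :: 'n and I :: "nat \<Rightarrow> 'n \<Rightarrow> real set"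
  assumes "polyrectangle W" and e: "e > 0" and ij: "UNIV = {i, j}" "i \<noteq> j"
    and W: "W = (\<Union>k<m. rectangle (I k))" "\<And>k. k < m \<Longrightarrow> rect_sides (I k)"
    and fam: "finite \<D>" "\<D> \<subseteq> bounded_components (pixelation e W)"
  shows "of_nat (card \<D>) \<le> of_nat m * ncard (corners W)"
proof (cases "\<D> = {}")
  case False
  have pc: "D \<in> path_components_of (top_of_set (pixelation e W))" "bounded D" if "D \<in> \<D>" for D
    using that fam(2) by (auto simp: bounded_components_def)
  have "\<forall>D\<in>\<D>. \<exists>p k. p \<in> D \<and> p \<in> lattice_points e W \<and> k < m \<and> p \<in> rectangle (I k)"
  proof
    fix D assume "D \<in> \<D>"
    then obtain p where p: "p \<in> D" "p \<in> lattice_points e W"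
      using pixel_component_peak[OF e, of D W "\<lambda>_. 0"] fam(2) by blast
    then obtain k where "k < m" "p \<in> rectangle (I k)" unfolding lattice_points_def W(1) by auto
    then show "\<exists>p k. p \<in> D \<and> p \<in> lattice_points e W \<and> k < m \<and> p \<in> rectangle (I k)" using p by blast
  qed
  then obtain P \<kappa> where P: "\<And>D. D \<in> \<D> \<Longrightarrow> P D \<in> D \<and> P D \<in> lattice_points e W \<and> \<kappa> D < m \<and> P D \<in> rectangle (I (\<kappa> D))"
    by metis
  have "inj_on \<kappa> \<D>"
  proof (rule inj_onI)
    fix D D' assume DD: "D \<in> \<D>" "D' \<in> \<D>" "\<kappa> D = \<kappa> D'"
    have k: "\<kappa> D < m" using P[OF DD(1)] by simp
    have J: "is_interval (I (\<kappa> D) c)" for c using W(2)[OF k] by (simp add: rect_sides_def)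
    have mem: "P D'' \<in> lattice_points e {x. \<forall>c. x $ c \<in> I (\<kappa> D) c}" if "D'' \<in> \<D>" "\<kappa> D'' = \<kappa> D" for D''
      using P[OF that(1)] that(2) by (simp add: lattice_points_def rectangle_def)
    have sub: "lattice_points e {x. \<forall>c. x $ c \<in> I (\<kappa> D) c} \<subseteq> W"
      using k unfolding W(1) by (auto simp: lattice_points_def rectangle_def)
    have "P D' \<in> D"
      using rectangle_lattice_connected[OF e ij pc(1)[OF DD(1)] J sub mem[OF DD(1) refl] _ mem[OF DD(2)]] DD(3) P[OF DD(1)] by metis
    then have "\<not> disjnt D D'" using P[OF DD(2)] by (auto simp: disjnt_def)
    then show "D = D'"
      using pairwise_disjoint_path_components_of[of "top_of_set (pixelation e W)"] pc(1)[OF DD(1)] pc(1)[OF DD(2)]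
      unfolding pairwise_def by blast
  qed
  then have "card \<D> \<le> card {..<m}" using P by (intro card_inj_on_le[of \<kappa>]) auto
  then have le: "card \<D> \<le> m" by simp
  have "corners W \<noteq> {}"
  proof
    assume no: "corners W = {}"
    obtain D where D: "D \<in> \<D>" using False by blast
    obtain B where B: "\<And>x. x \<in> D \<Longrightarrow> norm x \<le> B" using pc(2)[OF D] unfolding bounded_iff by blast
    obtain n :: nat where n: "2 * B / e < real n" using reals_Archimedean2 by blast
    have PD: "P D \<in> W" "P D \<in> lattice_points e W" "P D \<in> D" using P[OF D] by (auto simp: lattice_points_def)
    have "e * real n + 1 > 0" using e by (simp add: add_nonneg_pos)
    then obtain J x where J: "J \<noteq> {}" "\<And>c t. c \<in> J \<Longrightarrow> \<bar>t\<bar> < e * real n + 1 \<Longrightarrow> P D + t *\<^sub>R axis c 1 \<in> W"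
      using free_slice_without_corners[OF assms(1) ij PD(1), of "e * real n + 1"] no by (metis empty_iff)
    then obtain c where c: "c \<in> J" by blast
    have "P D + (e * of_int (int n)) *\<^sub>R axis c 1 \<in> D"
    proof (rule pixel_component_contains_lattice_step[OF e pc(1)[OF D] PD(2,3)])
      fix k :: int assume "min 0 (int n) \<le> k" "k \<le> max 0 (int n)"
      then have "0 \<le> e * of_int k" "e * of_int k \<le> e * real n" using e by auto
      then show "P D + (e * of_int k) *\<^sub>R axis c 1 \<in> W" by (intro J(2)[OF c]) auto
    qed
    then have "norm (P D + (e * real n) *\<^sub>R axis c 1) \<le> B" using B by simp
    moreover have "norm (P D) \<le> B" using B PD(3) by blast
    moreover have "norm ((e * real n) *\<^sub>R axis c (1::real)) \<le> norm (P D + (e * real n) *\<^sub>R axis c 1) + norm (P D)"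
      using norm_triangle_ineq4[of "P D + (e * real n) *\<^sub>R axis c 1" "P D"] by simp
    ultimately have "e * real n \<le> 2 * B" using e by simp
    then show False using n e by (simp add: field_simps)
  qed
  then obtain v where "v \<in> corners W" by blast
  then have "of_nat (card {v}) \<le> ncard (corners W)" by (intro card_le_ncard[of _ id]) auto
  then have "1 \<le> ncard (corners W)" by simp
  then have "of_nat m * 1 \<le> of_nat m * ncard (corners W)" by (rule mult_left_mono) simp
  moreover have "of_nat (card \<D>) \<le> (of_nat m * 1 :: ennreal)" using le by simp
  ultimately show ?thesis by (rule order_trans[rotated])
qed simp

text \<open>Every component is charged to a corner of \<open>W\<close> or to a flat slice of dimension 1 or 2 in the
  square around its peak. At the peak \<open>f\<close> exceeds \<open>l\<close> by at most \<open>8 * L * R\<close>, and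
  the points of the square are closer than \<open>2 * R\<close> to the peak, so on the slice the maximum in the weight is at most \<open>10 * L * R\<close>; its measure is at least
  \<open>R ^ k\<close> times the volume of the unit ball. The mass of the slice, including the factor
  \<open>L ^ k\<close>, is thus bounded below by a constant, in which \<open>R\<close> has cancelled.\<close>

lemma pixel_components_finite_scale:
  fixes f :: "real ^ 'n \<Rightarrow> real" and i j :: 'n and I :: "nat \<Rightarrow> 'n \<Rightarrow> real set"
  assumes poly: "polyrectangle W" and e: "e > 0" and ij: "UNIV = {i, j}" "i \<noteq> j"
    and W: "W = (\<Union>k<m. rectangle (I k))" "\<And>k. k < m \<Longrightarrow> rect_sides (I k)"
    and f: "C11_on W f" and F: "excursion W f l F"
    and L: "lip_scale W (\<lambda>x. f x - l) = ennreal L" "L > 0"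
    and nd: "\<not> (Lip W (\<lambda>x. f x - l) = 0 \<and> (\<forall>x\<in>W. f x - l = 0))"
    and fam: "finite \<D>" "\<D> \<subseteq> bounded_components (pixelation e F)"
  shows "of_nat (card \<D>) \<le>
    (\<Sum>k=0..2. ennreal (real (16 + m) * (10 ^ k * inverse (unit_ball_vol (real k)))) * I_val k W (\<lambda>x. f x - l))"
proof -
  let ?g = "\<lambda>x. f x - l"
  define N where "N = 16 + m"
  have lipf: "\<bar>f x - f y\<bar> \<le> L * dist x y" if "x \<in> W" "y \<in> W" for x y
    using lipschitz_of_Lip_le[OF _ _ that, of ?g L] Lip_le_lip_scale(1)[of W ?g] L by simp
  have lippd: "\<bar>pd W c f x - pd W c f y\<bar> \<le> L * dist x y" if "x \<in> W" "y \<in> W" for c x y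
    using lipschitz_of_Lip_le[OF _ _ that, of "pd W c f" L] Lip_le_lip_scale(2)[of W c ?g] L by simp
  have FW: "F \<subseteq> W" "\<And>x. x \<in> F \<Longrightarrow> f x \<ge> l" using F by (auto simp: excursion_def)
  have card2: "CARD('n) = 2" using ij by (metis card_2_iff)
  have pc: "D \<in> path_components_of (top_of_set (pixelation e F))" if "D \<in> \<D>" for D
    using that fam(2) by (auto simp: bounded_components_def)
  have "\<forall>D\<in>\<D>. \<exists>p. p \<in> D \<and> p \<in> lattice_points e F \<and> (\<forall>q. q \<in> lattice_points e F \<longrightarrow> q \<in> D \<longrightarrow> f q \<le> f p)"
    using pixel_component_peak[OF e, of _ F f] fam(2) by (metis subsetD)
  then obtain P where P: "\<And>D. D \<in> \<D> \<Longrightarrow> P D \<in> D" "\<And>D. D \<in> \<D> \<Longrightarrow> P D \<in> lattice_points e F"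
      "\<And>D q. D \<in> \<D> \<Longrightarrow> q \<in> lattice_points e F \<Longrightarrow> q \<in> D \<Longrightarrow> f q \<le> f (P D)"
    by metis
  define R where "R D = max (2 * e) ((f (P D) - l) / (8 * L))" for D
  have R: "R D > 0" "2 * e \<le> R D" "f (P D) - l \<le> 8 * L * R D" for D
  proof -
    show "2 * e \<le> R D" by (simp add: R_def)
    then show "R D > 0" using e by simp
    have "(f (P D) - l) / (8 * L) \<le> R D" by (simp add: R_def)
    then show "f (P D) - l \<le> 8 * L * R D" using L(2) by (simp add: field_simps)
  qed
  have PF: "P D \<in> F" "P D \<in> W" if "D \<in> \<D>" for D using P(2)[OF that] FW(1) by (auto simp: lattice_points_def)
  define Q where "Q D = {x. \<forall>c. \<bar>x $ c - P D $ c\<bar> < R D}" for D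
  have overlap: "card {D \<in> T. x \<in> Q D} \<le> N" if "T \<subseteq> \<D>" for T x
  proof -
    have "card {D \<in> T. x \<in> Q D} \<le> card {D \<in> \<D>. x \<in> Q D}"
      using that fam(1) by (intro card_mono) auto
    also have "\<dots> \<le> N" unfolding Q_def N_def mem_Collect_eq
      by (rule card_peak_boxes_le[OF e ij W F L(2) lipf fam(1) pc P(1,2) R_def])
    finally show ?thesis .
  qed
  define T0 where "T0 = {D \<in> \<D>. corners W \<inter> Q D \<noteq> {}}"
  have T0: "of_nat (card T0) \<le> of_nat N * ncard (corners W)"
  proof (cases "finite (corners W)")
    case True
    have "T0 \<subseteq> (\<Union>v\<in>corners W. {D \<in> \<D>. v \<in> Q D})" by (auto simp: T0_def)
    then have "card T0 \<le> card (\<Union>v\<in>corners W. {D \<in> \<D>. v \<in> Q D})"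
      using True fam(1) by (intro card_mono) auto
    also have "\<dots> \<le> (\<Sum>v\<in>corners W. card {D \<in> \<D>. v \<in> Q D})" by (rule card_UN_le[OF True])
    also have "\<dots> \<le> (\<Sum>v\<in>corners W. N)" by (intro sum_mono overlap) auto
    finally have "card T0 \<le> N * card (corners W)" by (simp add: mult.commute)
    then have "(of_nat (card T0) :: ennreal) \<le> of_nat (N * card (corners W))" by (simp only: of_nat_le_iff)
    then show ?thesis using True by (simp add: ncard_finite)
  next
    case False
    then have "ncard (corners W) = top" unfolding ncard_def by simp
    then show ?thesis by (simp add: ennreal_mult_top N_def)
  qed
  define good where "good D J x \<longleftrightarrow> J \<noteq> {} \<and>
      (\<forall>z\<in>flat_slice J (P D) x (R D). z \<in> W \<and> z \<in> Q D \<and> free_dirs W z = J) \<and>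
      (\<forall>c\<in>J. \<forall>t. \<bar>t\<bar> < R D \<longrightarrow> P D + t *\<^sub>R axis c 1 \<in> W)" for D J x
  have "\<forall>D\<in>\<D> - T0. \<exists>J x. good D J x"
  proof
    fix D assume D: "D \<in> \<D> - T0"
    have PD: "P D \<in> W" using D PF by blast
    have nc: "x \<notin> corners W" if "\<And>c. \<bar>x $ c - P D $ c\<bar> < R D" for x
      using D that by (auto simp: T0_def Q_def)
    show "\<exists>J x. good D J x"
    proof (rule free_slice_without_corners[OF poly ij PD R(1)[of D]])
      fix x assume "\<And>c. \<bar>x $ c - P D $ c\<bar> < R D"
      then show "x \<notin> corners W" by (rule nc)
    next
      fix J x assume J: "J \<noteq> {}"
        "\<And>z. z \<in> flat_slice J (P D) x (R D) \<Longrightarrow> z \<in> W \<and> (\<forall>c. \<bar>z $ c - P D $ c\<bar> < R D) \<and> free_dirs W z = J"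
        "\<And>c t. c \<in> J \<Longrightarrow> \<bar>t\<bar> < R D \<Longrightarrow> P D + t *\<^sub>R axis c 1 \<in> W"
      show ?thesis
        unfolding good_def
        by (intro exI[of _ J] exI[of _ x] conjI ballI allI impI J(1)) (use J(2,3) in \<open>auto simp: Q_def\<close>)
    qed
  qed
  then obtain J X where JX: "\<And>D. D \<in> \<D> - T0 \<Longrightarrow> good D (J D) (X D)" by metis
  define T where "T k = {D \<in> \<D> - T0. card (J D) = k}" for k
  have T: "of_nat (card (T k)) \<le> ennreal (real N * (10 ^ k * inverse (unit_ball_vol (real k)))) * I_val k W ?g"
    if k: "k > 0" for k
  proof -
    define \<kappa> where "\<kappa> = unit_ball_vol (real k)"
    have \<kappa>: "\<kappa> > 0" by (simp add: \<kappa>_def)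
    define E where "E D = flat_slice (J D) (P D) (X D) (R D)" for D
    define \<beta> where "\<beta> D = inverse ((10 * L * R D) ^ k)" for D
    define v where "v D x = ennreal (\<beta> D) * indicator (E D) x" for D x
    define \<phi> where "\<phi> x = critical_weight W ?g k x * indicator (bdry k W) x" for x
    have finT: "finite (T k)" using fam(1) by (simp add: T_def)
    have E_sets: "E D \<in> sets (hausdorff k)" for D by (simp add: E_def borel_flat_slice)
    have mass: "ennreal (\<kappa> / (10 * L) ^ k) \<le> (\<integral>\<^sup>+x. v D x \<partial>hausdorff k)" if D: "D \<in> T k" for D
    proof -
      have kD: "card (J D) = k" "D \<in> \<D> - T0" using D by (auto simp: T_def)
      have good: "J D \<noteq> {}" using JX[OF kD(2)] by (simp add: good_def)
      have "\<kappa> / (10 * L) ^ k = \<beta> D * (\<kappa> * R D ^ k)"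
        using R(1)[of D] L(2) by (simp add: \<beta>_def power_mult_distrib field_simps)
      then have "ennreal (\<kappa> / (10 * L) ^ k) = ennreal (\<beta> D) * ennreal (\<kappa> * R D ^ k)"
        using R(1)[of D] L(2) by (simp add: \<beta>_def ennreal_mult')
      also have "\<dots> \<le> ennreal (\<beta> D) * hausdorff_outer k (E D)"
        using hausdorff_flat_slice[OF good R(1)[of D], of "P D" "X D"] kD(1)
        by (intro mult_left_mono) (auto simp: E_def \<kappa>_def)
      also have "\<dots> = ennreal (\<beta> D) * emeasure (hausdorff k) (E D)"
        using E_sets[of D] by (simp add: emeasure_hausdorff)
      also have "\<dots> = (\<integral>\<^sup>+x. v D x \<partial>hausdorff k)"
        unfolding v_def by (rule nn_integral_cmult_indicator[OF E_sets, symmetric])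
      finally show ?thesis .
    qed
    have "of_nat (card (T k)) * ennreal (\<kappa> / (10 * L) ^ k) = (\<Sum>D\<in>T k. ennreal (\<kappa> / (10 * L) ^ k))" by simp
    also have "\<dots> \<le> (\<Sum>D\<in>T k. \<integral>\<^sup>+x. v D x \<partial>hausdorff k)" by (intro sum_mono mass)
    also have "\<dots> \<le> of_nat N * (\<integral>\<^sup>+x. \<phi> x \<partial>hausdorff k)"
    proof (rule sum_nn_integral_le_overlap[OF finT])
      fix D assume D: "D \<in> T k"
      show "v D \<in> borel_measurable (hausdorff k)"
        unfolding v_def using E_sets[of D] by measurable
      have kD: "card (J D) = k" "D \<in> \<D> - T0" "D \<in> \<D>" using D by (auto simp: T_def)
      fix z
      show "v D z \<le> (if z \<in> Q D then \<phi> z else 0)"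
      proof (cases "z \<in> E D")
        case True
        then have z: "z \<in> W" "z \<in> Q D" "free_dirs W z = J D" using JX[OF kD(2)] by (auto simp: E_def good_def)
        have "norm (z - P D) \<le> real CARD('n) * R D"
          using z(2) by (intro norm_le_card_cart) (auto simp: Q_def intro: less_imp_le)
        then have d: "L * dist z (P D) \<le> L * (2 * R D)"
          using L(2) card2 by (intro mult_left_mono) (auto simp: dist_norm)
        have LR: "L * R D > 0" using L(2) R(1)[of D] by simp
        have "\<bar>?g z\<bar> \<le> 10 * L * R D"
        proof -
          have "\<bar>f z - f (P D)\<bar> \<le> L * (2 * R D)" using lipf[OF z(1) PF(2)[OF kD(3)]] d by linarith
          moreover have "f (P D) \<ge> l" using FW(2) PF(1)[OF kD(3)] by blast
          ultimately show ?thesis using R(3)[of D] LR by (simp add: algebra_simps)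
        qed
        moreover have "\<bar>pd W c ?g z\<bar> \<le> 10 * L * R D" if c: "c \<in> free_dirs W z" for c
        proof -
          have "e < R D" using R(2)[of D] e by linarith
          moreover have "P D + t *\<^sub>R axis c 1 \<in> W" if "\<bar>t\<bar> < R D" for t
            using JX[OF kD(2)] c z(3) that by (simp add: good_def)
          ultimately have "\<bar>pd W c f (P D)\<bar> \<le> L * e"
            using L(2) kD(3)
            by (intro peak_derivative_le[OF e _ f F _ lippd pc[OF kD(3)] P(1)[OF kD(3)] P(2)[OF kD(3)] P(3)[OF kD(3)]]) auto
          also have "\<dots> \<le> L * R D" using L(2) R(2)[of D] e by (intro mult_left_mono) linarith+
          finally have "\<bar>pd W c f (P D)\<bar> \<le> L * R D" .
          moreover have "\<bar>pd W c f z - pd W c f (P D)\<bar> \<le> L * (2 * R D)"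
            using lippd[OF z(1) PF(2)[OF kD(3)], of c] d by linarith
          ultimately have "\<bar>pd W c f z\<bar> \<le> 10 * L * R D" using LR by (simp add: algebra_simps)
          then show ?thesis by simp
        qed
        ultimately have "ennreal (\<beta> D) \<le> critical_weight W ?g k z"
          unfolding \<beta>_def using LR by (intro critical_weight_ge) auto
        moreover have "z \<in> bdry k W" using z kD(1) by (simp add: bdry_def)
        ultimately show ?thesis using True z(2) by (simp add: v_def \<phi>_def)
      qed (simp add: v_def)
    next
      show "card {D \<in> T k. x \<in> Q D} \<le> N" for x by (rule overlap) (auto simp: T_def)
    qed
    finally have "ennreal ((10 * L) ^ k * inverse \<kappa>) * (ennreal (\<kappa> / (10 * L) ^ k) * of_nat (card (T k)))
        \<le> ennreal ((10 * L) ^ k * inverse \<kappa>) * (of_nat N * (\<integral>\<^sup>+x. \<phi> x \<partial>hausdorff k))"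
      by (intro mult_left_mono) (simp_all add: mult.commute)
    moreover have "ennreal ((10 * L) ^ k * inverse \<kappa>) * (ennreal (\<kappa> / (10 * L) ^ k) * of_nat (card (T k))) = of_nat (card (T k))"
      using \<kappa> L(2) by (subst ennreal_mult_assoc_real) simp_all
    moreover have "ennreal ((10 * L) ^ k * inverse \<kappa>) * (of_nat N * Y) =
        ennreal (real N * (10 ^ k * inverse \<kappa>)) * (ennreal L ^ k * Y)" for Y
    proof -
      have "ennreal ((10 * L) ^ k * inverse \<kappa>) * (ennreal (real N) * Y) = ennreal ((10 * L) ^ k * inverse \<kappa> * real N) * Y"
        using \<kappa> L(2) by (intro ennreal_mult_assoc_real) simp
      also have "(10 * L) ^ k * inverse \<kappa> * real N = real N * (10 ^ k * inverse \<kappa>) * L ^ k"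
        by (simp add: power_mult_distrib)
      also have "ennreal (real N * (10 ^ k * inverse \<kappa>) * L ^ k) * Y = ennreal (real N * (10 ^ k * inverse \<kappa>)) * (ennreal (L ^ k) * Y)"
        using \<kappa> by (intro ennreal_mult_assoc_real[symmetric]) simp
      finally show ?thesis using L(2) by (simp add: ennreal_of_nat_eq_real_of_nat ennreal_power)
    qed
    ultimately show ?thesis
      by (simp add: I_val_eq[OF k nd] L(1) \<phi>_def \<kappa>_def)
  qed
  have "\<D> = T0 \<union> (T 1 \<union> T 2)"
  proof -
    have "card (J D) = 1 \<or> card (J D) = 2" if "D \<in> \<D> - T0" for D
    proof -
      have "card (J D) \<le> 2" using card_mono[of UNIV "J D"] card2 by simp
      moreover have "card (J D) \<noteq> 0" using JX[OF that] by (simp add: good_def)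
      ultimately show ?thesis by linarith
    qed
    then show ?thesis by (auto simp: T_def T0_def)
  qed
  then have "card \<D> \<le> card T0 + (card (T 1) + card (T 2))"
    by (metis card_Un_le add_left_mono order_trans)
  then have "(of_nat (card \<D>) :: ennreal) \<le> of_nat (card T0 + (card (T 1) + card (T 2)))" by (simp only: of_nat_le_iff)
  also have "\<dots> = of_nat (card T0) + (of_nat (card (T 1)) + of_nat (card (T 2)))" by simp
  also have "\<dots> \<le> of_nat N * ncard (corners W) + (ennreal (real N * (10 ^ 1 * inverse (unit_ball_vol (real 1)))) * I_val 1 W ?g +
       ennreal (real N * (10 ^ 2 * inverse (unit_ball_vol (real 2)))) * I_val 2 W ?g)"
    by (intro add_mono T0 T) auto
  also have "\<dots> = (\<Sum>k=0..2. ennreal (real N * (10 ^ k * inverse (unit_ball_vol (real k)))) * I_val k W ?g)"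
    by (simp add: numeral_2_eq_2 I_val_def[of 0] ennreal_of_nat_eq_real_of_nat add.assoc)
  finally show ?thesis unfolding N_def .
qed

section \<open>The two bounds\<close>

lemma pixel_components_bound:
  fixes W :: "(real ^ 'n) set"
  assumes poly: "polyrectangle W" and card2: "CARD('n) = 2"
  shows "\<exists>C::real. C > 0 \<and> (\<forall>f l F \<epsilon>. C11_on W f \<longrightarrow>
      F = {x \<in> W. f x \<ge> l} \<or> F = {x \<in> W. f x > l} \<longrightarrow> \<epsilon> > 0 \<longrightarrow>
      ncard (bounded_components (pixelation \<epsilon> F)) \<le> ennreal C * (\<Sum>k=0..2. I_val k W (\<lambda>x. f x - l)))"
proof -
  obtain i j :: 'n where ij: "UNIV = {i, j}" "i \<noteq> j" using card2 by (metis card_2_iff)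
  from poly obtain m and I :: "nat \<Rightarrow> 'n \<Rightarrow> real set" where W: "W = (\<Union>k<m. rectangle (I k))" "\<And>k. k < m \<Longrightarrow> rect_sides (I k)"
    unfolding polyrectangle_def by blast
  define \<gamma> where "\<gamma> k = real (16 + m) * (10 ^ k * inverse (unit_ball_vol (real k)))" for k :: nat
  define C where "C = (\<Sum>k=0..2. \<gamma> k)"
  have \<gamma>: "\<gamma> k > 0" for k unfolding \<gamma>_def by simp
  have \<gamma>C: "\<gamma> k \<le> C" if "k \<le> 2" for k
    unfolding C_def using that \<gamma> by (intro member_le_sum) (auto intro: less_imp_le)
  have C: "C > 0" using \<gamma>[of 0] \<gamma>C[of 0] by simp
  have "ncard (bounded_components (pixelation \<epsilon> F)) \<le> ennreal C * (\<Sum>k=0..2. I_val k W (\<lambda>x. f x - l))"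
    if f: "C11_on W f" and F: "F = {x \<in> W. f x \<ge> l} \<or> F = {x \<in> W. f x > l}" and \<epsilon>: "\<epsilon> > 0" for f l F \<epsilon>
  proof (rule ncard_le_of_finite_subsets)
    let ?g = "\<lambda>x. f x - l"
    fix \<D> assume fam: "finite \<D>" "\<D> \<subseteq> bounded_components (pixelation \<epsilon> F)"
    have exc: "excursion W f l F" using F by (auto simp: excursion_def)
    show "of_nat (card \<D>) \<le> ennreal C * (\<Sum>k=0..2. I_val k W ?g)"
    proof (cases "\<D> = {}")
      case False
      then obtain D where "D \<in> bounded_components (pixelation \<epsilon> F)" using fam(2) by blast
      then obtain x0 where "x0 \<in> lattice_points \<epsilon> F" using pixel_component_peak[OF \<epsilon>, of D F f] by blast
      then have x0: "x0 \<in> F" "x0 \<in> W" using exc by (auto simp: lattice_points_def excursion_def)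
      show ?thesis
      proof (cases "Lip W ?g = 0")
        case True
        have "\<bar>?g x - ?g x0\<bar> \<le> 0 * dist x x0" if "x \<in> W" for x
          using lipschitz_of_Lip_le[of W ?g 0, OF _ _ that x0(2)] True by simp
        then have const: "f x = f x0" if "x \<in> W" for x using that by simp
        have "W \<subseteq> F"
        proof
          fix x assume x: "x \<in> W"
          show "x \<in> F" using F x0(1) const[OF x] x by (elim disjE) simp_all
        qed
        then have "F = W" using exc by (auto simp: excursion_def)
        then have "of_nat (card \<D>) \<le> of_nat m * ncard (corners W)"
          using pixel_components_of_polyrectangle_le[OF poly \<epsilon> ij W fam(1)] fam(2) by simp
        also have "\<dots> = ennreal (real m) * I_val 0 W ?g"
          by (simp add: I_val_def ennreal_of_nat_eq_real_of_nat)
        also have "\<dots> \<le> ennreal C * (\<Sum>k=0..2. I_val k W ?g)"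
        proof (rule mult_mono)
          have "real m \<le> \<gamma> 0" by (simp add: \<gamma>_def)
          then show "ennreal (real m) \<le> ennreal C" using \<gamma>C[of 0] by (intro ennreal_leI) simp
          show "I_val 0 W ?g \<le> (\<Sum>k=0..2. I_val k W ?g)" by (rule member_le_sum) auto
        qed auto
        finally show ?thesis .
      next
        case False
        then have nd: "\<not> (Lip W ?g = 0 \<and> (\<forall>x\<in>W. ?g x = 0))" by simp
        show ?thesis
        proof (cases "lip_scale W ?g = top")
          case True
          have "I_val 2 W ?g = top"
            using I_val_infinite_scale[OF poly f _ True nd] x0(2) card2 by auto
          then have total: "(\<Sum>k=0..2. I_val k W ?g) = top"
            using member_le_sum[of 2 "{0..2}" "\<lambda>k. I_val k W ?g"] by (simp add: top_unique)
          show ?thesis unfolding total using C by (simp add: ennreal_mult_top)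
        next
          case False
          then obtain L where L: "lip_scale W ?g = ennreal L" "L \<ge> 0" by (metis ennreal_cases)
          have "L \<noteq> 0" using Lip_le_lip_scale(1)[of W ?g] L(1) \<open>Lip W ?g \<noteq> 0\<close> by auto
          then have "L > 0" using L(2) by simp
          have "of_nat (card \<D>) \<le> (\<Sum>k=0..2. ennreal (\<gamma> k) * I_val k W ?g)"
            unfolding \<gamma>_def by (rule pixel_components_finite_scale[OF poly \<epsilon> ij W f exc L(1) \<open>L > 0\<close> nd fam])
          also have "\<dots> \<le> (\<Sum>k=0..2. ennreal C * I_val k W ?g)"
            using \<gamma>C by (intro sum_mono mult_right_mono ennreal_leI) auto
          finally show ?thesis by (simp add: sum_distrib_left)
        qed
      qed
    qed simp
  qed
  then show ?thesis using C by blast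
qed

theorem theorem3:
  fixes W :: "(real ^ 'n) set"
  assumes "polyrectangle W"
  shows
    "(\<forall>(f :: real ^ 'n \<Rightarrow> real) (l::real) F.
        C11_on W f \<longrightarrow> regular_within W f l \<longrightarrow>
        F = {x \<in> W. f x \<ge> l} \<or> F = {x \<in> W. f x > l} \<longrightarrow>
        ncard (bounded_components (F \<inter> W)) \<le>
          (\<Sum>k=0..CARD('n). ennreal (2 ^ k * inverse (unit_ball_vol (real k))) *
             I_val k W (\<lambda>x. f x - l))) \<and>
     (CARD('n) = 2 \<longrightarrow>
       (\<exists>C::real. C > 0 \<and>
         (\<forall>(f :: real ^ 'n \<Rightarrow> real) (l::real) F (\<epsilon>::real).
            C11_on W f \<longrightarrow> regular_within W f l \<longrightarrow>
            F = {x \<in> W. f x \<ge> l} \<or> F = {x \<in> W. f x > l} \<longrightarrow> \<epsilon> > 0 \<longrightarrow>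
            ncard (bounded_components (pixelation \<epsilon> (F \<inter> W))) \<le>
              ennreal C * (\<Sum>k=0..2. I_val k W (\<lambda>x. f x - l)))))"
proof (intro conjI allI impI)
  fix f :: "real ^ 'n \<Rightarrow> real" and l :: real and F
  assume f: "C11_on W f" "regular_within W f l"
    and F: "F = {x \<in> W. f x \<ge> l} \<or> F = {x \<in> W. f x > l}"
  have "excursion W f l F" "F \<inter> W = F" using F by (auto simp: excursion_def)
  then show "ncard (bounded_components (F \<inter> W)) \<le>
          (\<Sum>k=0..CARD('n). ennreal (2 ^ k * inverse (unit_ball_vol (real k))) * I_val k W (\<lambda>x. f x - l))"
    using bounded_components_bound[OF assms f] by simp
next
  assume "CARD('n) = 2"
  from pixel_components_bound[OF assms this] obtain C :: real where C: "C > 0"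
    "\<And>f l F \<epsilon>. C11_on W f \<Longrightarrow> F = {x \<in> W. f x \<ge> l} \<or> F = {x \<in> W. f x > l} \<Longrightarrow> \<epsilon> > 0 \<Longrightarrow>
      ncard (bounded_components (pixelation \<epsilon> F)) \<le> ennreal C * (\<Sum>k=0..2. I_val k W (\<lambda>x. f x - l))"
    by blast
  show "\<exists>C::real. C > 0 \<and>
         (\<forall>(f :: real ^ 'n \<Rightarrow> real) (l::real) F (\<epsilon>::real).
            C11_on W f \<longrightarrow> regular_within W f l \<longrightarrow>
            F = {x \<in> W. f x \<ge> l} \<or> F = {x \<in> W. f x > l} \<longrightarrow> \<epsilon> > 0 \<longrightarrow>
            ncard (bounded_components (pixelation \<epsilon> (F \<inter> W))) \<le>
              ennreal C * (\<Sum>k=0..2. I_val k W (\<lambda>x. f x - l)))"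
  proof (intro exI[of _ C] conjI allI impI)
    fix f :: "real ^ 'n \<Rightarrow> real" and l \<epsilon> :: real and F
    assume f: "C11_on W f" and F: "F = {x \<in> W. f x \<ge> l} \<or> F = {x \<in> W. f x > l}" and \<epsilon>: "\<epsilon> > 0"
    have "F \<inter> W = F" using F by auto
    then show "ncard (bounded_components (pixelation \<epsilon> (F \<inter> W))) \<le> ennreal C * (\<Sum>k=0..2. I_val k W (\<lambda>x. f x - l))"
      using C(2)[OF f F \<epsilon>] by simp
  qed (rule C(1))
qed

end
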